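(* Let $N\in\{4,5,6\}$, let $\Omega\subset\mathbb{R}^N$ be a smooth bounded domain and let $\xi\in\Omega$. Then, for $\lambda>0$ close to zero, the problem $$-\Delta u=\lambda u+|u|^{2^*-2}u\ \text{ in }\Omega,\qquad u=0\ \text{ on }\partial\Omega,\qquad (P_\lambda)$$ admits no sign-changing solution $u_\lambda$ of the form $$u_\lambda=PU_{\delta_1,\xi}-PU_{\delta_2,\xi}+w_\lambda$$ with $\delta_i=\delta_i(\lambda)>0$, $i=1,2$, such that, as $\lambda\to0$, $\delta_2=o(\delta_1)$, $\|w_\lambda\|\to0$, and $|w_\lambda|=o(\delta_1^{-\frac{N-2}{2}})$, $|\nabla w_\lambda|=o(\delta_1^{-\frac N2})$ uniformly in compact subsets of $\Omega$. That is: there do not exist a set $\Lambda\subset(0,\infty)$ having $0$ as an accumulation point, functions $\delta_1,\delta_2:\Lambda\to(0,\infty)$, and a family $(u_\lambda)_{\lambda\in\Lambda}$ of sign-changing solutions of $(P_\lambda)$ such that, setting $w_\lambda:=u_\lambda-PU_{\delta_1(\lambda),\xi}+PU_{\delta_2(\lambda),\xi}$, one has, as $\lambda\to0$ in $\Lambda$: $\delta_2/\delta_1\to0$, $\|w_\lambda\|\to0$, and, for every compact $K\subset\Omega$, $\delta_1^{\frac{N-2}{2}}\sup_K|w_\lambda|\to0$ and $\delta_1^{\frac N2}\sup_K|\nabla w_\lambda|\to0$.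
   Context: $2^*=\frac{2N}{N-2}$ is the critical Sobolev exponent. For $\delta>0$, $\xi\in\mathbb{R}^N$, $$U_{\delta,\xi}(x)=\alpha_N\frac{\delta^{\frac{N-2}{2}}}{(\delta^2+|x-\xi|^2)^{\frac{N-2}{2}}},\qquad \alpha_N=[N(N-2)]^{\frac{N-2}{4}};$$ these are all the regular positive solutions of $-\Delta U=U^{\frac{N+2}{N-2}}$ in $\mathbb{R}^N$ with $U(x)\to0$ as $|x|\to\infty$. $PU_{\delta,\xi}$ denotes the projection of $U_{\delta,\xi}$ on $H_0^1(\Omega)$, i.e. the unique solution of $-\Delta PU_{\delta,\xi}=U_{\delta,\xi}^{\frac{N+2}{N-2}}$ in $\Omega$, $PU_{\delta,\xi}=0$ on $\partial\Omega$. The norm on $H_0^1(\Omega)$ is given by $\|u\|^2=\int_\Omega|\nabla u|^2\,dx$. *)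

theory Defs
  imports "HOL-Analysis.Analysis"
begin

subsection \<open>Smooth functions, test functions and smooth domains\<close>

definition partial_deriv :: "'n \<Rightarrow> (real^'n \<Rightarrow> real) \<Rightarrow> real^'n \<Rightarrow> real" where
  "partial_deriv i f x = frechet_derivative f (at x) (axis i 1)"

definition grad :: "(real^'n \<Rightarrow> real) \<Rightarrow> real^'n \<Rightarrow> real^'n" where
  "grad f x = (\<chi> i. partial_deriv i f x)"

primrec C_diff :: "nat \<Rightarrow> (real^'n \<Rightarrow> real) \<Rightarrow> bool" where
  "C_diff 0 f \<longleftrightarrow> continuous_on UNIV f"
| "C_diff (Suc k) f \<longleftrightarrow>
     (\<forall>x. f differentiable (at x)) \<and> (\<forall>i. C_diff k (partial_deriv i f))"

definition smooth :: "(real^'n \<Rightarrow> real) \<Rightarrow> bool" where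
  "smooth f \<longleftrightarrow> (\<forall>k. C_diff k f)"

definition test_functions :: "(real^'n) set \<Rightarrow> (real^'n \<Rightarrow> real) set" where
  "test_functions \<Omega> =
     {\<phi>. smooth \<phi> \<and> compact (closure {x. \<phi> x \<noteq> 0}) \<and> closure {x. \<phi> x \<noteq> 0} \<subseteq> \<Omega>}"

text \<open>
  Near every boundary point, the domain lies strictly above the graph of a smooth function in
  suitable orthonormal coordinates: \<open>e\<close> is the direction of the last axis, and \<open>\<gamma>\<close> is only
  evaluated on the hyperplane orthogonal to \<open>e\<close>.
\<close>
definition smooth_boundary :: "(real^'n) set \<Rightarrow> bool" where
  "smooth_boundary \<Omega> \<longleftrightarrow>
     (\<forall>x0 \<in> frontier \<Omega>. \<exists>r>0. \<exists>e \<gamma>. norm e = 1 \<and> smooth \<gamma> \<and>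
        \<Omega> \<inter> ball x0 r = {x \<in> ball x0 r. \<gamma> (x - (x \<bullet> e) *\<^sub>R e) < x \<bullet> e})"

definition smooth_bounded_domain :: "(real^'n) set \<Rightarrow> bool" where
  "smooth_bounded_domain \<Omega> \<longleftrightarrow>
     \<Omega> \<noteq> {} \<and> open \<Omega> \<and> connected \<Omega> \<and> bounded \<Omega> \<and> smooth_boundary \<Omega>"

subsection \<open>The space H01\<close>

definition square_integrable ::
    "(real^'n) set \<Rightarrow> (real^'n \<Rightarrow> 'b::euclidean_space) \<Rightarrow> bool" where
  "square_integrable \<Omega> f \<longleftrightarrow>
     f \<in> borel_measurable (lebesgue_on \<Omega>) \<and> integrable (lebesgue_on \<Omega>) (\<lambda>x. (norm (f x))\<^sup>2)"

definition locally_integrable ::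
    "(real^'n) set \<Rightarrow> (real^'n \<Rightarrow> 'b::euclidean_space) \<Rightarrow> bool" where
  "locally_integrable \<Omega> f \<longleftrightarrow> (\<forall>K. compact K \<and> K \<subseteq> \<Omega> \<longrightarrow> integrable (lebesgue_on K) f)"

definition has_weak_grad ::
    "(real^'n) set \<Rightarrow> (real^'n \<Rightarrow> real) \<Rightarrow> (real^'n \<Rightarrow> real^'n) \<Rightarrow> bool" where
  "has_weak_grad \<Omega> u G \<longleftrightarrow>
     locally_integrable \<Omega> u \<and> locally_integrable \<Omega> G \<and>
     (\<forall>\<phi> \<in> test_functions \<Omega>.
        (LINT x|lebesgue_on \<Omega>. u x *\<^sub>R grad \<phi> x) = - (LINT x|lebesgue_on \<Omega>. \<phi> x *\<^sub>R G x))"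

text \<open>
  Elements of the Sobolev space are represented by functions, and the weak gradient is
  determined only almost everywhere; \<open>weak_grad\<close> picks a representative.
\<close>
definition weak_grad :: "(real^'n) set \<Rightarrow> (real^'n \<Rightarrow> real) \<Rightarrow> real^'n \<Rightarrow> real^'n" where
  "weak_grad \<Omega> u = (SOME G. has_weak_grad \<Omega> u G)"

text \<open>The closure of the test functions in the norm of H1.\<close>
definition H01 :: "(real^'n) set \<Rightarrow> (real^'n \<Rightarrow> real) set" where
  "H01 \<Omega> = {u. square_integrable \<Omega> u \<and>
     (\<exists>G. has_weak_grad \<Omega> u G \<and> square_integrable \<Omega> G \<and>
       (\<exists>\<phi>::nat \<Rightarrow> real^'n \<Rightarrow> real. range \<phi> \<subseteq> test_functions \<Omega> \<and>
          (\<lambda>k. LINT x|lebesgue_on \<Omega>. (u x - \<phi> k x)\<^sup>2) \<longlonglongrightarrow> 0 \<and>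
          (\<lambda>k. LINT x|lebesgue_on \<Omega>. (norm (G x - grad (\<phi> k) x))\<^sup>2) \<longlonglongrightarrow> 0))}"

definition H01_norm :: "(real^'n) set \<Rightarrow> (real^'n \<Rightarrow> real) \<Rightarrow> real" where
  "H01_norm \<Omega> u = sqrt (LINT x|lebesgue_on \<Omega>. (norm (weak_grad \<Omega> u x))\<^sup>2)"

text \<open>
  \<open>dirichlet_solution \<Omega> f u\<close>: \<open>u\<close> is a weak solution of \<open>- \<Delta> u = f\<close> in \<open>\<Omega>\<close>, \<open>u = 0\<close> on the
  boundary. The integrability requirement only makes the right-hand side meaningful; for the
  \<open>f\<close> used below it follows from the Sobolev embedding.
\<close>
definition dirichlet_solution ::
    "(real^'n) set \<Rightarrow> (real^'n \<Rightarrow> real) \<Rightarrow> (real^'n \<Rightarrow> real) \<Rightarrow> bool" where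
  "dirichlet_solution \<Omega> f u \<longleftrightarrow>
     u \<in> H01 \<Omega> \<and>
     (\<forall>v \<in> H01 \<Omega>. integrable (lebesgue_on \<Omega>) (\<lambda>x. f x * v x) \<and>
        (LINT x|lebesgue_on \<Omega>. weak_grad \<Omega> u x \<bullet> weak_grad \<Omega> v x) =
        (LINT x|lebesgue_on \<Omega>. f x * v x))"

subsection \<open>The critical problem and the bubbles\<close>

definition critical_exponent :: "real \<Rightarrow> real" where
  "critical_exponent N = 2 * N / (N - 2)"

definition brezis_nirenberg_solution ::
    "(real^'n) set \<Rightarrow> real \<Rightarrow> (real^'n \<Rightarrow> real) \<Rightarrow> bool" where
  "brezis_nirenberg_solution \<Omega> \<mu> u \<longleftrightarrow>
     dirichlet_solution \<Omega>
       (\<lambda>x. \<mu> * u x + \<bar>u x\<bar> powr (critical_exponent (real CARD('n)) - 2) * u x) u"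

definition sign_changing :: "(real^'n) set \<Rightarrow> (real^'n \<Rightarrow> real) \<Rightarrow> bool" where
  "sign_changing \<Omega> u \<longleftrightarrow>
     \<not> (AE x in lebesgue_on \<Omega>. u x \<ge> 0) \<and> \<not> (AE x in lebesgue_on \<Omega>. u x \<le> 0)"

definition bubble_const :: "real \<Rightarrow> real" where
  "bubble_const N = (N * (N - 2)) powr ((N - 2) / 4)"

definition bubble :: "real \<Rightarrow> real^'n \<Rightarrow> real^'n \<Rightarrow> real" where
  "bubble \<delta> \<xi> x = (let N = real CARD('n) in
     bubble_const N * (\<delta> powr ((N - 2) / 2) / (\<delta>\<^sup>2 + (norm (x - \<xi>))\<^sup>2) powr ((N - 2) / 2)))"

text \<open>
  The projection of a bubble to H01, as a relation because it is unique only up to null sets.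
\<close>
definition is_projected_bubble ::
    "(real^'n) set \<Rightarrow> real \<Rightarrow> real^'n \<Rightarrow> (real^'n \<Rightarrow> real) \<Rightarrow> bool" where
  "is_projected_bubble \<Omega> \<delta> \<xi> p \<longleftrightarrow>
     dirichlet_solution \<Omega>
       (\<lambda>x. bubble \<delta> \<xi> x powr ((real CARD('n) + 2) / (real CARD('n) - 2))) p"

text \<open>
  Along the filter \<open>F\<close>, the supremum of \<open>norm (g l)\<close> over \<open>K\<close> tends to zero, for functions
  determined up to null sets.
\<close>
definition ess_uniformly_null ::
    "'l filter \<Rightarrow> (real^'n) set \<Rightarrow> ('l \<Rightarrow> real^'n \<Rightarrow> 'b::real_normed_vector) \<Rightarrow> bool" where
  "ess_uniformly_null F K g \<longleftrightarrow>
     (\<forall>\<epsilon>>0. \<forall>\<^sub>F l in F. AE x in lebesgue_on K. norm (g l x) \<le> \<epsilon>)"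

end

theory Submission
  imports Defs
begin

text \<open>
  Write \<open>p = (N + 2) / (N - 2)\<close> and \<open>m = (N - 2) / 2\<close>, and let \<open>U1\<close>, \<open>U2\<close> be the bubbles with widths
  \<open>\<delta>1\<close>, \<open>\<delta>2\<close> and heights of order \<open>\<delta>1\<^sup>-\<^sup>m\<close>, \<open>\<delta>2\<^sup>-\<^sup>m\<close>. The proof plays two obstructions against each
  other, according to the size of \<open>\<delta>1\<close>.

  Suppose that \<open>\<delta>1\<close> stays below a constant \<open>D\<close>. On the core of the second bubble, a ball whose radius is
  a multiple of \<open>\<delta>2\<close>, the function \<open>v = u + PU2 = PU1 + w\<close> is bounded above and below by positive
  multiples of \<open>\<delta>1\<^sup>-\<^sup>m\<close>, which is small compared to \<open>U2\<close>. As \<open>u \<ge> v - U2\<close>, the two equations give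
  \<open>-\<Delta>v \<ge> (9/10) p U2\<^sup>p\<^sup>-\<^sup>1 v - \<lambda> U2\<close> there. But \<open>-\<Delta> - p U2\<^sup>p\<^sup>-\<^sup>1\<close> has a negative eigenvalue of order
  \<open>\<delta>2\<^sup>-\<^sup>2\<close>, and this is witnessed by an explicit nonnegative test function, a cut-off Gaussian of width \<open>\<delta>2\<close>
  (\<open>core_test_subsolution\<close>). Testing with it, and moving the Laplacian to the test function, leaves
  \<open>\<delta>1\<^sup>-\<^sup>m / \<delta>2\<^sup>2 \<le> C \<lambda> \<delta>2\<^sup>-\<^sup>m\<close>, that is, \<open>1 \<le> C \<lambda> \<delta>2\<^sup>2\<^sup>-\<^sup>m \<delta>1\<^sup>m\<close> (\<open>local_estimate\<close>,
  \<open>inner_scale_estimate\<close>). For \<open>N \<le> 6\<close> the exponent satisfies \<open>m \<le> 2\<close>, so the right-hand side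
  is at most \<open>C \<lambda> D\<^sup>2\<close>, which tends to \<open>0\<close>: a contradiction.

  Suppose that \<open>\<delta>1\<close> is large. Then \<open>U1\<close> is uniformly small, and since \<open>PU2 \<ge> 0\<close> the positive part of
  \<open>u\<close> is at most \<open>U1 + |w|\<close>, hence small in \<open>L\<close> to the critical power. On the other hand, testing the
  equation with \<open>u\<^sup>+\<close> and using Sobolev's inequality shows that a nonzero \<open>u\<^sup>+\<close> has critical mass bounded
  from below (\<open>positive_part_mass_lower_bound\<close>, \<open>energy_estimate\<close>). So here the change of sign is
  contradictory.

  What is known about a projection \<open>PU\<close> is that it lies between \<open>0\<close> and \<open>U\<close>, and above \<open>U\<close> minus the
  largest value of \<open>U\<close> away from \<open>\<xi>\<close> (\<open>projected_bubble_bounds\<close>). These bounds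
  come from a weak comparison principle (\<open>weak_comparison\<close>), which rests on the stability of \<open>H01\<close>
  under positive parts. The critical Sobolev inequality is derived from Hoelder's inequality by induction on
  the coordinates (\<open>grid_lines_inequality\<close>).
\<close>

section \<open>Calculus of smooth functions\<close>

lemma partial_derivI:
  "(f has_derivative f') (at x) \<Longrightarrow> partial_deriv i f x = f' (axis i 1)"
  unfolding partial_deriv_def using frechet_derivative_at by metis

lemma smooth_imp_C_diff [simp]: "smooth f \<Longrightarrow> C_diff k f"
  by (simp add: smooth_def)

lemma smooth_partial_deriv: "smooth f \<Longrightarrow> smooth (partial_deriv i f)"
  unfolding smooth_def by (metis C_diff.simps(2))

lemma smooth_differentiable: "smooth f \<Longrightarrow> f differentiable (at x)"
  unfolding smooth_def by (metis C_diff.simps(2))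

lemma smooth_continuous: "smooth f \<Longrightarrow> continuous_on S f"
  using smooth_imp_C_diff[of f 0] continuous_on_subset[OF _ subset_UNIV] by simp

lemma smooth_has_derivative:
  "smooth f \<Longrightarrow> (f has_derivative frechet_derivative f (at x)) (at x)"
  using smooth_differentiable frechet_derivative_works by blast

lemma C_diff_Suc_imp: "C_diff (Suc k) f \<Longrightarrow> C_diff k f"
proof (induction k arbitrary: f)
  case 0
  then show ?case
    by (auto intro!: differentiable_imp_continuous_on differentiable_at_imp_differentiable_on)
next
  case (Suc k)
  then show ?case by (metis C_diff.simps(2))
qed

lemma C_diff_const: "C_diff k (\<lambda>x. c)"
proof (induction k arbitrary: c)
  case (Suc k)
  have "partial_deriv i (\<lambda>x. c) = (\<lambda>x. 0)" for i :: 'a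
    by (rule ext, rule partial_derivI[where f' = "\<lambda>x. 0"]) auto
  then show ?case using Suc by simp
qed auto

lemma C_diff_coord: "C_diff k (\<lambda>x. x $ i)"
proof (cases k)
  case (Suc k')
  have "partial_deriv j (\<lambda>x. x $ i) = (\<lambda>x. axis j 1 $ i)" for j :: 'a
    by (rule ext, rule partial_derivI)
       (auto intro!: derivative_eq_intros bounded_linear.has_derivative[OF bounded_linear_vec_nth])
  moreover have "(\<lambda>x::real^'a. x $ i) differentiable (at x)" for x
    using bounded_linear.has_derivative[OF bounded_linear_vec_nth has_derivative_ident]
    unfolding differentiable_def by blast
  ultimately show ?thesis unfolding Suc by (simp add: C_diff_const)
qed (auto intro: continuous_intros)

lemma partial_deriv_add:
  assumes "f differentiable (at x)" "g differentiable (at x)"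
  shows "partial_deriv i (\<lambda>x. f x + g x) x = partial_deriv i f x + partial_deriv i g x"
  unfolding partial_deriv_def[of i f] partial_deriv_def[of i g]
  by (rule partial_derivI) (use assms in \<open>auto intro!: derivative_eq_intros simp: frechet_derivative_works\<close>)

lemma partial_deriv_mult:
  assumes "f differentiable (at x)" "g differentiable (at x)"
  shows "partial_deriv i (\<lambda>x. f x * g x) x = f x * partial_deriv i g x + partial_deriv i f x * g x"
  unfolding partial_deriv_def[of i f] partial_deriv_def[of i g]
  by (rule partial_derivI) (use assms in \<open>auto intro!: derivative_eq_intros simp: frechet_derivative_works\<close>)

lemma C_diff_add:
  assumes "C_diff k f" "C_diff k g" shows "C_diff k (\<lambda>x. f x + g x)"
  using assms
proof (induction k arbitrary: f g)
  case (Suc k)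
  then have "partial_deriv i (\<lambda>x. f x + g x) = (\<lambda>x. partial_deriv i f x + partial_deriv i g x)" for i
    by (auto intro!: partial_deriv_add)
  then show ?case using Suc by auto
qed (auto intro: continuous_intros)

lemma C_diff_mult:
  assumes "C_diff k f" "C_diff k g" shows "C_diff k (\<lambda>x. f x * g x)"
  using assms
proof (induction k arbitrary: f g)
  case (Suc k)
  then have "partial_deriv i (\<lambda>x. f x * g x) =
      (\<lambda>x. f x * partial_deriv i g x + partial_deriv i f x * g x)" for i
    by (auto intro!: partial_deriv_mult)
  then show ?case using Suc C_diff_Suc_imp[OF Suc.prems(1)] C_diff_Suc_imp[OF Suc.prems(2)]
    by (auto intro!: C_diff_add)
qed (auto intro: continuous_intros)

named_theorems smooth_intros

lemma smooth_const [smooth_intros]: "smooth (\<lambda>x. c)"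
  and smooth_coord [smooth_intros]: "smooth (\<lambda>x. x $ i)"
  and smooth_add [smooth_intros]: "smooth f \<Longrightarrow> smooth g \<Longrightarrow> smooth (\<lambda>x. f x + g x)"
  and smooth_mult [smooth_intros]: "smooth f \<Longrightarrow> smooth g \<Longrightarrow> smooth (\<lambda>x. f x * g x)"
  by (auto simp: smooth_def intro: C_diff_const C_diff_coord C_diff_add C_diff_mult)

lemma smooth_uminus [smooth_intros]: "smooth f \<Longrightarrow> smooth (\<lambda>x. - f x)"
  using smooth_mult[OF smooth_const[of "-1"]] by simp

lemma smooth_diff [smooth_intros]: "smooth f \<Longrightarrow> smooth g \<Longrightarrow> smooth (\<lambda>x. f x - g x)"
  using smooth_add[OF _ smooth_uminus] by fastforce

lemma smooth_sum [smooth_intros]: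
  "(\<And>i. i \<in> I \<Longrightarrow> smooth (f i)) \<Longrightarrow> smooth (\<lambda>x. \<Sum>i\<in>I. f i x)"
  by (induction I rule: infinite_finite_induct) (auto intro: smooth_intros)

lemma smooth_prod [smooth_intros]:
  "(\<And>i. i \<in> I \<Longrightarrow> smooth (f i)) \<Longrightarrow> smooth (\<lambda>x. \<Prod>i\<in>I. f i x)"
  by (induction I rule: infinite_finite_induct) (auto intro: smooth_intros)

lemma norm_power2_eq_sum: "(norm (x::real^'n))\<^sup>2 = (\<Sum>i\<in>UNIV. x$i * x$i)"
  by (simp add: power2_norm_eq_inner inner_vec_def)

lemma smooth_norm_power2 [smooth_intros]: "smooth (\<lambda>x. (norm (x - \<xi>))\<^sup>2)"
  unfolding norm_power2_eq_sum vector_minus_component by (intro smooth_intros)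

text \<open>Stated pointwise in the derivative of the outer function, so that it can drive inductions over
  families of outer functions that are closed under differentiation.\<close>

lemma partial_deriv_comp:
  assumes "(g has_real_derivative d) (at (f x))" "f differentiable (at x)"
  shows "partial_deriv i (\<lambda>x. g (f x)) x = d * partial_deriv i f x"
    and "(\<lambda>x. g (f x)) differentiable (at x)"
proof -
  from assms(2) have "(f has_derivative frechet_derivative f (at x)) (at x)"
    by (simp add: frechet_derivative_works)
  from has_derivative_compose[OF this, of g "(*) d"] assms(1)
  have *: "((\<lambda>x. g (f x)) has_derivative (\<lambda>h. d * frechet_derivative f (at x) h)) (at x)"
    by (simp add: has_field_derivative_def)
  show "partial_deriv i (\<lambda>x. g (f x)) x = d * partial_deriv i f x"
    using partial_derivI[OF *] by (simp add: partial_deriv_def)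
  show "(\<lambda>x. g (f x)) differentiable (at x)"
    using * by (auto simp: differentiable_def)
qed

text \<open>Differentiation maps this family into its own linear span, so all its members are smooth by one
  induction. Every cut-off function below is built from it. The exponent \<open>m\<close> is there to close the
  family; \<open>flat 0 c\<close> tends to the indicator of \<open>s > 0\<close> as \<open>c\<close> tends to \<open>0\<close>.\<close>

definition flat :: "nat \<Rightarrow> real \<Rightarrow> real \<Rightarrow> real" where
  "flat m c s = (if s > 0 then exp (- c / s) / s ^ m else 0)"

lemma flat_tendsto_0:
  assumes "c > 0" shows "((\<lambda>s. exp (- c / s) / s ^ m) \<longlongrightarrow> 0) (at_right (0::real))"
proof -
  have "((\<lambda>t. t ^ m / exp (c * t)) \<longlongrightarrow> 0) at_top"
  proof -
    have "((\<lambda>t. (c * t) ^ m / exp (c * t)) \<longlongrightarrow> 0) at_top"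
      by (rule filterlim_compose[OF tendsto_power_div_exp_0])
         (use assms in \<open>auto intro: filterlim_tendsto_pos_mult_at_top filterlim_ident\<close>)
    then have "((\<lambda>t. (1/c^m) * ((c * t) ^ m / exp (c * t))) \<longlongrightarrow> (1/c^m) * 0) at_top"
      by (intro tendsto_intros)
    then show ?thesis using assms by (simp add: power_mult_distrib)
  qed
  from filterlim_compose[OF this filterlim_inverse_at_top_right]
  show ?thesis by (simp add: exp_minus field_simps power_inverse)
qed

lemma flat_has_derivative:
  assumes "c > 0"
  shows "(flat m c has_real_derivative (c * flat (m+2) c s - m * flat (m+1) c s)) (at s)"
proof (cases "s = 0")
  case True
  have R: "((\<lambda>s. flat m c s / s) \<longlongrightarrow> 0) (at_right 0)"
    by (rule Lim_transform_eventually[OF flat_tendsto_0[OF assms, of "m+1"]])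
       (auto simp: eventually_at_right_less flat_def intro!: eventually_mono[OF eventually_at_right_less[of 0]])
  have L: "((\<lambda>s. flat m c s / s) \<longlongrightarrow> 0) (at_left 0)"
    by (rule Lim_transform_eventually[OF tendsto_const])
       (auto simp: flat_def eventually_at_filter)
  have "((\<lambda>s. flat m c s / s) \<longlongrightarrow> 0) (at 0)"
    using L R by (simp add: filterlim_split_at_real)
  then show ?thesis unfolding True DERIV_def by (simp add: flat_def)
next
  case False
  show ?thesis
  proof (cases "s > 0")
    case True
    have ev: "\<forall>\<^sub>F x in nhds s. x \<in> {0<..}"
      using True by (intro eventually_nhds_in_open) auto
    have "((\<lambda>s. exp (- c / s) / s ^ m) has_real_derivative (c * flat (m+2) c s - m * flat (m+1) c s)) (at s)"
    proof (cases m)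
      case 0
      show ?thesis using True
        by (auto intro!: derivative_eq_intros simp: 0 flat_def power2_eq_square)
    next
      case (Suc k)
      have "k = 0 \<or> s ^ k = s * s ^ (k - Suc 0)"
        by (cases k) auto
      then show ?thesis using True unfolding Suc
        by (auto intro!: derivative_eq_intros simp: flat_def divide_simps)
           (simp_all add: algebra_simps power2_eq_square)?
    qed
    moreover have "\<forall>\<^sub>F x in nhds s. flat m c x = exp (- c / x) / x ^ m"
      using ev by eventually_elim (simp add: flat_def)
    ultimately show ?thesis by (subst DERIV_cong_ev[OF refl _ refl]) auto
  next
    case 2: False
    then have ev: "\<forall>\<^sub>F x in nhds s. x \<in> {..<0}"
      using False by (intro eventually_nhds_in_open) auto
    have "\<forall>\<^sub>F x in nhds s. flat m c x = 0"
      using ev by eventually_elim (simp add: flat_def)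
    moreover have "((\<lambda>_. 0) has_real_derivative (c * flat (m+2) c s - m * flat (m+1) c s)) (at s)"
      using 2 by (simp add: flat_def)
    ultimately show ?thesis by (subst DERIV_cong_ev[OF refl _ refl]) auto
  qed
qed

lemma flat_continuous: "c > 0 \<Longrightarrow> continuous_on S (flat m c)"
  by (meson DERIV_continuous_on flat_has_derivative has_field_derivative_at_within)

lemma smooth_flat [smooth_intros]:
  assumes "c > 0" "smooth f" shows "smooth (\<lambda>x. flat m c (f x))"
proof -
  have "C_diff k (\<lambda>x. flat m c (f x))" for k
  proof (induction k arbitrary: m)
    case 0
    show ?case
      using continuous_on_compose2[OF flat_continuous[OF assms(1)] smooth_continuous[OF assms(2)]] by auto
  next
    case (Suc k)
    have "partial_deriv i (\<lambda>x. flat m c (f x)) =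
       (\<lambda>x. (c * flat (m+2) c (f x) + (- real m) * flat (m+1) c (f x)) * partial_deriv i f x)" for i
      using partial_deriv_comp(1)[OF flat_has_derivative[OF assms(1)] smooth_differentiable[OF assms(2)]]
      by (auto simp: fun_eq_iff)
    moreover have *: "C_diff k (\<lambda>x. (c * flat (m+2) c (f x) + (- real m) * flat (m+1) c (f x)) * partial_deriv i f x)" for i
      by (intro C_diff_mult C_diff_add Suc C_diff_const smooth_imp_C_diff smooth_partial_deriv assms(2))
    moreover have "(\<lambda>x. flat m c (f x)) differentiable (at x)" for x
      using partial_deriv_comp(2)[OF flat_has_derivative[OF assms(1)] smooth_differentiable[OF assms(2)]] .
    ultimately show ?case
      using smooth_imp_C_diff[OF smooth_partial_deriv[OF assms(2)]]
      unfolding C_diff.simps by (metis *)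
  qed
  then show ?thesis by (simp add: smooth_def)
qed

lemma smooth_powr [smooth_intros]:
  assumes "smooth f" "\<And>x. f x > 0" shows "smooth (\<lambda>x. f x powr s)"
proof -
  have D: "((\<lambda>t. t powr s) has_real_derivative (s * f x powr (s - 1))) (at (f x))" for x s
    by (rule has_real_derivative_powr) (use assms in auto)
  have "C_diff k (\<lambda>x. f x powr s)" for k
  proof (induction k arbitrary: s)
    case 0
    show ?case using assms smooth_continuous[of f UNIV]
      by (auto intro!: continuous_intros simp: less_imp_neq[symmetric])
  next
    case (Suc k)
    have "partial_deriv i (\<lambda>x. f x powr s) = (\<lambda>x. (s * f x powr (s-1)) * partial_deriv i f x)" for i
      using partial_deriv_comp(1)[OF D smooth_differentiable[OF assms(1)]] by (auto simp: fun_eq_iff)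
    moreover have "(\<lambda>x. f x powr s) differentiable (at x)" for x
      using partial_deriv_comp(2)[OF D smooth_differentiable[OF assms(1)]] .
    ultimately show ?case
      using smooth_imp_C_diff[OF smooth_partial_deriv[OF assms(1)]]
      by (auto intro!: C_diff_mult Suc C_diff_const)
  qed
  then show ?thesis by (simp add: smooth_def)
qed

lemma partial_deriv_norm_power2:
  "partial_deriv i (\<lambda>x. (norm (x - \<xi>))\<^sup>2) x = 2 * (x $ i - \<xi> $ i)"
proof -
  have "((\<lambda>x. (norm (x - \<xi>))\<^sup>2) has_derivative (\<lambda>h. 2 * ((x - \<xi>) \<bullet> h))) (at x)"
    unfolding power2_norm_eq_inner
    by (auto intro!: derivative_eq_intros simp: inner_commute)
  from partial_derivI[OF this] show ?thesis by (simp add: inner_axis)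
qed

definition laplacian :: "(real^'n \<Rightarrow> real) \<Rightarrow> real^'n \<Rightarrow> real" where
  "laplacian f x = (\<Sum>i\<in>UNIV. partial_deriv i (partial_deriv i f) x)"

lemma grad_nth [simp]: "grad f x $ i = partial_deriv i f x"
  by (simp add: grad_def)

lemma continuous_grad: "smooth f \<Longrightarrow> continuous_on S (grad f)"
  unfolding grad_def[abs_def]
  by (intro continuous_on_vec_lambda smooth_continuous smooth_partial_deriv)

lemma laplacian_radial:
  fixes g g' g'' :: "real \<Rightarrow> real"
  assumes "\<And>t. t \<ge> 0 \<Longrightarrow> (g has_real_derivative g' t) (at t)"
    and "\<And>t. t \<ge> 0 \<Longrightarrow> (g' has_real_derivative g'' t) (at t)"
  shows "laplacian (\<lambda>x. g ((norm (x - \<xi>))\<^sup>2)) (x::real^'n) =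
    4 * (norm (x - \<xi>))\<^sup>2 * g'' ((norm (x - \<xi>))\<^sup>2) + 2 * CARD('n) * g' ((norm (x - \<xi>))\<^sup>2)"
proof -
  let ?q = "\<lambda>x. (norm (x - \<xi>))\<^sup>2"
  note q = smooth_differentiable[OF smooth_norm_power2]
  have p1: "partial_deriv i (\<lambda>x. g (?q x)) = (\<lambda>x. g' (?q x) * (2 * (x $ i - \<xi> $ i)))" for i
    using partial_deriv_comp(1)[OF assms(1) q, where i = i]
    by (auto simp: fun_eq_iff partial_deriv_norm_power2)
  have p2: "partial_deriv i (\<lambda>x. g' (?q x) * (2 * (x $ i - \<xi> $ i))) x =
      4 * ((x-\<xi>) $ i * (x-\<xi>) $ i) * g'' (?q x) + 2 * g' (?q x)" for i
  proof -
    have D: "((\<lambda>x. 2 * (x $ i - \<xi> $ i)) has_derivative (\<lambda>h. 2 * h $ i)) (at x)"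
      by (auto intro!: derivative_eq_intros bounded_linear.has_derivative[OF bounded_linear_vec_nth])
    have "partial_deriv i (\<lambda>x. 2 * (x $ i - \<xi> $ i)) x = 2"
      using partial_derivI[OF D] by simp
    moreover have "(\<lambda>x. g' (?q x)) differentiable (at x)"
      using partial_deriv_comp(2)[OF assms(2) q] by auto
    moreover have "partial_deriv i (\<lambda>x. g' (?q x)) x = g'' (?q x) * (2 * (x $ i - \<xi> $ i))"
      using partial_deriv_comp(1)[OF assms(2) q, where i = i] by (simp add: partial_deriv_norm_power2)
    moreover have "(\<lambda>x. 2 * (x $ i - \<xi> $ i)) differentiable (at x)"
      using D by (auto simp: differentiable_def)
    ultimately have "partial_deriv i (\<lambda>x. g' (?q x) * (2 * (x $ i - \<xi> $ i))) x =
        g' (?q x) * 2 + g'' (?q x) * (2 * (x $ i - \<xi> $ i)) * (2 * (x $ i - \<xi> $ i))"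
      by (simp only: partial_deriv_mult)
    then show ?thesis by (simp add: algebra_simps)
  qed
  have "(norm (x - \<xi>))\<^sup>2 = (\<Sum>i\<in>UNIV. (x-\<xi>) $ i * (x-\<xi>) $ i)"
    by (rule norm_power2_eq_sum)
  then show ?thesis
    unfolding laplacian_def p1 p2 sum.distrib
    by (simp add: sum_distrib_left sum_distrib_right)
qed

section \<open>Compactly supported functions and integration by parts\<close>

lemma compact_support_integrable:
  fixes f :: "real^'n \<Rightarrow> 'b::{banach, second_countable_topology}"
  assumes "continuous_on UNIV f" "compact K" "\<And>x. x \<notin> K \<Longrightarrow> f x = 0"
  shows "integrable lborel f" and "S \<in> sets lebesgue \<Longrightarrow> integrable (lebesgue_on S) f"
proof -
  have "integrable lborel (\<lambda>x. indicator K x *\<^sub>R f x)"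
    using assms by (intro borel_integrable_compact) (auto intro: continuous_on_subset)
  also have "(\<lambda>x. indicator K x *\<^sub>R f x) = f"
    using assms(3) by (auto simp: indicator_def fun_eq_iff)
  finally show *: "integrable lborel f" .
  show "integrable (lebesgue_on S) f" if "S \<in> sets lebesgue"
  proof -
    have "integrable lebesgue f" using * by (simp add: integrable_completion)
    then show ?thesis using that
      by (subst integrable_restrict_space) (auto intro!: integrable_mult_indicator)
  qed
qed

text \<open>Lets integrals over \<open>\<Omega>\<close> be computed on the whole space, where translation invariance and
  product structure are available.\<close>

lemma integral_lebesgue_on_support:
  fixes f :: "real^'n \<Rightarrow> 'b::{banach, second_countable_topology}"
  assumes "f \<in> borel_measurable borel" "\<And>x. x \<notin> S \<Longrightarrow> f x = 0" "S \<in> sets lebesgue"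
  shows "(LINT x|lebesgue_on S. f x) = (LINT x|lborel. f x)"
proof -
  have "(LINT x|lebesgue_on S. f x) = (LINT x|lebesgue. indicator S x *\<^sub>R f x)"
    using assms(3) by (subst integral_restrict_space) auto
  also have "(\<lambda>x. indicator S x *\<^sub>R f x) = f"
    using assms(2) by (auto simp: indicator_def fun_eq_iff)
  also have "(LINT x|lebesgue. f x) = (LINT x|lborel. f x)"
    using assms(1) by (simp add: integral_completion)
  finally show ?thesis .
qed

lemma partial_deriv_outside_support:
  assumes "x \<notin> closure {x. f x \<noteq> 0}" shows "partial_deriv i f x = 0"
proof -
  have "(f has_derivative (\<lambda>h. 0)) (at x)"
  proof (rule has_derivative_transform_within_open[where s = "- closure {x. f x \<noteq> 0}"])
    show "((\<lambda>_. 0) has_derivative (\<lambda>h. 0)) (at x)" by simp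
    show "\<And>y. y \<in> - closure {x. f x \<noteq> 0} \<Longrightarrow> 0 = f y"
      using closure_subset[of "{x. f x \<noteq> 0}"] by auto
  qed (use assms in auto)
  from partial_derivI[OF this] show ?thesis by simp
qed

lemma partial_deriv_support:
  "closure {x. partial_deriv i f x \<noteq> 0} \<subseteq> closure {x. f x \<noteq> 0}"
  by (rule closure_minimal) (use partial_deriv_outside_support[of _ f i] in blast, simp)

lemma DERIV_along_axis:
  assumes "smooth f"
  shows "((\<lambda>t. f (x + t *\<^sub>R axis i 1)) has_real_derivative partial_deriv i f (x + t *\<^sub>R axis i 1)) (at t)"
proof -
  let ?e = "axis i (1::real)"
  have "((\<lambda>t. x + t *\<^sub>R ?e) has_derivative (\<lambda>h. h *\<^sub>R ?e)) (at t)"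
    by (auto intro!: derivative_eq_intros)
  from has_derivative_compose[OF this smooth_has_derivative[OF assms]]
  have *: "((\<lambda>t. f (x + t *\<^sub>R ?e)) has_derivative
     (\<lambda>h. frechet_derivative f (at (x + t *\<^sub>R ?e)) (h *\<^sub>R ?e))) (at t)" .
  have "linear (frechet_derivative f (at (x + t *\<^sub>R ?e)))"
    using linear_frechet_derivative smooth_differentiable[OF assms] by blast
  from linear_scale[OF this] * show ?thesis
    by (simp add: has_field_derivative_def partial_deriv_def mult_commute_abs)
qed

lemma lborel_integral_translate:
  fixes f :: "real^'n \<Rightarrow> real"
  assumes "f \<in> borel_measurable borel"
  shows "(LINT x|lborel. f (x + a)) = (LINT x|lborel. f x)"
proof -
  have "(LINT x|lborel. f x) = (LINT x|distr lborel borel ((+) a). f x)"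
    by (simp add: lborel_distr_plus)
  also have "\<dots> = (LINT x|lborel. f (a + x))"
    using assms by (intro integral_distr) auto
  finally show ?thesis by (simp add: add.commute)
qed

text \<open>By translation invariance every difference quotient has integral zero, and compact support
  allows passing to the limit.\<close>

lemma integral_partial_deriv_eq_0:
  assumes f: "smooth f" and K: "compact (closure {x. f x \<noteq> 0})"
  shows "(LINT x|lborel. partial_deriv i f x) = 0"
proof -
  let ?e = "axis i (1::real)"
  obtain R where R: "closure {x. f x \<noteq> 0} \<subseteq> cball 0 R"
    using compact_imp_bounded[OF K] bounded_iff[of "closure {x. f x \<noteq> 0}"]
    by (auto simp: subset_iff)
  have f0: "f x = 0" if "norm x > R" for x
  proof (rule ccontr)
    assume "f x \<noteq> 0"
    then have "x \<in> cball 0 R" using R closure_subset[of "{x. f x \<noteq> 0}"] by blast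
    with that show False by simp
  qed
  have "compact (partial_deriv i f ` cball 0 (R+2))"
    by (intro compact_continuous_image smooth_continuous smooth_partial_deriv f compact_cball)
  then obtain B where B: "\<And>x. norm x \<le> R+2 \<Longrightarrow> \<bar>partial_deriv i f x\<bar> \<le> B"
    using compact_imp_bounded[of "partial_deriv i f ` cball 0 (R+2)"] unfolding bounded_iff
    by (metis imageI mem_cball_0 real_norm_def)
  define h :: "nat \<Rightarrow> real" where "h n = 1 / (n+1)" for n
  have h: "h n > 0" "h n \<le> 1" for n by (auto simp: h_def)
  have h0: "h \<longlonglongrightarrow> 0" unfolding h_def using LIMSEQ_inverse_real_of_nat by (simp add: inverse_eq_divide add.commute)
  define D where "D n x = (f (x + h n *\<^sub>R ?e) - f x) / h n" for n x
  have cont: "continuous_on UNIV f" using f by (rule smooth_continuous)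
  have contD: "continuous_on UNIV (D n)" for n
    unfolding D_def using h(1)[of n]
    by (auto intro!: continuous_intros continuous_on_compose2[OF cont])
  have bound: "norm (D n x) \<le> B * indicator (cball 0 (R+1)) x" for n x
  proof (cases "norm x \<le> R + 1")
    case True
    obtain z where z: "0 < z" "z < h n"
      "f (x + h n *\<^sub>R ?e) - f (x + 0 *\<^sub>R ?e) = (h n - 0) * partial_deriv i f (x + z *\<^sub>R ?e)"
      using MVT2[OF h(1)[of n] DERIV_along_axis[OF f]] by blast
    have "norm (x + z *\<^sub>R ?e) \<le> R + 2"
      using norm_triangle_ineq[of x "z *\<^sub>R ?e"] True z h(2)[of n] by (simp add: norm_axis_1)
    with B z h(1)[of n] True show ?thesis by (simp add: D_def)
  next
    case False
    have "norm (x + h n *\<^sub>R ?e) > R"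
      using norm_triangle_ineq4[of "x + h n *\<^sub>R ?e" "h n *\<^sub>R ?e"] False h[of n] by (simp add: norm_axis_1)
    with False f0 show ?thesis by (simp add: D_def)
  qed
  have int0: "(LINT x|lborel. D n x) = 0" for n
  proof -
    have i1: "integrable lborel f"
      by (rule compact_support_integrable(1)[OF cont K]) (use closure_subset[of "{x. f x \<noteq> 0}"] in blast)
    have c2: "continuous_on UNIV (\<lambda>x. f (x + h n *\<^sub>R ?e))"
      by (auto intro!: continuous_intros continuous_on_compose2[OF cont])
    have i2: "integrable lborel (\<lambda>x. f (x + h n *\<^sub>R ?e))"
    proof (rule compact_support_integrable(1)[OF c2 compact_cball[of 0 "R+1"]])
      fix x :: "real^'a" assume "x \<notin> cball 0 (R+1)"
      then show "f (x + h n *\<^sub>R ?e) = 0"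
        using norm_triangle_ineq4[of "x + h n *\<^sub>R ?e" "h n *\<^sub>R ?e"] h[of n]
        by (intro f0) (simp add: norm_axis_1)
    qed
    show ?thesis unfolding D_def
      using i1 i2 lborel_integral_translate[OF borel_measurable_continuous_onI[OF cont], of "h n *\<^sub>R ?e"]
      by simp
  qed
  have "(\<lambda>n. LINT x|lborel. D n x) \<longlonglongrightarrow> (LINT x|lborel. partial_deriv i f x)"
  proof (rule integral_dominated_convergence[where w = "\<lambda>x. B * indicator (cball 0 (R+1)) x"])
    show "partial_deriv i f \<in> borel_measurable lborel"
      using smooth_continuous[OF smooth_partial_deriv[OF f]] by (simp add: borel_measurable_continuous_onI)
    show "D n \<in> borel_measurable lborel" for n
      using contD by (simp add: borel_measurable_continuous_onI)
    show "integrable lborel (\<lambda>x. B * indicator (cball 0 (R+1)) x :: real)"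
      by (intro integrable_mult_right integrable_real_indicator) (use emeasure_bounded_finite[OF bounded_cball, of 0 "R+1"] in auto)
    show "AE x in lborel. (\<lambda>n. D n x) \<longlonglongrightarrow> partial_deriv i f x"
    proof (rule AE_I2)
      fix x
      have "((\<lambda>t. (f (x + t *\<^sub>R ?e) - f x) / t) \<longlongrightarrow> partial_deriv i f x) (at 0)"
        using DERIV_along_axis[OF f, of x i 0] by (simp add: DERIV_def)
      moreover have "filterlim h (at 0) sequentially"
        using h0 h(1) by (auto simp: filterlim_at intro!: always_eventually less_imp_neq[symmetric])
      ultimately show "(\<lambda>n. D n x) \<longlonglongrightarrow> partial_deriv i f x"
        unfolding D_def by (rule filterlim_compose)
    qed
    show "\<And>n. AE x in lborel. norm (D n x) \<le> B * indicator (cball 0 (R+1)) x"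
      using bound by auto
  qed
  then show ?thesis by (simp add: int0 LIMSEQ_const_iff)
qed

subsection \<open>Test functions\<close>

lemma test_functionsD:
  assumes "\<phi> \<in> test_functions \<Omega>"
  shows "smooth \<phi>" "compact (closure {x. \<phi> x \<noteq> 0})" "closure {x. \<phi> x \<noteq> 0} \<subseteq> \<Omega>"
  using assms by (auto simp: test_functions_def)

lemma test_functionsI:
  assumes "smooth \<phi>" "compact K" "K \<subseteq> \<Omega>" "\<And>x. x \<notin> K \<Longrightarrow> \<phi> x = 0"
  shows "\<phi> \<in> test_functions \<Omega>"
proof -
  have "closure {x. \<phi> x \<noteq> 0} \<subseteq> K"
    using assms by (intro closure_minimal compact_imp_closed) auto
  then show ?thesis
    using assms compact_Int_closed[OF assms(2) closed_closure, of "{x. \<phi> x \<noteq> 0}"]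
    by (simp add: test_functions_def Int_absorb1)
qed

lemma test_functions_outside: "\<phi> \<in> test_functions \<Omega> \<Longrightarrow> x \<notin> \<Omega> \<Longrightarrow> \<phi> x = 0"
  using closure_subset[of "{x. \<phi> x \<noteq> 0}"] unfolding test_functions_def by blast

lemma test_functions_mult:
  assumes "\<phi> \<in> test_functions \<Omega>" "smooth \<psi>" shows "(\<lambda>x. \<psi> x * \<phi> x) \<in> test_functions \<Omega>"
  using test_functionsD[OF assms(1)] assms(2) closure_subset[of "{x. \<phi> x \<noteq> 0}"]
  by (intro test_functionsI[where K = "closure {x. \<phi> x \<noteq> 0}"] smooth_mult) auto

lemma test_functions_add:
  assumes "\<phi> \<in> test_functions \<Omega>" "\<psi> \<in> test_functions \<Omega>"
  shows "(\<lambda>x. \<psi> x + \<phi> x) \<in> test_functions \<Omega>"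
proof -
  have "\<psi> x + \<phi> x = 0" if "x \<notin> closure {x. \<phi> x \<noteq> 0} \<union> closure {x. \<psi> x \<noteq> 0}" for x
  proof -
    have "\<phi> x = 0" "\<psi> x = 0"
      using that closure_subset[of "{x. \<phi> x \<noteq> 0}"] closure_subset[of "{x. \<psi> x \<noteq> 0}"] by blast+
    then show ?thesis by simp
  qed
  then show ?thesis using test_functionsD[OF assms(1)] test_functionsD[OF assms(2)]
  by (intro test_functionsI[where K = "closure {x. \<phi> x \<noteq> 0} \<union> closure {x. \<psi> x \<noteq> 0}"] smooth_add) auto
qed

lemma test_functions_partial_deriv:
  assumes "\<phi> \<in> test_functions \<Omega>" shows "partial_deriv i \<phi> \<in> test_functions \<Omega>"
  using test_functionsD[OF assms]
  by (intro test_functionsI[where K = "closure {x. \<phi> x \<noteq> 0}"] smooth_partial_deriv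
     partial_deriv_outside_support) auto

lemma grad_outside_support:
  assumes "x \<notin> closure {x. f x \<noteq> 0}" shows "grad f x = 0"
  using partial_deriv_outside_support[OF assms] by (simp add: vec_eq_iff)

lemma integrable_test_function:
  assumes "\<phi> \<in> test_functions \<Omega>"
  shows "integrable lborel \<phi>" "S \<in> sets lebesgue \<Longrightarrow> integrable (lebesgue_on S) \<phi>"
  using compact_support_integrable[OF smooth_continuous[OF test_functionsD(1)[OF assms]]
      test_functionsD(2)[OF assms]] closure_subset[of "{x. \<phi> x \<noteq> 0}"] by auto

lemma integral_test_function:
  assumes "\<phi> \<in> test_functions \<Omega>" "open \<Omega>"
  shows "(LINT x|lebesgue_on \<Omega>. \<phi> x) = (LINT x|lborel. \<phi> x)"
  using assms smooth_continuous[OF test_functionsD(1)[OF assms(1)], of UNIV] test_functions_outside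
  by (intro integral_lebesgue_on_support borel_measurable_continuous_onI) (auto intro: borel_open)

lemma integration_by_parts:
  assumes "\<phi> \<in> test_functions \<Omega>" "smooth \<psi>" "open \<Omega>"
  shows "(LINT x|lebesgue_on \<Omega>. \<psi> x * partial_deriv i \<phi> x) =
     - (LINT x|lebesgue_on \<Omega>. partial_deriv i \<psi> x * \<phi> x)"
proof -
  have S: "\<Omega> \<in> sets lebesgue" using assms(3) by (auto intro: borel_open)
  note t = test_functions_mult[OF assms(1,2)]
  have i1: "integrable (lebesgue_on \<Omega>) (\<lambda>x. \<psi> x * partial_deriv i \<phi> x)"
    using integrable_test_function(2)[OF test_functions_mult[OF test_functions_partial_deriv[OF assms(1)] assms(2)] S] .
  have i2: "integrable (lebesgue_on \<Omega>) (\<lambda>x. partial_deriv i \<psi> x * \<phi> x)"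
    using integrable_test_function(2)[OF test_functions_mult[OF assms(1) smooth_partial_deriv[OF assms(2)]] S] .
  have "0 = (LINT x|lebesgue_on \<Omega>. partial_deriv i (\<lambda>x. \<psi> x * \<phi> x) x)"
    using integral_test_function[OF test_functions_partial_deriv[OF t] assms(3), of i]
      integral_partial_deriv_eq_0[OF test_functionsD(1,2)[OF t], of i] by simp
  also have "\<dots> = (LINT x|lebesgue_on \<Omega>. \<psi> x * partial_deriv i \<phi> x + partial_deriv i \<psi> x * \<phi> x)"
    using partial_deriv_mult[OF smooth_differentiable[OF assms(2)] smooth_differentiable[OF test_functionsD(1)[OF assms(1)]], of i]
    by simp
  finally show ?thesis using i1 i2 by simp
qed

subsection \<open>The fundamental lemma of the calculus of variations\<close>

text \<open>Smooth, bounded by \<open>1\<close>, and convergent to the indicator of the open box as \<open>c\<close> tends to \<open>0\<close>.\<close>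

definition box_bump :: "real \<Rightarrow> real^'n \<Rightarrow> real^'n \<Rightarrow> real^'n \<Rightarrow> real" where
  "box_bump c a b x = (\<Prod>i\<in>UNIV. flat 0 c (x $ i - a $ i) * flat 0 c (b $ i - x $ i))"

lemma flat_0_bounds: "0 \<le> flat 0 c s" "c \<ge> 0 \<Longrightarrow> flat 0 c s \<le> 1"
  by (auto simp: flat_def)

lemma box_bump_bounds: "0 \<le> box_bump c a b x" "c \<ge> 0 \<Longrightarrow> box_bump c a b x \<le> 1"
  unfolding box_bump_def
  by (auto intro!: prod_nonneg prod_le_1 mult_nonneg_nonneg flat_0_bounds mult_le_one)

lemma box_bump_outside: "x \<notin> box a b \<Longrightarrow> box_bump c a b x = 0"
  by (auto simp: box_bump_def mem_box_cart flat_def)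

lemma box_bump_test:
  assumes "c > 0" "cbox a b \<subseteq> \<Omega>" shows "box_bump c a b \<in> test_functions \<Omega>"
proof (rule test_functionsI[OF _ compact_cbox assms(2)])
  show "smooth (box_bump c a b)"
    unfolding box_bump_def[abs_def] by (intro smooth_intros assms)
  show "x \<notin> cbox a b \<Longrightarrow> box_bump c a b x = 0" for x
    using box_bump_outside box_subset_cbox by blast
qed

lemma flat_0_tendsto: "(\<lambda>n. flat 0 (1 / real (Suc n)) s) \<longlonglongrightarrow> (if s > 0 then 1 else 0)"
proof -
  have "(\<lambda>n. 1 / real (Suc n) / s) \<longlonglongrightarrow> 0"
    using tendsto_mult_right[OF LIMSEQ_inverse_real_of_nat, of "1/s"]
    by (simp add: inverse_eq_divide)
  then have "(\<lambda>n. exp (- (1 / real (Suc n) / s))) \<longlonglongrightarrow> exp (- 0)"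
    by (intro tendsto_intros) simp
  then show ?thesis by (auto simp: flat_def)
qed

lemma box_bump_tendsto: "(\<lambda>n. box_bump (1 / real (Suc n)) a b x) \<longlonglongrightarrow> indicator (box a b) x"
proof -
  have "(\<Prod>i\<in>UNIV. (if x $ i - a $ i > 0 then 1 else 0) * (if b $ i - x $ i > 0 then 1 else (0::real)))
      = indicator (box a b) x"
    by (auto simp: indicator_def mem_box_cart intro!: prod.neutral)
  moreover have "(\<lambda>n. box_bump (1 / real (Suc n)) a b x) \<longlonglongrightarrow>
      (\<Prod>i\<in>UNIV. (if x $ i - a $ i > 0 then 1 else 0) * (if b $ i - x $ i > 0 then 1 else (0::real)))"
    unfolding box_bump_def by (intro tendsto_intros flat_0_tendsto)
  ultimately show ?thesis by simp
qed

text \<open>The positive and the negative part of \<open>g\<close> are densities of two measures that agree on boxes. Boxes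
  are stable under intersection and generate the Borel sets, so the two densities agree.\<close>

lemma AE_zero_if_box_integrals_zero:
  fixes g :: "real^'n \<Rightarrow> real"
  assumes g: "integrable lborel g" and 0: "\<And>a b. (LINT x|lborel. indicator (box a b) x * g x) = 0"
  shows "AE x in lborel. g x = 0"
proof -
  note [measurable] = borel_measurable_integrable[OF g, simplified]
  have eq: "emeasure (density lborel (\<lambda>x. ennreal (g x))) (box a b) =
     emeasure (density lborel (\<lambda>x. ennreal (- g x))) (box a b)" for a b
  proof -
    let ?i = "\<lambda>x. indicator (box a b) x :: real"
    have i1: "integrable lborel (\<lambda>x. ?i x * max 0 (g x))" "integrable lborel (\<lambda>x. ?i x * max 0 (- g x))"
      using g by (auto intro!: integrable_real_mult_indicator simp: mult.commute[of "?i _"])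
    have "(LINT x|lborel. ?i x * max 0 (g x)) - (LINT x|lborel. ?i x * max 0 (- g x)) =
        (LINT x|lborel. ?i x * g x)"
      unfolding Bochner_Integration.integral_diff[OF i1, symmetric]
      by (intro Bochner_Integration.integral_cong) (auto simp: max_def indicator_def)
    also have "\<dots> = 0" by (rule 0)
    finally have *: "(LINT x|lborel. ?i x * max 0 (g x)) = (LINT x|lborel. ?i x * max 0 (- g x))" by simp
    have "emeasure (density lborel (\<lambda>x. ennreal (h x))) (box a b) = ennreal (LINT x|lborel. ?i x * max 0 (h x))"
      if "integrable lborel (\<lambda>x. ?i x * max 0 (h x))" "h \<in> borel_measurable borel" for h
    proof -
      have "emeasure (density lborel (\<lambda>x. ennreal (h x))) (box a b) = (\<integral>\<^sup>+x. ennreal (h x) * indicator (box a b) x \<partial>lborel)"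
        using that(2) by (subst emeasure_density) auto
      also have "\<dots> = (\<integral>\<^sup>+x. ennreal (?i x * max 0 (h x)) \<partial>lborel)"
        by (intro nn_integral_cong) (auto simp: indicator_def max_def ennreal_neg)
      also have "\<dots> = ennreal (LINT x|lborel. ?i x * max 0 (h x))"
        using that by (intro nn_integral_eq_integral) auto
      finally show ?thesis .
    qed
    from this[of g] this[of "\<lambda>x. - g x"] i1 * show ?thesis by simp
  qed
  have "density lborel (\<lambda>x. ennreal (g x)) = density lborel (\<lambda>x. ennreal (- g x))"
  proof (rule measure_eqI_generator_eq[where E = "range (\<lambda>(a,b). box a b)" and \<Omega> = UNIV
      and A = "\<lambda>n. box (\<chi> i. - real n) (\<chi> i. real n)"])
    show "Int_stable (range (\<lambda>(a, b). box a b :: (real^'n) set))"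
      unfolding Int_stable_def by (auto simp: box_Int_box)
    show "(\<Union>n. box (\<chi> i. - real n) (\<chi> i. real n)) = (UNIV :: (real^'n) set)"
    proof (intro set_eqI iffI UNIV_I)
      fix x :: "real^'n"
      obtain n where n: "real n > norm x" using reals_Archimedean2 by blast
      have "x \<in> box (\<chi> i. - real n) (\<chi> i. real n)"
        unfolding mem_box_cart using component_le_norm_cart[of x] n by (auto simp: abs_less_iff) (smt (verit))+
      then show "x \<in> (\<Union>n. box (\<chi> i. - real n) (\<chi> i. real n))" by blast
    qed
    show "emeasure (density lborel (\<lambda>x. ennreal (g x))) (box (\<chi> i. - real n) (\<chi> i. real n)) \<noteq> \<infinity>" for n
    proof -
      have "emeasure (density lborel (\<lambda>x. ennreal (g x))) (box (\<chi> i. - real n) (\<chi> i. real n)) \<le> (\<integral>\<^sup>+x. ennreal (norm (g x)) \<partial>lborel)"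
        by (subst emeasure_density) (auto intro!: nn_integral_mono simp: indicator_def ennreal_leI)
      also have "\<dots> < \<infinity>" using g by (auto simp: integrable_iff_bounded)
      finally show ?thesis by simp
    qed
  qed (auto simp: eq borel_eq_box)
  then have "AE x in lborel. ennreal (g x) = ennreal (- g x)"
    by (intro sigma_finite_measure.density_unique[OF sigma_finite_lborel]) auto
  then show ?thesis
    by eventually_elim (smt (verit) ennreal_eq_0_iff ennreal_neg)
qed

text \<open>On a closed box inside \<open>\<Omega>\<close> the function \<open>g\<close> is integrable, and testing with bumps that converge
  boundedly to indicators gives vanishing integrals over all smaller boxes. Countably many such boxes
  cover \<open>\<Omega>\<close>.\<close>

lemma fundamental_lemma:
  fixes g :: "real^'n \<Rightarrow> real"
  assumes \<Omega>: "open \<Omega>" and g: "locally_integrable \<Omega> g"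
    and 0: "\<And>\<phi>. \<phi> \<in> test_functions \<Omega> \<Longrightarrow> (LINT x|lebesgue_on \<Omega>. \<phi> x * g x) = 0"
  shows "AE x in lebesgue_on \<Omega>. g x = 0"
proof -
  have sO: "\<Omega> \<in> sets lebesgue" using \<Omega> by (auto intro: borel_open)
  have box: "AE x in lebesgue. x \<in> box a b \<longrightarrow> g x = 0" if ab: "cbox a b \<subseteq> \<Omega>" for a b
  proof -
    define g' where "g' x = indicator (box a b) x * g x" for x
    have "integrable (lebesgue_on (cbox a b)) g"
      using g ab by (auto simp: locally_integrable_def)
    then have "integrable lebesgue (\<lambda>x. indicator (cbox a b) x *\<^sub>R g x)"
      by (subst (asm) integrable_restrict_space) auto
    from integrable_mult_indicator[OF _ this, of "box a b"]
    have "integrable lebesgue (\<lambda>x. indicator (box a b) x *\<^sub>R indicator (cbox a b) x *\<^sub>R g x)"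
      by auto
    also have "(\<lambda>x. indicator (box a b) x *\<^sub>R indicator (cbox a b) x *\<^sub>R g x) = g'"
      using box_subset_cbox[of a b] by (auto simp: g'_def indicator_def fun_eq_iff)
    finally have g'i: "integrable lebesgue g'" .
    obtain h where h: "h \<in> borel_measurable lborel" "AE x in lborel. g' x = h x"
      using completion_ex_borel_measurable_real[OF borel_measurable_integrable[OF g'i]] by blast
    then have AEh: "AE x in lebesgue. g' x = h x" by (simp add: AE_completion)
    have hi: "integrable lebesgue h"
      using integrable_cong_AE[OF borel_measurable_integrable[OF g'i] _ AEh] g'i h(1) by (simp add: measurable_completion)
    then have hi': "integrable lborel h" using h(1) by (simp add: integrable_completion)
    have "AE x in lborel. h x = 0"
    proof (rule AE_zero_if_box_integrals_zero[OF hi'])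
      fix c d
      \<comment> \<open>the intersection with \<open>box a b\<close> keeps the support of the bumps inside \<open>\<Omega>\<close>\<close>
      define c' where "c' = (\<chi> i. max (a$i) (c$i))"
      define d' where "d' = (\<chi> i. min (b$i) (d$i))"
      have cd: "box c' d' = box c d \<inter> box a b" "cbox c' d' \<subseteq> cbox a b"
        by (auto simp: c'_def d'_def mem_box_cart)
      have "(\<lambda>n. LINT x|lebesgue. box_bump (1 / real (Suc n)) c' d' x * g' x) \<longlonglongrightarrow>
          (LINT x|lebesgue. indicator (box c' d') x * g' x)"
      proof (rule integral_dominated_convergence[where w = "\<lambda>x. norm (g' x)"])
        show "(\<lambda>x. indicator (box c' d') x * g' x) \<in> borel_measurable lebesgue"
          using borel_measurable_integrable[OF g'i]
          by (intro borel_measurable_times borel_measurable_indicator) auto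
        have "box_bump (1 / real (Suc n)) c' d' \<in> borel_measurable borel" for n
          using smooth_continuous[OF test_functionsD(1)[OF box_bump_test[of "1 / real (Suc n)" c' d' UNIV]]]
          by (intro borel_measurable_continuous_onI) auto
        then show "(\<lambda>x. box_bump (1 / real (Suc n)) c' d' x * g' x) \<in> borel_measurable lebesgue" for n
          using borel_measurable_integrable[OF g'i] by (intro borel_measurable_times) (auto simp: measurable_completion)
        show "AE x in lebesgue. norm (box_bump (1 / real (Suc n)) c' d' x * g' x) \<le> norm (g' x)" for n
          using box_bump_bounds[of "1 / real (Suc n)" c' d'] by (auto simp: abs_mult intro!: mult_left_le_one_le)
        show "AE x in lebesgue. (\<lambda>n. box_bump (1 / real (Suc n)) c' d' x * g' x) \<longlonglongrightarrow> indicator (box c' d') x * g' x"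
          by (intro AE_I2 tendsto_mult box_bump_tendsto tendsto_const)
      qed (use g'i in auto)
      moreover have "(LINT x|lebesgue. box_bump (1 / real (Suc n)) c' d' x * g' x) = 0" for n
      proof -
        have "box_bump (1 / real (Suc n)) c' d' \<in> test_functions \<Omega>"
          using cd(2) ab by (intro box_bump_test) auto
        from 0[OF this] have "0 = (LINT x|lebesgue. indicator \<Omega> x *\<^sub>R (box_bump (1 / real (Suc n)) c' d' x * g x))"
          using sO by (subst (asm) integral_restrict_space) auto
        also have "(\<lambda>x. indicator \<Omega> x *\<^sub>R (box_bump (1 / real (Suc n)) c' d' x * g x)) =
           (\<lambda>x. box_bump (1 / real (Suc n)) c' d' x * g' x)"
          using box_bump_outside[of _ c' d' "1 / real (Suc n)"] cd(1) ab box_subset_cbox[of a b]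
          by (fastforce simp: fun_eq_iff indicator_def g'_def)
        finally show ?thesis by simp
      qed
      ultimately have "(LINT x|lebesgue. indicator (box c' d') x * g' x) = 0"
        by (simp add: LIMSEQ_const_iff)
      also have "(\<lambda>x. indicator (box c' d') x * g' x) = (\<lambda>x. indicator (box c d) x * g' x)"
        unfolding cd by (auto simp: g'_def indicator_def fun_eq_iff)
      also have "(LINT x|lebesgue. indicator (box c d) x * g' x) = (LINT x|lebesgue. indicator (box c d) x * h x)"
        using AEh h(1) borel_measurable_integrable[OF g'i]
        by (intro integral_cong_AE borel_measurable_times) (auto simp: measurable_completion)
      also have "\<dots> = (LINT x|lborel. indicator (box c d) x * h x)"
        using h(1) by (intro integral_completion) auto
      finally show "(LINT x|lborel. indicator (box c d) x * h x) = 0" .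
    qed
    then have "AE x in lebesgue. h x = 0" by (simp add: AE_completion)
    with AEh show ?thesis by eventually_elim (auto simp: g'_def)
  qed
  have cbox: "AE x in lebesgue. x \<in> cbox a b \<longrightarrow> g x = 0" if "cbox a b \<subseteq> \<Omega>" for a b
  proof -
    have "cbox a b - box a b \<in> null_sets lebesgue"
      using negligible_frontier_interval[of a b] by (simp add: negligible_iff_null_sets)
    from AE_not_in[OF this] box[OF that] show ?thesis by eventually_elim auto
  qed
  obtain D where D: "countable D" "D \<subseteq> Pow \<Omega>" "\<And>X. X \<in> D \<Longrightarrow> \<exists>a b. X = cbox a b" "\<Union>D = \<Omega>"
    using open_countable_Union_open_cbox[OF \<Omega>] by metis
  have "AE x in lebesgue. x \<in> X \<longrightarrow> g x = 0" if "X \<in> D" for X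
    using D(2,3) cbox that by (metis PowD subsetD)
  then have "AE x in lebesgue. \<forall>X\<in>D. x \<in> X \<longrightarrow> g x = 0"
    by (intro AE_ball_countable'[OF _ D(1)])
  then have "AE x in lebesgue. x \<in> \<Omega> \<longrightarrow> g x = 0"
    unfolding D(4)[symmetric] by eventually_elim auto
  then show ?thesis using sO by (simp add: AE_restrict_space_iff)
qed

section \<open>Square integrable functions\<close>

text \<open>The square of the distance in \<open>L\<^sup>2\<close>.\<close>

definition L2dist :: "(real^'n) set \<Rightarrow> (real^'n \<Rightarrow> 'b::euclidean_space) \<Rightarrow> (real^'n \<Rightarrow> 'b) \<Rightarrow> real" where
  "L2dist \<Omega> f g = (LINT x|lebesgue_on \<Omega>. (norm (f x - g x))\<^sup>2)"

lemma L2dist_nonneg: "0 \<le> L2dist \<Omega> f g"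
  by (simp add: L2dist_def)

lemma L2_measurable:
  "square_integrable \<Omega> f \<Longrightarrow> f \<in> borel_measurable (lebesgue_on \<Omega>)"
  and L2_integrable:
  "square_integrable \<Omega> f \<Longrightarrow> integrable (lebesgue_on \<Omega>) (\<lambda>x. (norm (f x))\<^sup>2)"
  by (auto simp: square_integrable_def)

lemma young_half: "(a::real) * b \<le> (a\<^sup>2 + b\<^sup>2) / 2"
  using sum_squares_bound[of a b] by simp

lemma norm_sum_power2_le: "(norm (a + b))\<^sup>2 \<le> 2 * (norm a)\<^sup>2 + 2 * (norm b)\<^sup>2"
proof -
  have "(norm (a + b))\<^sup>2 \<le> (norm a + norm b)\<^sup>2"
    by (intro power_mono norm_triangle_ineq) auto
  also have "\<dots> \<le> 2 * (norm a)\<^sup>2 + 2 * (norm b)\<^sup>2"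
    using sum_squares_bound[of "norm a" "norm b"] by (simp add: power2_sum)
  finally show ?thesis .
qed

lemma L2_norm_mult:
  assumes "square_integrable \<Omega> f" "square_integrable \<Omega> g"
  shows "integrable (lebesgue_on \<Omega>) (\<lambda>x. norm (f x) * norm (g x))"
proof (rule Bochner_Integration.integrable_bound)
  show "integrable (lebesgue_on \<Omega>) (\<lambda>x. ((norm (f x))\<^sup>2 + (norm (g x))\<^sup>2) / 2)"
    using assms by (auto simp: square_integrable_def)
  show "(\<lambda>x. norm (f x) * norm (g x)) \<in> borel_measurable (lebesgue_on \<Omega>)"
    using assms by (auto simp: square_integrable_def)
  show "AE x in lebesgue_on \<Omega>. norm (norm (f x) * norm (g x)) \<le> norm (((norm (f x))\<^sup>2 + (norm (g x))\<^sup>2) / 2)"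
    by (intro AE_I2) (simp only: real_norm_def abs_mult abs_norm_cancel order_trans[OF young_half abs_ge_self])
qed

lemma L2_inner:
  assumes "square_integrable \<Omega> f" "square_integrable \<Omega> g"
  shows "integrable (lebesgue_on \<Omega>) (\<lambda>x. f x \<bullet> g x)"
  by (rule Bochner_Integration.integrable_bound[OF L2_norm_mult[OF assms]])
     (use assms in \<open>auto simp: square_integrable_def abs_mult Cauchy_Schwarz_ineq2\<close>)

lemma L2_add:
  assumes "square_integrable \<Omega> f" "square_integrable \<Omega> g"
  shows "square_integrable \<Omega> (\<lambda>x. f x + g x)"
  unfolding square_integrable_def
proof (rule conjI[OF _ Bochner_Integration.integrable_bound])
  show "integrable (lebesgue_on \<Omega>) (\<lambda>x. 2 * (norm (f x))\<^sup>2 + 2 * (norm (g x))\<^sup>2)"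
    by (intro Bochner_Integration.integrable_add integrable_mult_right L2_integrable assms)
  show "AE x in lebesgue_on \<Omega>. norm ((norm (f x + g x))\<^sup>2) \<le> norm (2 * (norm (f x))\<^sup>2 + 2 * (norm (g x))\<^sup>2)"
    by (intro AE_I2) (simp add: norm_sum_power2_le)
qed (use assms in \<open>auto simp: square_integrable_def\<close>)

lemma L2_dominated:
  assumes "square_integrable \<Omega> f" "g \<in> borel_measurable (lebesgue_on \<Omega>)"
    "AE x in lebesgue_on \<Omega>. norm (g x) \<le> norm (f x)"
  shows "square_integrable \<Omega> g"
  unfolding square_integrable_def
proof (intro conjI assms(2))
  show "integrable (lebesgue_on \<Omega>) (\<lambda>x. (norm (g x))\<^sup>2)"
  proof (rule Bochner_Integration.integrable_bound[OF L2_integrable[OF assms(1)]])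
    show "AE x in lebesgue_on \<Omega>. norm ((norm (g x))\<^sup>2) \<le> norm ((norm (f x))\<^sup>2)"
      using assms(3) by eventually_elim (auto intro!: power_mono)
  qed (use assms in auto)
qed

lemma L2_scaleR:
  assumes "square_integrable \<Omega> f" shows "square_integrable \<Omega> (\<lambda>x. c *\<^sub>R f x)"
  using assms by (auto simp: square_integrable_def power_mult_distrib)

lemma L2_uminus:
  "square_integrable \<Omega> f \<Longrightarrow> square_integrable \<Omega> (\<lambda>x. - f x)"
  using L2_scaleR[of \<Omega> f "-1"] by simp

lemma L2_diff:
  assumes "square_integrable \<Omega> f" "square_integrable \<Omega> g"
  shows "square_integrable \<Omega> (\<lambda>x. f x - g x)"
  using L2_add[OF assms(1) L2_uminus[OF assms(2)]] by simp

text \<open>A quadratic polynomial without sign change has nonpositive discriminant; this yields the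
  Cauchy--Schwarz inequality.\<close>

lemma quadratic_nonneg_imp:
  fixes A B C :: real
  assumes "\<And>t. 0 \<le> A + 2 * t * B + t\<^sup>2 * C" "C \<ge> 0"
  shows "B\<^sup>2 \<le> A * C"
proof (cases "C = 0")
  case True
  have "B = 0"
  proof (rule ccontr)
    assume "B \<noteq> 0"
    with assms(1)[of "- (A + 1) / (2 * B)"] True assms(1)[of 0] show False by (simp add: field_simps)
  qed
  then show ?thesis using True by simp
next
  case False
  with assms(1)[of "- B / C"] assms(2) show ?thesis
    by (simp add: field_simps power2_eq_square)
qed

lemma Cauchy_Schwarz_integral:
  assumes "square_integrable \<Omega> f" "square_integrable \<Omega> g"
  shows "(LINT x|lebesgue_on \<Omega>. norm (f x) * norm (g x))\<^sup>2
     \<le> (LINT x|lebesgue_on \<Omega>. (norm (f x))\<^sup>2) * (LINT x|lebesgue_on \<Omega>. (norm (g x))\<^sup>2)"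
proof (rule quadratic_nonneg_imp)
  fix t :: real
  have "0 \<le> (LINT x|lebesgue_on \<Omega>. (norm (f x) + t * norm (g x))\<^sup>2)" by simp
  also have "\<dots> = (LINT x|lebesgue_on \<Omega>. (norm (f x))\<^sup>2 + 2 * t * (norm (f x) * norm (g x)) + t\<^sup>2 * (norm (g x))\<^sup>2)"
    by (simp add: power2_sum power_mult_distrib algebra_simps)
  also have "\<dots> = (LINT x|lebesgue_on \<Omega>. (norm (f x))\<^sup>2) + 2 * t * (LINT x|lebesgue_on \<Omega>. norm (f x) * norm (g x))
     + t\<^sup>2 * (LINT x|lebesgue_on \<Omega>. (norm (g x))\<^sup>2)"
    using L2_norm_mult[OF assms] L2_integrable[OF assms(1)]
      L2_integrable[OF assms(2)] by simp
  finally show "0 \<le> \<dots>" .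
qed simp

lemma L2dist_triangle:
  assumes "square_integrable \<Omega> f" "square_integrable \<Omega> g" "square_integrable \<Omega> h"
  shows "L2dist \<Omega> f h \<le> 2 * L2dist \<Omega> f g + 2 * L2dist \<Omega> g h"
proof -
  have "L2dist \<Omega> f h \<le> (LINT x|lebesgue_on \<Omega>. 2 * (norm (f x - g x))\<^sup>2 + 2 * (norm (g x - h x))\<^sup>2)"
    unfolding L2dist_def
  proof (rule integral_mono)
    show "(norm (f x - h x))\<^sup>2 \<le> 2 * (norm (f x - g x))\<^sup>2 + 2 * (norm (g x - h x))\<^sup>2" for x
      using norm_sum_power2_le[of "f x - g x" "g x - h x"] by simp
  qed (use assms in \<open>auto intro!: L2_integrable L2_diff Bochner_Integration.integrable_add\<close>)
  also have "\<dots> = 2 * L2dist \<Omega> f g + 2 * L2dist \<Omega> g h"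
    unfolding L2dist_def
    using L2_integrable[OF L2_diff[OF assms(1,2)]] L2_integrable[OF L2_diff[OF assms(2,3)]]
    by simp
  finally show ?thesis .
qed

lemma L2dist_add:
  assumes "square_integrable \<Omega> f" "square_integrable \<Omega> g" "square_integrable \<Omega> f'" "square_integrable \<Omega> g'"
  shows "L2dist \<Omega> (\<lambda>x. f x + g x) (\<lambda>x. f' x + g' x) \<le> 2 * L2dist \<Omega> f f' + 2 * L2dist \<Omega> g g'"
proof -
  have "L2dist \<Omega> (\<lambda>x. f x + g x) (\<lambda>x. f' x + g' x) \<le>
     (LINT x|lebesgue_on \<Omega>. 2 * (norm (f x - f' x))\<^sup>2 + 2 * (norm (g x - g' x))\<^sup>2)"
    unfolding L2dist_def
  proof (rule integral_mono)
    show "(norm (f x + g x - (f' x + g' x)))\<^sup>2 \<le> 2 * (norm (f x - f' x))\<^sup>2 + 2 * (norm (g x - g' x))\<^sup>2" for x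
      using norm_sum_power2_le[of "f x - f' x" "g x - g' x"] by (simp add: algebra_simps)
  qed (use assms in \<open>auto intro!: L2_integrable L2_diff L2_add Bochner_Integration.integrable_add\<close>)
  also have "\<dots> = 2 * L2dist \<Omega> f f' + 2 * L2dist \<Omega> g g'"
    unfolding L2dist_def
    using L2_integrable[OF L2_diff[OF assms(1,3)]] L2_integrable[OF L2_diff[OF assms(2,4)]]
    by simp
  finally show ?thesis .
qed

lemma L2dist_scaleR: "L2dist \<Omega> (\<lambda>x. c *\<^sub>R f x) (\<lambda>x. c *\<^sub>R g x) = c\<^sup>2 * L2dist \<Omega> f g"
  unfolding L2dist_def by (simp add: power_mult_distrib flip: scaleR_diff_right)

lemma L2_tendsto_inner:
  assumes "square_integrable \<Omega> f" "\<And>k::nat. square_integrable \<Omega> (F k)" "square_integrable \<Omega> g"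
    and "(\<lambda>k. L2dist \<Omega> f (F k)) \<longlonglongrightarrow> 0"
  shows "(\<lambda>k. LINT x|lebesgue_on \<Omega>. F k x \<bullet> g x) \<longlonglongrightarrow> (LINT x|lebesgue_on \<Omega>. f x \<bullet> g x)"
proof -
  have bd: "\<bar>(LINT x|lebesgue_on \<Omega>. F k x \<bullet> g x) - (LINT x|lebesgue_on \<Omega>. f x \<bullet> g x)\<bar>
      \<le> sqrt (L2dist \<Omega> f (F k) * (LINT x|lebesgue_on \<Omega>. (norm (g x))\<^sup>2))" for k
  proof -
    have "(LINT x|lebesgue_on \<Omega>. F k x \<bullet> g x) - (LINT x|lebesgue_on \<Omega>. f x \<bullet> g x) =
        (LINT x|lebesgue_on \<Omega>. (F k x - f x) \<bullet> g x)"
      using L2_inner[OF assms(1,3)] L2_inner[OF assms(2,3)]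
      by (simp add: inner_diff_left)
    also have "norm \<dots> \<le> (LINT x|lebesgue_on \<Omega>. norm (f x - F k x) * norm (g x))"
    proof (rule Bochner_Integration.integral_norm_bound_integral)
      show "norm ((F k x - f x) \<bullet> g x) \<le> norm (f x - F k x) * norm (g x)" for x
        by (metis Cauchy_Schwarz_ineq2 norm_minus_commute real_norm_def)
    qed (intro L2_inner L2_norm_mult L2_diff assms)+
    also have "\<dots> \<le> sqrt (L2dist \<Omega> f (F k) * (LINT x|lebesgue_on \<Omega>. (norm (g x))\<^sup>2))"
      unfolding L2dist_def
      by (intro real_le_rsqrt Cauchy_Schwarz_integral L2_diff assms)
    finally show ?thesis by simp
  qed
  have "(\<lambda>k. sqrt (L2dist \<Omega> f (F k) * (LINT x|lebesgue_on \<Omega>. (norm (g x))\<^sup>2))) \<longlonglongrightarrow> sqrt (0 * (LINT x|lebesgue_on \<Omega>. (norm (g x))\<^sup>2))"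
    by (intro tendsto_intros assms)
  then have "(\<lambda>k. sqrt (L2dist \<Omega> f (F k) * (LINT x|lebesgue_on \<Omega>. (norm (g x))\<^sup>2))) \<longlonglongrightarrow> 0" by simp
  then have "(\<lambda>k. (LINT x|lebesgue_on \<Omega>. F k x \<bullet> g x) - (LINT x|lebesgue_on \<Omega>. f x \<bullet> g x)) \<longlonglongrightarrow> 0"
    by (rule Lim_null_comparison[rotated]) (intro always_eventually allI, simp add: bd)
  then show ?thesis by (simp add: LIM_zero_iff)
qed

text \<open>Expand \<open>|f - F\<^sub>k|\<^sup>2\<close> and use the convergence of the mixed term.\<close>

lemma L2_tendsto_norm:
  assumes "square_integrable \<Omega> f" "\<And>k::nat. square_integrable \<Omega> (F k)"
    and "(\<lambda>k. L2dist \<Omega> f (F k)) \<longlonglongrightarrow> 0"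
  shows "(\<lambda>k. LINT x|lebesgue_on \<Omega>. (norm (F k x))\<^sup>2) \<longlonglongrightarrow> (LINT x|lebesgue_on \<Omega>. (norm (f x))\<^sup>2)"
proof -
  have eq: "(LINT x|lebesgue_on \<Omega>. (norm (F k x))\<^sup>2) =
     L2dist \<Omega> f (F k) + 2 * (LINT x|lebesgue_on \<Omega>. F k x \<bullet> f x) - (LINT x|lebesgue_on \<Omega>. (norm (f x))\<^sup>2)" for k
  proof -
    have "(LINT x|lebesgue_on \<Omega>. (norm (F k x))\<^sup>2) = (LINT x|lebesgue_on \<Omega>. (norm (f x - F k x))\<^sup>2 + 2 * (F k x \<bullet> f x) - (norm (f x))\<^sup>2)"
      by (intro Bochner_Integration.integral_cong) (auto simp: power2_norm_eq_inner inner_commute algebra_simps)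
    then show ?thesis unfolding L2dist_def
      using L2_integrable[OF L2_diff[OF assms(1) assms(2)[of k]]]
        L2_inner[OF assms(2)[of k] assms(1)] L2_integrable[OF assms(1)] by simp
  qed
  have "(\<lambda>k. L2dist \<Omega> f (F k) + 2 * (LINT x|lebesgue_on \<Omega>. F k x \<bullet> f x) - (LINT x|lebesgue_on \<Omega>. (norm (f x))\<^sup>2))
     \<longlonglongrightarrow> 0 + 2 * (LINT x|lebesgue_on \<Omega>. f x \<bullet> f x) - (LINT x|lebesgue_on \<Omega>. (norm (f x))\<^sup>2)"
    by (intro tendsto_intros assms L2_tendsto_inner)
  then show ?thesis unfolding eq by (simp add: power2_norm_eq_inner)
qed

lemma L2_AE_subseq:
  assumes "square_integrable \<Omega> f" "\<And>k::nat. square_integrable \<Omega> (F k)" "(\<lambda>k. L2dist \<Omega> f (F k)) \<longlonglongrightarrow> 0"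
  obtains r where "strict_mono r" "AE x in lebesgue_on \<Omega>. (\<lambda>k. F (r k) x) \<longlonglongrightarrow> f x"
proof -
  have "\<exists>r::nat\<Rightarrow>nat. strict_mono r \<and> (AE x in lebesgue_on \<Omega>. (\<lambda>k. (norm (f x - F (r k) x))\<^sup>2) \<longlonglongrightarrow> 0)"
  proof (rule tendsto_L1_AE_subseq)
    show "integrable (lebesgue_on \<Omega>) (\<lambda>x. (norm (f x - F n x))\<^sup>2)" for n
      using assms by (intro L2_integrable L2_diff)
    show "(\<lambda>n. LINT x|lebesgue_on \<Omega>. norm ((norm (f x - F n x))\<^sup>2)) \<longlonglongrightarrow> 0"
      using assms(3) by (simp add: L2dist_def)
  qed
  then obtain r :: "nat \<Rightarrow> nat" where r: "strict_mono r" "AE x in lebesgue_on \<Omega>. (\<lambda>k. (norm (f x - F (r k) x))\<^sup>2) \<longlonglongrightarrow> 0"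
    by blast
  have "AE x in lebesgue_on \<Omega>. (\<lambda>k. F (r k) x) \<longlonglongrightarrow> f x"
    using r(2)
  proof eventually_elim
    case (elim x)
    then have "(\<lambda>k. sqrt ((norm (f x - F (r k) x))\<^sup>2)) \<longlonglongrightarrow> sqrt 0" by (intro tendsto_intros)
    then have "(\<lambda>k. norm (F (r k) x - f x)) \<longlonglongrightarrow> 0" by (simp add: norm_minus_commute)
    then show ?case by (simp add: tendsto_norm_zero_iff LIM_zero_iff)
  qed
  with r(1) that show ?thesis by blast
qed

lemma L2_bounded:
  assumes "\<Omega> \<in> lmeasurable" "f \<in> borel_measurable (lebesgue_on \<Omega>)" "\<And>x. x \<in> \<Omega> \<Longrightarrow> norm (f x) \<le> B"
  shows "square_integrable \<Omega> f"
  unfolding square_integrable_def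
proof (intro conjI assms)
  have "finite_measure (lebesgue_on \<Omega>)"
    using assms(1) by (simp add: finite_measure_lebesgue_on)
  then show "integrable (lebesgue_on \<Omega>) (\<lambda>x. (norm (f x))\<^sup>2)"
  proof (rule finite_measure.integrable_const_bound[where B = "B\<^sup>2"])
    show "AE x in lebesgue_on \<Omega>. norm ((norm (f x))\<^sup>2) \<le> B\<^sup>2"
      using assms(3) by (auto intro!: AE_I2 power_mono)
  qed (use assms in auto)
qed

lemma L2_continuous:
  fixes f :: "real^'n \<Rightarrow> 'b::euclidean_space"
  assumes "bounded \<Omega>" "open \<Omega>" "continuous_on UNIV f"
  shows "square_integrable \<Omega> f"
proof -
  have "compact (f ` closure \<Omega>)"
    using assms by (intro compact_continuous_image) (auto intro: continuous_on_subset simp: compact_closure)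
  then obtain B where B: "\<And>x. x \<in> \<Omega> \<Longrightarrow> norm (f x) \<le> B"
    using compact_imp_bounded[of "f ` closure \<Omega>"] closure_subset[of \<Omega>] by (auto simp: bounded_iff)
  have "f \<in> borel_measurable (lebesgue_on \<Omega>)"
    using assms(3) by (intro measurable_restrict_space1 measurable_completion) (simp add: borel_measurable_continuous_onI)
  moreover have "\<Omega> \<in> lmeasurable"
    using assms by (simp add: lmeasurable_open)
  ultimately show ?thesis using B by (intro L2_bounded)
qed

lemma L2_locally_integrable:
  fixes f :: "real^'n \<Rightarrow> 'b::euclidean_space"
  assumes "open \<Omega>" "square_integrable \<Omega> f" shows "locally_integrable \<Omega> f"
  unfolding locally_integrable_def
proof (intro allI impI, elim conjE)
  fix K assume K: "compact K" "K \<subseteq> \<Omega>"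
  have KL: "K \<in> lmeasurable" using K by (simp add: lmeasurable_compact)
  have m: "f \<in> borel_measurable (lebesgue_on K)"
    using measurable_restrict_mono[OF L2_measurable[OF assms(2)] K(2)] .
  have "integrable lebesgue (\<lambda>x. indicator \<Omega> x *\<^sub>R (norm (f x))\<^sup>2)"
    using L2_integrable[OF assms(2)] assms(1) by (subst (asm) integrable_restrict_space) (auto intro: borel_open)
  from integrable_mult_indicator[OF _ this, of K] KL
  have "integrable lebesgue (\<lambda>x. indicator K x *\<^sub>R indicator \<Omega> x *\<^sub>R (norm (f x))\<^sup>2)" by auto
  also have "(\<lambda>x. indicator K x *\<^sub>R indicator \<Omega> x *\<^sub>R (norm (f x))\<^sup>2) = (\<lambda>x. indicator K x *\<^sub>R (norm (f x))\<^sup>2)"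
    using K by (auto simp: indicator_def fun_eq_iff)
  finally have i2: "integrable (lebesgue_on K) (\<lambda>x. (norm (f x))\<^sup>2)"
    using KL by (subst integrable_restrict_space) auto
  have i1: "integrable (lebesgue_on K) (\<lambda>x. 1::real)"
    using finite_measure.integrable_const[OF finite_measure_lebesgue_on[OF KL]] by auto
  show "integrable (lebesgue_on K) f"
  proof (rule Bochner_Integration.integrable_bound[OF Bochner_Integration.integrable_add[OF i1 i2] m])
    show "AE x in lebesgue_on K. norm (f x) \<le> norm (1 + (norm (f x))\<^sup>2)"
      using young_half[of 1 "norm (f _)"] by (auto intro!: AE_I2) (smt (verit) one_power2 zero_le_power2 field_sum_of_halves)
  qed
qed

section \<open>The space H01 through approximation by test functions\<close>

text \<open>A member of \<open>H01\<close> together with its gradient. Carrying a concrete gradient avoids the arbitrary choice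
  made by \<open>weak_grad\<close>, and approximation up to every \<open>e\<close> makes closedness under limits immediate.
  That nothing is lost is the content of \<open>H01_obtain_pair\<close>, \<open>H01_pair_imp_H01\<close> and \<open>H01_pair_weak_grad\<close>.\<close>

definition H01_pair :: "(real^'n) set \<Rightarrow> (real^'n \<Rightarrow> real) \<Rightarrow> (real^'n \<Rightarrow> real^'n) \<Rightarrow> bool" where
  "H01_pair \<Omega> u G \<longleftrightarrow> square_integrable \<Omega> u \<and> square_integrable \<Omega> G \<and>
     (\<forall>e>0. \<exists>\<phi>\<in>test_functions \<Omega>. L2dist \<Omega> u \<phi> < e \<and> L2dist \<Omega> G (grad \<phi>) < e)"

lemma H01_pairD:
  "H01_pair \<Omega> u G \<Longrightarrow> square_integrable \<Omega> u" "H01_pair \<Omega> u G \<Longrightarrow> square_integrable \<Omega> G"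
  by (auto simp: H01_pair_def)

lemma test_function_L2:
  fixes \<phi> :: "real^'n \<Rightarrow> real"
  assumes "\<phi> \<in> test_functions \<Omega>" "open \<Omega>"
  shows "square_integrable \<Omega> \<phi>" "square_integrable \<Omega> (grad \<phi>)"
proof -
  note t = test_functionsD[OF assms(1)]
  have S: "\<Omega> \<in> sets lebesgue" using assms(2) by (auto intro: borel_open)
  have *: "square_integrable \<Omega> f" if "continuous_on UNIV f" "\<And>x. x \<notin> closure {x. \<phi> x \<noteq> 0} \<Longrightarrow> f x = 0" for f :: "real^'n \<Rightarrow> 'b::euclidean_space"
    unfolding square_integrable_def
  proof
    show "f \<in> borel_measurable (lebesgue_on \<Omega>)"
      using that(1) by (intro measurable_restrict_space1 measurable_completion) (simp add: borel_measurable_continuous_onI)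
    show "integrable (lebesgue_on \<Omega>) (\<lambda>x. (norm (f x))\<^sup>2)"
      by (rule compact_support_integrable(2)[OF _ t(2) _ S])
         (use that in \<open>auto intro!: continuous_intros simp del: closure_eq\<close>)
  qed
  show "square_integrable \<Omega> \<phi>"
    using subsetD[OF closure_subset[of "{x. \<phi> x \<noteq> 0}"]] by (intro * smooth_continuous t) blast
  show "square_integrable \<Omega> (grad \<phi>)"
    by (intro * continuous_grad t grad_outside_support)
qed

lemma H01_pair_seq:
  assumes "H01_pair \<Omega> u G"
  obtains \<phi> where "\<And>k::nat. \<phi> k \<in> test_functions \<Omega>" "(\<lambda>k. L2dist \<Omega> u (\<phi> k)) \<longlonglongrightarrow> 0"
    "(\<lambda>k. L2dist \<Omega> G (grad (\<phi> k))) \<longlonglongrightarrow> 0"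
proof -
  have "\<exists>\<phi>\<in>test_functions \<Omega>. L2dist \<Omega> u \<phi> < 1 / real (Suc k) \<and> L2dist \<Omega> G (grad \<phi>) < 1 / real (Suc k)" for k
    using assms by (auto simp: H01_pair_def)
  then obtain \<phi> where \<phi>: "\<And>k::nat. \<phi> k \<in> test_functions \<Omega>" "\<And>k. L2dist \<Omega> u (\<phi> k) < 1 / real (Suc k)"
    "\<And>k. L2dist \<Omega> G (grad (\<phi> k)) < 1 / real (Suc k)" by metis
  have l: "(\<lambda>k. 1 / real (Suc k)) \<longlonglongrightarrow> 0"
    using LIMSEQ_inverse_real_of_nat by (simp add: inverse_eq_divide)
  show ?thesis
    by (rule that[of \<phi>, OF \<phi>(1)]; rule Lim_null_comparison[OF always_eventually l])
       (auto simp del: of_nat_Suc simp: abs_of_nonneg[OF L2dist_nonneg] intro!: less_imp_le \<phi>)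
qed

lemma H01_pair_seqI:
  assumes "square_integrable \<Omega> u" "square_integrable \<Omega> G" "\<And>k::nat. \<phi> k \<in> test_functions \<Omega>"
    "(\<lambda>k. L2dist \<Omega> u (\<phi> k)) \<longlonglongrightarrow> 0" "(\<lambda>k. L2dist \<Omega> G (grad (\<phi> k))) \<longlonglongrightarrow> 0"
  shows "H01_pair \<Omega> u G"
  unfolding H01_pair_def
proof (intro conjI assms allI impI)
  fix e :: real assume "e > 0"
  then have "\<forall>\<^sub>F k in sequentially. L2dist \<Omega> u (\<phi> k) < e \<and> L2dist \<Omega> G (grad (\<phi> k)) < e"
    using assms(4,5) by (intro eventually_conj order_tendstoD(2)) auto
  then show "\<exists>\<phi>\<in>test_functions \<Omega>. L2dist \<Omega> u \<phi> < e \<and> L2dist \<Omega> G (grad \<phi>) < e"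
    using assms(3) unfolding eventually_sequentially by blast
qed

lemma H01_pair_closed:
  assumes "open \<Omega>" "square_integrable \<Omega> u" "square_integrable \<Omega> G" "\<And>k::nat. H01_pair \<Omega> (U k) (H k)"
    "(\<lambda>k. L2dist \<Omega> u (U k)) \<longlonglongrightarrow> 0" "(\<lambda>k. L2dist \<Omega> G (H k)) \<longlonglongrightarrow> 0"
  shows "H01_pair \<Omega> u G"
  unfolding H01_pair_def
proof (intro conjI assms allI impI)
  fix e :: real assume e: "e > 0"
  then have "\<forall>\<^sub>F k in sequentially. L2dist \<Omega> u (U k) < e/4 \<and> L2dist \<Omega> G (H k) < e/4"
    using assms(5,6) by (intro eventually_conj order_tendstoD(2)) auto
  then obtain k where k: "L2dist \<Omega> u (U k) < e/4" "L2dist \<Omega> G (H k) < e/4"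
    unfolding eventually_sequentially by blast
  from assms(4)[of k] e obtain \<phi> where \<phi>: "\<phi> \<in> test_functions \<Omega>" "L2dist \<Omega> (U k) \<phi> < e/4" "L2dist \<Omega> (H k) (grad \<phi>) < e/4"
    unfolding H01_pair_def by (meson divide_pos_pos zero_less_numeral)
  have "L2dist \<Omega> u \<phi> < e" "L2dist \<Omega> G (grad \<phi>) < e"
    using L2dist_triangle[OF assms(2) H01_pairD(1)[OF assms(4)[of k]] test_function_L2(1)[OF \<phi>(1) assms(1)]]
      L2dist_triangle[OF assms(3) H01_pairD(2)[OF assms(4)[of k]] test_function_L2(2)[OF \<phi>(1) assms(1)]] k \<phi>
    by auto
  with \<phi>(1) show "\<exists>\<phi>\<in>test_functions \<Omega>. L2dist \<Omega> u \<phi> < e \<and> L2dist \<Omega> G (grad \<phi>) < e" by blast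
qed

lemma H01_pair_test:
  assumes "open \<Omega>" "\<phi> \<in> test_functions \<Omega>" shows "H01_pair \<Omega> \<phi> (grad \<phi>)"
  by (rule H01_pair_seqI[where \<phi> = "\<lambda>_. \<phi>"])
     (use assms test_function_L2[OF assms(2,1)] in \<open>auto simp: L2dist_def\<close>)

lemma grad_scale_add:
  assumes "smooth f" "smooth g"
  shows "grad (\<lambda>x. a * f x + b * g x) = (\<lambda>x. a *\<^sub>R grad f x + b *\<^sub>R grad g x)"
proof -
  have "partial_deriv i (\<lambda>x. a * f x + b * g x) x = a * partial_deriv i f x + b * partial_deriv i g x" for i x
    unfolding partial_deriv_def[of i f] partial_deriv_def[of i g]
    by (rule partial_derivI) (use assms[THEN smooth_has_derivative, of x] in \<open>auto intro!: derivative_eq_intros\<close>)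
  then show ?thesis by (auto simp: vec_eq_iff fun_eq_iff)
qed

lemma H01_pair_lincomb:
  assumes "open \<Omega>" "H01_pair \<Omega> u G" "H01_pair \<Omega> v H"
  shows "H01_pair \<Omega> (\<lambda>x. a * u x + b * v x) (\<lambda>x. a *\<^sub>R G x + b *\<^sub>R H x)"
proof -
  obtain \<phi> where \<phi>: "\<And>k::nat. \<phi> k \<in> test_functions \<Omega>" "(\<lambda>k. L2dist \<Omega> u (\<phi> k)) \<longlonglongrightarrow> 0"
    "(\<lambda>k. L2dist \<Omega> G (grad (\<phi> k))) \<longlonglongrightarrow> 0" by (rule H01_pair_seq[OF assms(2)]) blast
  obtain \<psi> where \<psi>: "\<And>k::nat. \<psi> k \<in> test_functions \<Omega>" "(\<lambda>k. L2dist \<Omega> v (\<psi> k)) \<longlonglongrightarrow> 0"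
    "(\<lambda>k. L2dist \<Omega> H (grad (\<psi> k))) \<longlonglongrightarrow> 0" by (rule H01_pair_seq[OF assms(3)]) blast
  note sq = L2_scaleR[OF H01_pairD(1)[OF assms(2)]] L2_scaleR[OF H01_pairD(2)[OF assms(2)]]
    L2_scaleR[OF H01_pairD(1)[OF assms(3)]] L2_scaleR[OF H01_pairD(2)[OF assms(3)]]
    L2_scaleR[OF test_function_L2(1)[OF \<phi>(1) assms(1)]]
    L2_scaleR[OF test_function_L2(2)[OF \<phi>(1) assms(1)]]
    L2_scaleR[OF test_function_L2(1)[OF \<psi>(1) assms(1)]]
    L2_scaleR[OF test_function_L2(2)[OF \<psi>(1) assms(1)]]
  have lim: "(\<lambda>k. L2dist \<Omega> (\<lambda>x. a *\<^sub>R f x + b *\<^sub>R h x) (\<lambda>x. a *\<^sub>R F k x + b *\<^sub>R E k x)) \<longlonglongrightarrow> 0"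
    if "square_integrable \<Omega> (\<lambda>x. a *\<^sub>R f x)" "square_integrable \<Omega> (\<lambda>x. b *\<^sub>R h x)"
      "\<And>k. square_integrable \<Omega> (\<lambda>x. a *\<^sub>R F k x)" "\<And>k. square_integrable \<Omega> (\<lambda>x. b *\<^sub>R E k x)"
      "(\<lambda>k. L2dist \<Omega> f (F k)) \<longlonglongrightarrow> 0" "(\<lambda>k. L2dist \<Omega> h (E k)) \<longlonglongrightarrow> 0"
    for f h :: "real^'a \<Rightarrow> 'b::euclidean_space" and F E
  proof (rule Lim_null_comparison[OF always_eventually])
    show "(\<lambda>k. 2 * (a\<^sup>2 * L2dist \<Omega> f (F k)) + 2 * (b\<^sup>2 * L2dist \<Omega> h (E k))) \<longlonglongrightarrow> 0"
      using that(5,6) by (auto intro!: tendsto_eq_intros)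
    show "\<forall>k. norm (L2dist \<Omega> (\<lambda>x. a *\<^sub>R f x + b *\<^sub>R h x) (\<lambda>x. a *\<^sub>R F k x + b *\<^sub>R E k x))
       \<le> 2 * (a\<^sup>2 * L2dist \<Omega> f (F k)) + 2 * (b\<^sup>2 * L2dist \<Omega> h (E k))"
      using L2dist_add[OF that(1,2,3,4)] by (auto simp: L2dist_scaleR abs_of_nonneg[OF L2dist_nonneg])
  qed
  show ?thesis
  proof (rule H01_pair_seqI[where \<phi> = "\<lambda>k x. a * \<phi> k x + b * \<psi> k x"])
    show "square_integrable \<Omega> (\<lambda>x. a * u x + b * v x)" "square_integrable \<Omega> (\<lambda>x. a *\<^sub>R G x + b *\<^sub>R H x)"
      using L2_add[OF sq(1)[of a] sq(3)[of b]] L2_add[OF sq(2)[of a] sq(4)[of b]] by auto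
    show "(\<lambda>x. a * \<phi> k x + b * \<psi> k x) \<in> test_functions \<Omega>" for k
      by (intro test_functions_add test_functions_mult \<phi> \<psi> smooth_const)
    show "(\<lambda>k. L2dist \<Omega> (\<lambda>x. a * u x + b * v x) (\<lambda>x. a * \<phi> k x + b * \<psi> k x)) \<longlonglongrightarrow> 0"
      using lim[OF sq(1) sq(3) sq(5) sq(7) \<phi>(2) \<psi>(2)] by simp
    show "(\<lambda>k. L2dist \<Omega> (\<lambda>x. a *\<^sub>R G x + b *\<^sub>R H x) (grad (\<lambda>x. a * \<phi> k x + b * \<psi> k x))) \<longlonglongrightarrow> 0"
      using lim[OF sq(2) sq(4) sq(6) sq(8) \<phi>(3) \<psi>(3)] test_functionsD(1)[OF \<phi>(1)] test_functionsD(1)[OF \<psi>(1)] by (simp add: grad_scale_add)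
  qed
qed

lemma integral_vec_nth:
  fixes f :: "'a \<Rightarrow> real^'n"
  assumes "integrable M f" shows "(LINT x|M. f x) $ i = (LINT x|M. f x $ i)"
  using integral_bounded_linear[OF bounded_linear_vec_nth assms] by simp

lemma integrable_bounded_mult:
  fixes f :: "'a \<Rightarrow> 'b::{banach, second_countable_topology}"
  assumes "integrable M f" "h \<in> borel_measurable M" "\<And>x. \<bar>h x\<bar> \<le> B"
  shows "integrable M (\<lambda>x. h x *\<^sub>R f x)"
proof (rule Bochner_Integration.integrable_bound)
  show "integrable M (\<lambda>x. B * norm (f x))" using assms(1) by auto
  show "(\<lambda>x. h x *\<^sub>R f x) \<in> borel_measurable M" using assms by auto
  show "AE x in M. norm (h x *\<^sub>R f x) \<le> norm (B * norm (f x))"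
  proof (rule AE_I2)
    fix x
    have "\<bar>h x\<bar> * norm (f x) \<le> \<bar>B\<bar> * norm (f x)"
      using assms(3)[of x] by (intro mult_right_mono) auto
    then show "norm (h x *\<^sub>R f x) \<le> norm (B * norm (f x))" by (simp add: abs_mult)
  qed
qed

text \<open>On its compact support the test function is bounded and \<open>g\<close> is integrable.\<close>

lemma test_function_mult_integrable:
  fixes g :: "real^'n \<Rightarrow> 'b::euclidean_space"
  assumes "open \<Omega>" "locally_integrable \<Omega> g" "\<phi> \<in> test_functions \<Omega>"
  shows "integrable (lebesgue_on \<Omega>) (\<lambda>x. \<phi> x *\<^sub>R g x)"
proof -
  define K where "K = closure {x. \<phi> x \<noteq> 0}"
  note t = test_functionsD[OF assms(3), folded K_def]
  have \<phi>0: "\<phi> x = 0" if "x \<notin> K" for x using that closure_subset[of "{x. \<phi> x \<noteq> 0}"] unfolding K_def by blast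
  have KS: "K \<in> sets lebesgue" using t(2) by (simp add: lmeasurable_compact fmeasurableD)
  have "compact (\<phi> ` K)" using t by (intro compact_continuous_image smooth_continuous)
  then obtain B where "\<And>x. x \<in> K \<Longrightarrow> \<bar>\<phi> x\<bar> \<le> B"
    using compact_imp_bounded[of "\<phi> ` K"] by (auto simp: bounded_iff)
  then have B: "\<bar>\<phi> x\<bar> \<le> max B 0" for x using \<phi>0[of x] by (cases "x \<in> K") fastforce+
  have "integrable (lebesgue_on K) g" using assms(2) t by (auto simp: locally_integrable_def)
  then have "integrable lebesgue (\<lambda>x. indicator K x *\<^sub>R g x)"
    using KS by (subst (asm) integrable_restrict_space) auto
  moreover have "\<phi> \<in> borel_measurable lebesgue"
    using smooth_continuous[OF t(1), of UNIV] by (auto intro!: measurable_completion borel_measurable_continuous_onI)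
  ultimately have "integrable lebesgue (\<lambda>x. \<phi> x *\<^sub>R indicator K x *\<^sub>R g x)"
    using B by (rule integrable_bounded_mult)
  also have "(\<lambda>x. \<phi> x *\<^sub>R indicator K x *\<^sub>R g x) = (\<lambda>x. indicator \<Omega> x *\<^sub>R (\<phi> x *\<^sub>R g x))"
    using \<phi>0 t(3) by (fastforce simp: fun_eq_iff indicator_def)
  finally show ?thesis using assms(1) by (subst integrable_restrict_space) (auto intro: borel_open)
qed

text \<open>A function that is known only up to null sets, such as \<open>weak_grad\<close>, is measurable as soon as one of
  its representatives is, because Lebesgue measure is complete.\<close>

lemma borel_measurable_lebesgue_on_cong_AE:
  assumes "\<Omega> \<in> sets lebesgue" "f \<in> borel_measurable (lebesgue_on \<Omega>)" "AE x in lebesgue_on \<Omega>. f x = g x"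
  shows "g \<in> borel_measurable (lebesgue_on \<Omega>)"
proof -
  have c: "complete_measure (lebesgue_on \<Omega>)"
  proof
    fix A B assume AB: "A \<subseteq> B" "B \<in> null_sets (lebesgue_on \<Omega>)"
    then have "B \<in> null_sets lebesgue" "B \<subseteq> \<Omega>"
      using assms(1) by (auto simp: null_sets_restrict_space)
    then have "A \<in> sets lebesgue" "A \<subseteq> \<Omega>"
      using AB completion.complete2[of A B lborel] by auto
    then show "A \<in> sets (lebesgue_on \<Omega>)"
      using assms(1) by (simp add: sets_restrict_space_iff)
  qed
  show ?thesis
  proof (rule measurableI)
    fix X :: "'b set" assume X: "X \<in> sets borel"
    show "g -` X \<inter> space (lebesgue_on \<Omega>) \<in> sets (lebesgue_on \<Omega>)"
    proof (rule complete_measure.in_sets_AE[OF c])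
      show "f -` X \<inter> space (lebesgue_on \<Omega>) \<in> sets (lebesgue_on \<Omega>)"
        using assms(2) X by (rule measurable_sets)
      show "AE x in lebesgue_on \<Omega>. (x \<in> f -` X \<inter> space (lebesgue_on \<Omega>)) = (x \<in> g -` X \<inter> space (lebesgue_on \<Omega>))"
        using assms(3) by eventually_elim auto
    qed auto
  qed auto
qed

text \<open>The components of \<open>G - H\<close> integrate to zero against all test functions.\<close>

lemma weak_grad_unique:
  assumes \<Omega>: "open \<Omega>" and G: "has_weak_grad \<Omega> u G" and H: "has_weak_grad \<Omega> u H"
  shows "AE x in lebesgue_on \<Omega>. G x = H x"
proof -
  have "AE x in lebesgue_on \<Omega>. G x $ i - H x $ i = 0" for i
  proof (rule fundamental_lemma[OF \<Omega>])
    show "locally_integrable \<Omega> (\<lambda>x. G x $ i - H x $ i)"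
      using G H unfolding has_weak_grad_def locally_integrable_def
      by (auto intro!: Bochner_Integration.integrable_diff integrable_bounded_linear[OF bounded_linear_vec_nth])
    fix \<phi> assume \<phi>: "\<phi> \<in> test_functions \<Omega>"
    have i: "integrable (lebesgue_on \<Omega>) (\<lambda>x. \<phi> x *\<^sub>R G x)" "integrable (lebesgue_on \<Omega>) (\<lambda>x. \<phi> x *\<^sub>R H x)"
      using G H \<phi> \<Omega> by (auto simp: has_weak_grad_def intro!: test_function_mult_integrable)
    have "(LINT x|lebesgue_on \<Omega>. \<phi> x *\<^sub>R G x) = (LINT x|lebesgue_on \<Omega>. \<phi> x *\<^sub>R H x)"
    proof -
      have "(LINT x|lebesgue_on \<Omega>. u x *\<^sub>R grad \<phi> x) = - (LINT x|lebesgue_on \<Omega>. \<phi> x *\<^sub>R G x)"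
        using G \<phi> unfolding has_weak_grad_def by (elim conjE) (erule (1) bspec)
      moreover have "(LINT x|lebesgue_on \<Omega>. u x *\<^sub>R grad \<phi> x) = - (LINT x|lebesgue_on \<Omega>. \<phi> x *\<^sub>R H x)"
        using H \<phi> unfolding has_weak_grad_def by (elim conjE) (erule (1) bspec)
      ultimately show ?thesis by simp
    qed
    then have "(LINT x|lebesgue_on \<Omega>. \<phi> x *\<^sub>R G x) $ i = (LINT x|lebesgue_on \<Omega>. \<phi> x *\<^sub>R H x) $ i" by simp
    then have "(LINT x|lebesgue_on \<Omega>. \<phi> x * G x $ i) = (LINT x|lebesgue_on \<Omega>. \<phi> x * H x $ i)"
      by (simp add: integral_vec_nth i)
    moreover have "integrable (lebesgue_on \<Omega>) (\<lambda>x. \<phi> x * G x $ i)" "integrable (lebesgue_on \<Omega>) (\<lambda>x. \<phi> x * H x $ i)"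
      using integrable_bounded_linear[OF bounded_linear_vec_nth i(1), of i] integrable_bounded_linear[OF bounded_linear_vec_nth i(2), of i] by auto
    ultimately show "(LINT x|lebesgue_on \<Omega>. \<phi> x * (G x $ i - H x $ i)) = 0"
      by (simp add: right_diff_distrib)
  qed
  then have "AE x in lebesgue_on \<Omega>. \<forall>i. G x $ i - H x $ i = 0"
    by (simp add: AE_all_countable)
  then show ?thesis by eventually_elim (simp add: vec_eq_iff)
qed

text \<open>There is no boundary term, because \<open>u\<close> is a limit of test functions, for which the identity holds.\<close>

lemma H01_pair_integration_by_parts:
  assumes \<Omega>: "open \<Omega>" and u: "H01_pair \<Omega> u G" and \<psi>: "smooth \<psi>"
    and sq: "square_integrable \<Omega> \<psi>" "square_integrable \<Omega> (partial_deriv i \<psi>)"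
  shows "(LINT x|lebesgue_on \<Omega>. \<psi> x * G x $ i) = - (LINT x|lebesgue_on \<Omega>. partial_deriv i \<psi> x * u x)"
proof -
  obtain \<phi> where \<phi>: "\<And>k::nat. \<phi> k \<in> test_functions \<Omega>" "(\<lambda>k. L2dist \<Omega> u (\<phi> k)) \<longlonglongrightarrow> 0"
    "(\<lambda>k. L2dist \<Omega> G (grad (\<phi> k))) \<longlonglongrightarrow> 0" by (rule H01_pair_seq[OF u]) blast
  have sqv: "square_integrable \<Omega> (\<lambda>x. \<psi> x *\<^sub>R (axis i 1 :: real^'a))"
    using sq(1) by (auto simp: square_integrable_def norm_axis_1)
  note tsq = test_function_L2[OF \<phi>(1) \<Omega>]
  have "(\<lambda>k. LINT x|lebesgue_on \<Omega>. grad (\<phi> k) x \<bullet> \<psi> x *\<^sub>R axis i 1) \<longlonglongrightarrow> (LINT x|lebesgue_on \<Omega>. G x \<bullet> \<psi> x *\<^sub>R axis i 1)"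
    by (rule L2_tendsto_inner[OF H01_pairD(2)[OF u] tsq(2) sqv \<phi>(3)])
  moreover have "(\<lambda>k. LINT x|lebesgue_on \<Omega>. \<phi> k x \<bullet> partial_deriv i \<psi> x) \<longlonglongrightarrow> (LINT x|lebesgue_on \<Omega>. u x \<bullet> partial_deriv i \<psi> x)"
    by (rule L2_tendsto_inner[OF H01_pairD(1)[OF u] tsq(1) sq(2) \<phi>(2)])
  moreover have "(LINT x|lebesgue_on \<Omega>. grad (\<phi> k) x \<bullet> \<psi> x *\<^sub>R axis i 1) = - (LINT x|lebesgue_on \<Omega>. \<phi> k x \<bullet> partial_deriv i \<psi> x)" for k
    using integration_by_parts[OF \<phi>(1)[of k] \<psi> \<Omega>, of i] by (simp add: inner_axis mult.commute)
  ultimately have "(LINT x|lebesgue_on \<Omega>. G x \<bullet> \<psi> x *\<^sub>R axis i 1) = - (LINT x|lebesgue_on \<Omega>. u x \<bullet> partial_deriv i \<psi> x)"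
    by (metis (no_types, lifting) LIMSEQ_unique tendsto_minus ext)
  then show ?thesis by (simp add: inner_axis mult.commute)
qed

lemma H01_pair_has_weak_grad:
  assumes \<Omega>: "open \<Omega>" and u: "H01_pair \<Omega> u G"
  shows "has_weak_grad \<Omega> u G"
  unfolding has_weak_grad_def
proof (intro conjI ballI)
  show l: "locally_integrable \<Omega> u" "locally_integrable \<Omega> G"
    using H01_pairD[OF u] \<Omega> by (auto intro: L2_locally_integrable)
  fix \<psi> assume \<psi>: "\<psi> \<in> test_functions \<Omega>"
  note sq = test_function_L2[OF \<psi> \<Omega>]
  have i1: "integrable (lebesgue_on \<Omega>) (\<lambda>x. \<psi> x *\<^sub>R G x)"
    by (rule test_function_mult_integrable[OF \<Omega> l(2) \<psi>])
  have i2: "integrable (lebesgue_on \<Omega>) (\<lambda>x. u x *\<^sub>R grad \<psi> x)"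
  proof (rule Bochner_Integration.integrable_bound[OF L2_norm_mult[OF H01_pairD(1)[OF u] sq(2)]])
    show "(\<lambda>x. u x *\<^sub>R grad \<psi> x) \<in> borel_measurable (lebesgue_on \<Omega>)"
      using L2_measurable[OF H01_pairD(1)[OF u]] L2_measurable[OF sq(2)] by auto
  qed auto
  show "(LINT x|lebesgue_on \<Omega>. u x *\<^sub>R grad \<psi> x) = - (LINT x|lebesgue_on \<Omega>. \<psi> x *\<^sub>R G x)"
    unfolding vec_eq_iff
  proof
    fix i
    show "(LINT x|lebesgue_on \<Omega>. u x *\<^sub>R grad \<psi> x) $ i = (- (LINT x|lebesgue_on \<Omega>. \<psi> x *\<^sub>R G x)) $ i"
      using H01_pair_integration_by_parts[OF \<Omega> u test_functionsD(1)[OF \<psi>] sq(1)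
          test_function_L2(1)[OF test_functions_partial_deriv[OF \<psi>] \<Omega>], of i]
      by (simp add: integral_vec_nth i1 i2 mult.commute)
  qed
qed

lemma H01_pair_imp_H01:
  assumes "open \<Omega>" "H01_pair \<Omega> u G" shows "u \<in> H01 \<Omega>"
proof -
  obtain \<phi> where \<phi>: "\<And>k::nat. \<phi> k \<in> test_functions \<Omega>" "(\<lambda>k. L2dist \<Omega> u (\<phi> k)) \<longlonglongrightarrow> 0"
    "(\<lambda>k. L2dist \<Omega> G (grad (\<phi> k))) \<longlonglongrightarrow> 0" by (rule H01_pair_seq[OF assms(2)]) blast
  then show ?thesis
    using H01_pair_has_weak_grad[OF assms] H01_pairD[OF assms(2)]
    unfolding H01_def L2dist_def by (auto intro!: exI[of _ G] exI[of _ \<phi>])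
qed

lemma H01_pair_weak_grad:
  assumes "open \<Omega>" "H01_pair \<Omega> u G"
  shows "AE x in lebesgue_on \<Omega>. weak_grad \<Omega> u x = G x"
  unfolding weak_grad_def
  using someI[of "has_weak_grad \<Omega> u", OF H01_pair_has_weak_grad[OF assms]] H01_pair_has_weak_grad[OF assms]
  by (rule weak_grad_unique[OF assms(1)])

lemma H01_obtain_pair:
  assumes "u \<in> H01 \<Omega>" obtains G where "H01_pair \<Omega> u G"
proof -
  obtain G \<phi> where "square_integrable \<Omega> u" "square_integrable \<Omega> G" "range \<phi> \<subseteq> test_functions \<Omega>"
    "(\<lambda>k. LINT x|lebesgue_on \<Omega>. (u x - \<phi> k x)\<^sup>2) \<longlonglongrightarrow> 0"
    "(\<lambda>k::nat. LINT x|lebesgue_on \<Omega>. (norm (G x - grad (\<phi> k) x))\<^sup>2) \<longlonglongrightarrow> 0"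
    using assms by (auto simp: H01_def)
  then have "H01_pair \<Omega> u G"
    by (intro H01_pair_seqI[where \<phi> = \<phi>]) (auto simp: L2dist_def)
  then show ?thesis by (rule that)
qed

text \<open>The weak formulation in terms of arbitrary representatives of the gradients.\<close>

lemma dirichlet_solution_pair:
  assumes "open \<Omega>" "dirichlet_solution \<Omega> f u" "H01_pair \<Omega> u G" "H01_pair \<Omega> v H"
  shows "integrable (lebesgue_on \<Omega>) (\<lambda>x. f x * v x)"
    and "(LINT x|lebesgue_on \<Omega>. G x \<bullet> H x) = (LINT x|lebesgue_on \<Omega>. f x * v x)"
proof -
  have v: "v \<in> H01 \<Omega>" using H01_pair_imp_H01 assms by blast
  then show "integrable (lebesgue_on \<Omega>) (\<lambda>x. f x * v x)"
    using assms(2) by (auto simp: dirichlet_solution_def)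
  have m: "G \<in> borel_measurable (lebesgue_on \<Omega>)" "H \<in> borel_measurable (lebesgue_on \<Omega>)"
    using H01_pairD[OF assms(3)] H01_pairD[OF assms(4)] by (auto intro: L2_measurable)
  have ae: "AE x in lebesgue_on \<Omega>. G x \<bullet> H x = weak_grad \<Omega> u x \<bullet> weak_grad \<Omega> v x"
    using H01_pair_weak_grad[OF assms(1,3)] H01_pair_weak_grad[OF assms(1,4)] by eventually_elim simp
  have "(LINT x|lebesgue_on \<Omega>. G x \<bullet> H x) = (LINT x|lebesgue_on \<Omega>. weak_grad \<Omega> u x \<bullet> weak_grad \<Omega> v x)"
    using m assms(1) by (intro integral_cong_AE ae borel_measurable_lebesgue_on_cong_AE[OF _ _ ae]) (auto intro: borel_open)
  then show "(LINT x|lebesgue_on \<Omega>. G x \<bullet> H x) = (LINT x|lebesgue_on \<Omega>. f x * v x)"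
    using assms(2) v by (auto simp: dirichlet_solution_def)
qed

section \<open>Poincare inequality, Green identity, weak comparison\<close>

text \<open>Integrating \<open>\<partial>\<^sub>i (x\<^sub>i \<phi>\<^sup>2)\<close> gives \<open>\<integral> \<phi>\<^sup>2 = - 2 \<integral> x\<^sub>i \<phi> \<partial>\<^sub>i \<phi>\<close>; as \<open>|x\<^sub>i| \<le> R\<close>, Young's inequality
  absorbs half of the left-hand side.\<close>

lemma Poincare_test:
  fixes \<Omega> :: "(real^'n) set"
  assumes \<Omega>: "open \<Omega>" "\<And>x. x \<in> \<Omega> \<Longrightarrow> norm x \<le> R" and \<phi>: "\<phi> \<in> test_functions \<Omega>"
  shows "(LINT x|lebesgue_on \<Omega>. (norm (\<phi> x))\<^sup>2) \<le> 4 * R\<^sup>2 * (LINT x|lebesgue_on \<Omega>. (norm (grad \<phi> x))\<^sup>2)"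
proof -
  fix i :: 'n
  note sq = test_function_L2[OF \<phi> \<Omega>(1)]
  note i1 = L2_integrable[OF sq(1)] and i2 = L2_integrable[OF sq(2)]
  have t2: "(\<lambda>x. \<phi> x * \<phi> x) \<in> test_functions \<Omega>"
    by (intro test_functions_mult \<phi> test_functionsD[OF \<phi>])
  have pc: "partial_deriv i (\<lambda>x. x $ i) = (\<lambda>x::real^'n. 1)"
    by (rule ext, rule partial_derivI[where f' = "\<lambda>h. h $ i", THEN trans])
       (auto intro!: bounded_linear.has_derivative[OF bounded_linear_vec_nth])
  have p2: "partial_deriv i (\<lambda>x. \<phi> x * \<phi> x) x = 2 * \<phi> x * partial_deriv i \<phi> x" for x
    using smooth_differentiable[OF test_functionsD(1)[OF \<phi>]] by (simp add: partial_deriv_mult)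
  have "(LINT x|lebesgue_on \<Omega>. (norm (\<phi> x))\<^sup>2) = (LINT x|lebesgue_on \<Omega>. 1 * (\<phi> x * \<phi> x))"
    by (simp add: power2_eq_square)
  also have "\<dots> = - (LINT x|lebesgue_on \<Omega>. x $ i * (2 * \<phi> x * partial_deriv i \<phi> x))"
    using integration_by_parts[OF t2 smooth_coord[of i] \<Omega>(1), of i] by (simp add: pc p2)
  also have "\<dots> = (LINT x|lebesgue_on \<Omega>. - (x $ i * (2 * \<phi> x * partial_deriv i \<phi> x)))" by simp
  also have "\<dots> \<le> (LINT x|lebesgue_on \<Omega>. (norm (\<phi> x))\<^sup>2 / 2 + 2 * R\<^sup>2 * (norm (grad \<phi> x))\<^sup>2)"
  proof (rule integral_mono)
    have "(\<lambda>x. (x $ i * (2 * \<phi> x)) * partial_deriv i \<phi> x) \<in> test_functions \<Omega>"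
      by (intro test_functions_mult test_functions_partial_deriv \<phi> smooth_intros test_functionsD[OF \<phi>])
    from integrable_test_function(2)[OF this, of \<Omega>] \<Omega>(1)
    show "integrable (lebesgue_on \<Omega>) (\<lambda>x. - (x $ i * (2 * \<phi> x * partial_deriv i \<phi> x)))"
      by (auto simp: mult.assoc intro: borel_open)
    show "integrable (lebesgue_on \<Omega>) (\<lambda>x. (norm (\<phi> x))\<^sup>2 / 2 + 2 * R\<^sup>2 * (norm (grad \<phi> x))\<^sup>2)"
      using i1 i2 by (intro Bochner_Integration.integrable_add integrable_mult_right integrable_divide)
    fix x assume "x \<in> space (lebesgue_on \<Omega>)"
    then have x: "norm x \<le> R" using \<Omega>(2) by simp
    have "- (x $ i * (2 * \<phi> x * partial_deriv i \<phi> x)) \<le> \<bar>\<phi> x\<bar> * (2 * (\<bar>x $ i\<bar> * \<bar>partial_deriv i \<phi> x\<bar>))"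
      using abs_ge_minus_self[of "x $ i * (2 * \<phi> x * partial_deriv i \<phi> x)"] by (simp add: abs_mult mult_ac)
    also have "\<dots> \<le> \<bar>\<phi> x\<bar> * (2 * (R * norm (grad \<phi> x)))"
      using component_le_norm_cart[of x i] component_le_norm_cart[of "grad \<phi> x" i] x
      by (intro mult_left_mono mult_mono) auto
    also have "\<dots> \<le> (\<bar>\<phi> x\<bar>\<^sup>2 + (2 * (R * norm (grad \<phi> x)))\<^sup>2) / 2" by (rule young_half)
    also have "\<dots> = (norm (\<phi> x))\<^sup>2 / 2 + 2 * R\<^sup>2 * (norm (grad \<phi> x))\<^sup>2"
      by (simp add: power_mult_distrib)
    finally show "- (x $ i * (2 * \<phi> x * partial_deriv i \<phi> x)) \<le> (norm (\<phi> x))\<^sup>2 / 2 + 2 * R\<^sup>2 * (norm (grad \<phi> x))\<^sup>2" .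
  qed
  also have "\<dots> = (LINT x|lebesgue_on \<Omega>. (norm (\<phi> x))\<^sup>2) / 2 + 2 * R\<^sup>2 * (LINT x|lebesgue_on \<Omega>. (norm (grad \<phi> x))\<^sup>2)"
    using i1 i2 by simp
  finally show ?thesis by simp
qed

lemma Poincare:
  fixes \<Omega> :: "(real^'n) set"
  assumes \<Omega>: "open \<Omega>" "\<And>x. x \<in> \<Omega> \<Longrightarrow> norm x \<le> R" and u: "H01_pair \<Omega> u G"
  shows "(LINT x|lebesgue_on \<Omega>. (norm (u x))\<^sup>2) \<le> 4 * R\<^sup>2 * (LINT x|lebesgue_on \<Omega>. (norm (G x))\<^sup>2)"
proof -
  obtain \<phi> where \<phi>: "\<And>k::nat. \<phi> k \<in> test_functions \<Omega>" "(\<lambda>k. L2dist \<Omega> u (\<phi> k)) \<longlonglongrightarrow> 0"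
    "(\<lambda>k. L2dist \<Omega> G (grad (\<phi> k))) \<longlonglongrightarrow> 0" by (rule H01_pair_seq[OF u]) blast
  note tsq = test_function_L2[OF \<phi>(1) \<Omega>(1)]
  show ?thesis
    by (rule LIMSEQ_le[OF L2_tendsto_norm[OF H01_pairD(1)[OF u] tsq(1) \<phi>(2)]
         tendsto_mult_left[OF L2_tendsto_norm[OF H01_pairD(2)[OF u] tsq(2) \<phi>(3)]]])
       (use Poincare_test[OF \<Omega> \<phi>(1)] in auto)
qed

lemma H01_pair_zero_gradient:
  assumes "open \<Omega>" "bounded \<Omega>" "H01_pair \<Omega> u G" "(LINT x|lebesgue_on \<Omega>. (norm (G x))\<^sup>2) \<le> 0"
  shows "AE x in lebesgue_on \<Omega>. u x = 0"
proof -
  obtain R where "\<And>x. x \<in> \<Omega> \<Longrightarrow> norm x \<le> R" using assms(2) by (auto simp: bounded_iff)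
  from Poincare[OF assms(1) this assms(3)] assms(4)
  have "(LINT x|lebesgue_on \<Omega>. (norm (u x))\<^sup>2) \<le> 0"
    by (smt (verit) mult_nonneg_nonpos zero_le_power2)
  moreover have "0 \<le> (LINT x|lebesgue_on \<Omega>. (norm (u x))\<^sup>2)" by simp
  ultimately have "(LINT x|lebesgue_on \<Omega>. (norm (u x))\<^sup>2) = 0" by linarith
  then have "AE x in lebesgue_on \<Omega>. (norm (u x))\<^sup>2 = 0"
    using integral_nonneg_eq_0_iff_AE[OF L2_integrable[OF H01_pairD(1)[OF assms(3)]]] by simp
  then show ?thesis by eventually_elim simp
qed

text \<open>Used in two ways: with \<open>\<psi>\<close> a test function it is the distributional form of \<open>-\<Delta>u\<close>, and with \<open>\<psi>\<close> a
  barrier, such as a bubble, it is the weak equation of the barrier tested with \<open>u\<close>.\<close>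

lemma Green_identity:
  assumes \<Omega>: "open \<Omega>" "bounded \<Omega>" and u: "H01_pair \<Omega> u G" and \<psi>: "smooth \<psi>"
  shows "(LINT x|lebesgue_on \<Omega>. G x \<bullet> grad \<psi> x) = - (LINT x|lebesgue_on \<Omega>. laplacian \<psi> x * u x)"
    and "integrable (lebesgue_on \<Omega>) (\<lambda>x. laplacian \<psi> x * u x)"
proof -
  have sq: "square_integrable \<Omega> f" if "smooth f" for f
    using L2_continuous[OF \<Omega>(2,1) smooth_continuous[OF that]] .
  note s1 = smooth_partial_deriv[OF \<psi>] and s2 = smooth_partial_deriv[OF smooth_partial_deriv[OF \<psi>]]
  have sG: "square_integrable \<Omega> (\<lambda>x. G x $ i)" for i
    by (rule L2_dominated[OF H01_pairD(2)[OF u]])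
       (use L2_measurable[OF H01_pairD(2)[OF u]] component_le_norm_cart in
        \<open>auto intro!: borel_measurable_continuous_on[where f = "\<lambda>v. v $ i"] continuous_intros\<close>)
  have i1: "integrable (lebesgue_on \<Omega>) (\<lambda>x. partial_deriv i \<psi> x * G x $ i)" for i
    using L2_inner[OF sq[OF s1] sG] by simp
  have i2: "integrable (lebesgue_on \<Omega>) (\<lambda>x. partial_deriv i (partial_deriv i \<psi>) x * u x)" for i
    using L2_inner[OF sq[OF s2] H01_pairD(1)[OF u]] by simp
  have "(LINT x|lebesgue_on \<Omega>. G x \<bullet> grad \<psi> x) = (LINT x|lebesgue_on \<Omega>. (\<Sum>i\<in>UNIV. partial_deriv i \<psi> x * G x $ i))"
    by (simp add: inner_vec_def mult.commute)
  also have "\<dots> = (\<Sum>i\<in>UNIV. LINT x|lebesgue_on \<Omega>. partial_deriv i \<psi> x * G x $ i)"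
    by (intro Bochner_Integration.integral_sum i1)
  also have "\<dots> = (\<Sum>i\<in>UNIV. - (LINT x|lebesgue_on \<Omega>. partial_deriv i (partial_deriv i \<psi>) x * u x))"
    by (intro sum.cong refl H01_pair_integration_by_parts[OF \<Omega>(1) u s1] sq s1 s2)
  also have "\<dots> = - (LINT x|lebesgue_on \<Omega>. (\<Sum>i\<in>UNIV. partial_deriv i (partial_deriv i \<psi>) x * u x))"
    by (simp add: sum_negf Bochner_Integration.integral_sum i2)
  finally show "(LINT x|lebesgue_on \<Omega>. G x \<bullet> grad \<psi> x) = - (LINT x|lebesgue_on \<Omega>. laplacian \<psi> x * u x)"
    by (simp add: laplacian_def sum_distrib_right)
  show "integrable (lebesgue_on \<Omega>) (\<lambda>x. laplacian \<psi> x * u x)"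
    unfolding laplacian_def sum_distrib_right by (intro Bochner_Integration.integrable_sum i2)
qed

subsection \<open>Positive parts\<close>

text \<open>For \<open>t > 0\<close> this is \<open>t exp (-\<epsilon>/t)\<close>: a smooth substitute for the positive part that vanishes for
  \<open>t \<le> 0\<close>, so that composition with it preserves compact supports. Its derivative \<open>spos'\<close> stays in
  \<open>[0, 1]\<close>.\<close>

definition spos :: "real \<Rightarrow> real \<Rightarrow> real" where "spos \<epsilon> t = t * flat 0 \<epsilon> t"
definition spos' :: "real \<Rightarrow> real \<Rightarrow> real" where "spos' \<epsilon> t = flat 0 \<epsilon> t + \<epsilon> * flat 1 \<epsilon> t"

lemma spos_has_derivative:
  assumes "\<epsilon> > 0" shows "(spos \<epsilon> has_real_derivative spos' \<epsilon> t) (at t)"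
proof -
  have "(spos \<epsilon> has_real_derivative (1 * flat 0 \<epsilon> t + (\<epsilon> * flat (0+2) \<epsilon> t - real 0 * flat (0+1) \<epsilon> t) * t)) (at t)"
    unfolding spos_def[abs_def] by (intro DERIV_mult DERIV_ident flat_has_derivative assms)
  also have "1 * flat 0 \<epsilon> t + (\<epsilon> * flat (0+2) \<epsilon> t - real 0 * flat (0+1) \<epsilon> t) * t = spos' \<epsilon> t"
    by (simp add: spos'_def flat_def power2_eq_square)
  finally show ?thesis .
qed

lemma spos'_bounds:
  assumes "\<epsilon> > 0" shows "0 \<le> spos' \<epsilon> t" "spos' \<epsilon> t \<le> 1"
proof -
  have "(1 + s) * exp (- s) \<le> 1" for s :: real
    using exp_ge_add_one_self[of s] by (simp add: exp_minus field_simps)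
  from this[of "\<epsilon> / t"] show "spos' \<epsilon> t \<le> 1"
    by (simp add: spos'_def flat_def algebra_simps)
  show "0 \<le> spos' \<epsilon> t" using assms by (simp add: spos'_def flat_def)
qed

lemma spos'_continuous: "\<epsilon> > 0 \<Longrightarrow> continuous_on S (spos' \<epsilon>)"
  unfolding spos'_def[abs_def] by (intro continuous_intros flat_continuous)

lemma spos_Lipschitz:
  assumes "\<epsilon> > 0" shows "\<bar>spos \<epsilon> s - spos \<epsilon> t\<bar> \<le> \<bar>s - t\<bar>"
proof -
  have "norm (spos \<epsilon> s - spos \<epsilon> t) \<le> 1 * norm (s - t)"
  proof (rule field_differentiable_bound[where f' = "spos' \<epsilon>" and S = UNIV])
    show "\<And>z. z \<in> UNIV \<Longrightarrow> (spos \<epsilon> has_field_derivative spos' \<epsilon> z) (at z within UNIV)"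
      using spos_has_derivative[OF assms] by simp
    show "\<And>z. z \<in> UNIV \<Longrightarrow> norm (spos' \<epsilon> z) \<le> 1"
      using spos'_bounds[OF assms] by (simp add: abs_of_nonneg)
  qed auto
  then show ?thesis by simp
qed

lemma spos_continuous: "\<epsilon> > 0 \<Longrightarrow> continuous_on S (spos \<epsilon>)"
  by (meson DERIV_continuous_on spos_has_derivative has_field_derivative_at_within)

lemma spos_bounds: "\<epsilon> > 0 \<Longrightarrow> 0 \<le> spos \<epsilon> t \<and> spos \<epsilon> t \<le> max 0 t"
  using flat_0_bounds[of \<epsilon> t] by (auto simp: spos_def flat_def mult_le_cancel_left1 max_def)

lemma spos_tendsto: "(\<lambda>n. spos (1 / real (Suc n)) t) \<longlonglongrightarrow> max 0 t"
proof -
  have "(\<lambda>n. spos (1 / real (Suc n)) t) \<longlonglongrightarrow> t * (if t > 0 then 1 else 0)"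
    unfolding spos_def by (intro tendsto_intros flat_0_tendsto)
  then show ?thesis by (auto simp: max_def split: if_splits)
qed

lemma spos'_tendsto: "(\<lambda>n. spos' (1 / real (Suc n)) t) \<longlonglongrightarrow> (if t > 0 then 1 else 0)"
proof -
  have l: "(\<lambda>k. 1 / real (Suc k)) \<longlonglongrightarrow> 0"
    using LIMSEQ_inverse_real_of_nat by (simp add: inverse_eq_divide)
  have f: "flat 1 c t = flat 0 c t * (1 / t)" for c by (simp add: flat_def)
  have "(\<lambda>n. spos' (1 / real (Suc n)) t) \<longlonglongrightarrow> (if t > 0 then 1 else 0) + 0 * ((if t > 0 then 1 else 0) * (1/t))"
    unfolding spos'_def f by (intro tendsto_intros flat_0_tendsto l)
  then show ?thesis by simp
qed

lemma grad_comp: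
  assumes "(g has_real_derivative d) (at (f x))" "f differentiable (at x)"
  shows "grad (\<lambda>x. g (f x)) x = d *\<^sub>R grad f x"
  using partial_deriv_comp(1)[OF assms] by (simp add: vec_eq_iff)

lemma grad_diff: "smooth f \<Longrightarrow> smooth g \<Longrightarrow> grad (\<lambda>x. f x - g x) x = grad f x - grad g x"
  using grad_scale_add[of f g 1 "-1"] by simp

lemma norm_diff_split: "norm (a *\<^sub>R (v::'b::real_normed_vector) - b *\<^sub>R w) \<le> \<bar>b\<bar> * norm (v - w) + \<bar>a - b\<bar> * norm v"
proof -
  have "a *\<^sub>R v - b *\<^sub>R w = b *\<^sub>R (v - w) + (a - b) *\<^sub>R v" by (simp add: algebra_simps)
  then show ?thesis by (metis norm_scaleR norm_triangle_ineq)
qed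

text \<open>If \<open>\<phi>\<close> is a test function, then \<open>spos \<epsilon> (\<phi> - \<psi>)\<close> vanishes off the union of \<open>K\<close> and the support
  of \<open>\<phi>\<close>, hence it is a test function too. Along test functions that converge to \<open>P\<close> almost
  everywhere, dominated convergence identifies the limit of the gradients.\<close>

lemma H01_pair_spos:
  assumes \<Omega>: "open \<Omega>" "bounded \<Omega>" and P: "H01_pair \<Omega> P G" and \<psi>: "smooth \<psi>"
    and K: "compact K" "K \<subseteq> \<Omega>" "\<And>x. x \<notin> K \<Longrightarrow> \<psi> x \<ge> 0" and \<epsilon>: "\<epsilon> > 0"
  shows "H01_pair \<Omega> (\<lambda>x. spos \<epsilon> (P x - \<psi> x)) (\<lambda>x. spos' \<epsilon> (P x - \<psi> x) *\<^sub>R (G x - grad \<psi> x))"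
    (is "H01_pair \<Omega> ?u ?G")
proof -
  obtain \<phi>0 where \<phi>0: "\<And>k::nat. \<phi>0 k \<in> test_functions \<Omega>" "(\<lambda>k. L2dist \<Omega> P (\<phi>0 k)) \<longlonglongrightarrow> 0"
    "(\<lambda>k. L2dist \<Omega> G (grad (\<phi>0 k))) \<longlonglongrightarrow> 0" by (rule H01_pair_seq[OF P]) blast
  obtain r where r: "strict_mono (r::nat\<Rightarrow>nat)" "AE x in lebesgue_on \<Omega>. (\<lambda>k. \<phi>0 (r k) x) \<longlonglongrightarrow> P x"
    using L2_AE_subseq[OF H01_pairD(1)[OF P] test_function_L2(1)[OF \<phi>0(1) \<Omega>(1)] \<phi>0(2)] by blast
  define \<phi> where "\<phi> k = \<phi>0 (r k)" for k
  have \<phi>: "\<phi> k \<in> test_functions \<Omega>" for k by (simp add: \<phi>_def \<phi>0)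
  have \<phi>l: "(\<lambda>k. L2dist \<Omega> P (\<phi> k)) \<longlonglongrightarrow> 0" "(\<lambda>k. L2dist \<Omega> G (grad (\<phi> k))) \<longlonglongrightarrow> 0"
    using LIMSEQ_subseq_LIMSEQ[OF \<phi>0(2) r(1)] LIMSEQ_subseq_LIMSEQ[OF \<phi>0(3) r(1)] by (auto simp: \<phi>_def o_def)
  have ae: "AE x in lebesgue_on \<Omega>. (\<lambda>k. \<phi> k x) \<longlonglongrightarrow> P x" using r(2) by (simp add: \<phi>_def)
  note tsq = test_function_L2[OF \<phi> \<Omega>(1)]
  note s\<phi> = test_functionsD(1)[OF \<phi>]
  have sq\<psi>: "square_integrable \<Omega> \<psi>" "square_integrable \<Omega> (grad \<psi>)"
    using L2_continuous[OF \<Omega>(2,1)] smooth_continuous[OF \<psi>] continuous_grad[OF \<psi>] by auto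
  define D where "D x = G x - grad \<psi> x" for x
  have sqP: "square_integrable \<Omega> (\<lambda>x. P x - \<psi> x)" by (intro L2_diff H01_pairD(1)[OF P] sq\<psi>)
  have sqD: "square_integrable \<Omega> D" unfolding D_def[abs_def] by (intro L2_diff H01_pairD(2)[OF P] sq\<psi>)
  have ms: "(\<lambda>x. spos' \<epsilon> (f x)) \<in> borel_measurable (lebesgue_on \<Omega>)" "(\<lambda>x. spos \<epsilon> (f x)) \<in> borel_measurable (lebesgue_on \<Omega>)"
    if "f \<in> borel_measurable (lebesgue_on \<Omega>)" for f
    using borel_measurable_continuous_on[OF spos'_continuous[OF \<epsilon>] that] borel_measurable_continuous_on[OF spos_continuous[OF \<epsilon>] that] by auto
  have mP: "(\<lambda>x. P x - \<psi> x) \<in> borel_measurable (lebesgue_on \<Omega>)" using L2_measurable[OF sqP] .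
  have m\<phi>: "(\<lambda>x. \<phi> k x - \<psi> x) \<in> borel_measurable (lebesgue_on \<Omega>)" for k
    using L2_measurable[OF tsq(1)[of k]] L2_measurable[OF sq\<psi>(1)] by auto
  have mD: "D \<in> borel_measurable (lebesgue_on \<Omega>)" using L2_measurable[OF sqD] .
  have squ: "square_integrable \<Omega> ?u"
    by (rule L2_dominated[OF sqP ms(2)[OF mP]]) (use spos_bounds[OF \<epsilon>] in \<open>auto simp: abs_of_nonneg max_def intro!: AE_I2 split: if_splits\<close>, smt (verit))
  have sqG: "square_integrable \<Omega> ?G"
  proof (rule L2_dominated[OF sqD])
    show "?G \<in> borel_measurable (lebesgue_on \<Omega>)"
      using ms(1)[OF mP] mD unfolding D_def by auto
    show "AE x in lebesgue_on \<Omega>. norm (?G x) \<le> norm (D x)"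
      using spos'_bounds[OF \<epsilon>] by (auto intro!: AE_I2 mult_left_le_one_le simp: D_def)
  qed
  define q where "q k x = spos \<epsilon> (\<phi> k x - \<psi> x)" for k x
  have q: "q k \<in> test_functions \<Omega>" for k
  proof (rule test_functionsI[where K = "closure {x. \<phi> k x \<noteq> 0} \<union> K"])
    show "smooth (q k)" unfolding q_def[abs_def] spos_def by (intro smooth_intros s\<phi> \<psi> \<epsilon>)
    show "compact (closure {x. \<phi> k x \<noteq> 0} \<union> K)" "closure {x. \<phi> k x \<noteq> 0} \<union> K \<subseteq> \<Omega>"
      using K test_functionsD[OF \<phi>[of k]] by auto
    fix x assume x: "x \<notin> closure {x. \<phi> k x \<noteq> 0} \<union> K"
    then have "\<phi> k x = 0" using closure_subset[of "{x. \<phi> k x \<noteq> 0}"] by blast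
    with x K(3)[of x] show "q k x = 0" by (simp add: q_def spos_def flat_def)
  qed
  have gq: "grad (q k) x = spos' \<epsilon> (\<phi> k x - \<psi> x) *\<^sub>R (grad (\<phi> k) x - grad \<psi> x)" for k x
    unfolding q_def[abs_def]
    using grad_comp[OF spos_has_derivative[OF \<epsilon>] smooth_differentiable[OF smooth_diff[OF s\<phi>[of k] \<psi>]]]
    by (simp add: grad_diff[OF s\<phi> \<psi>])
  show ?thesis
  proof (rule H01_pair_seqI[OF squ sqG q])
    show "(\<lambda>k. L2dist \<Omega> ?u (q k)) \<longlonglongrightarrow> 0"
    proof (rule Lim_null_comparison[OF always_eventually \<phi>l(1)], rule allI)
      fix k
      have "L2dist \<Omega> ?u (q k) \<le> L2dist \<Omega> P (\<phi> k)"
        unfolding L2dist_def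
      proof (rule integral_mono)
        show "integrable (lebesgue_on \<Omega>) (\<lambda>x. (norm (?u x - q k x))\<^sup>2)"
          by (intro L2_integrable L2_diff squ test_function_L2[OF q \<Omega>(1)])
        show "integrable (lebesgue_on \<Omega>) (\<lambda>x. (norm (P x - \<phi> k x))\<^sup>2)"
          by (intro L2_integrable L2_diff tsq H01_pairD[OF P])
        show "(norm (?u x - q k x))\<^sup>2 \<le> (norm (P x - \<phi> k x))\<^sup>2" for x
          using spos_Lipschitz[OF \<epsilon>, of "P x - \<psi> x" "\<phi> k x - \<psi> x"] unfolding q_def real_norm_def
          by (intro power_mono) auto
      qed
      then show "norm (L2dist \<Omega> ?u (q k)) \<le> L2dist \<Omega> P (\<phi> k)"
        by (simp add: abs_of_nonneg[OF L2dist_nonneg])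
    qed
    \<comment> \<open>the part of the gradient error that is controlled only by dominated convergence\<close>
    define E where "E k x = \<bar>spos' \<epsilon> (P x - \<psi> x) - spos' \<epsilon> (\<phi> k x - \<psi> x)\<bar> * norm (D x)" for k x
    have Em: "E k \<in> borel_measurable (lebesgue_on \<Omega>)" for k
      unfolding E_def[abs_def] using ms(1)[OF mP] ms(1)[OF m\<phi>[of k]] mD by auto
    have Ele: "\<bar>E k x\<bar> \<le> norm (D x)" for k x
      unfolding E_def using spos'_bounds[OF \<epsilon>, of "P x - \<psi> x"] spos'_bounds[OF \<epsilon>, of "\<phi> k x - \<psi> x"]
      by (auto simp: abs_mult intro!: mult_left_le_one_le)
    have Ei: "integrable (lebesgue_on \<Omega>) (\<lambda>x. (E k x)\<^sup>2)" for k
      using L2_integrable[OF L2_dominated[OF sqD Em[of k]]] Ele by simp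
    have E0: "(\<lambda>k. LINT x|lebesgue_on \<Omega>. (E k x)\<^sup>2) \<longlonglongrightarrow> (LINT x|lebesgue_on \<Omega>. 0)"
    proof (rule integral_dominated_convergence[where w = "\<lambda>x. (norm (D x))\<^sup>2"])
      show "integrable (lebesgue_on \<Omega>) (\<lambda>x. (norm (D x))\<^sup>2)" by (rule L2_integrable[OF sqD])
      show "AE x in lebesgue_on \<Omega>. norm ((E k x)\<^sup>2) \<le> (norm (D x))\<^sup>2" for k
        using power_mono[OF Ele abs_ge_zero, of _ _ 2] by (intro AE_I2) simp
      show "AE x in lebesgue_on \<Omega>. (\<lambda>k. (E k x)\<^sup>2) \<longlonglongrightarrow> 0"
        using ae
      proof eventually_elim
        case (elim x)
        have "isCont (spos' \<epsilon>) (P x - \<psi> x)"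
          using spos'_continuous[OF \<epsilon>, of UNIV] by (simp add: continuous_on_eq_continuous_at)
        moreover have "(\<lambda>k. \<phi> k x - \<psi> x) \<longlonglongrightarrow> P x - \<psi> x" using elim by (intro tendsto_intros)
        ultimately have "(\<lambda>k. spos' \<epsilon> (\<phi> k x - \<psi> x)) \<longlonglongrightarrow> spos' \<epsilon> (P x - \<psi> x)"
          by (rule isCont_tendsto_compose)
        then have "(\<lambda>k. (E k x)\<^sup>2) \<longlonglongrightarrow> (\<bar>spos' \<epsilon> (P x - \<psi> x) - spos' \<epsilon> (P x - \<psi> x)\<bar> * norm (D x))\<^sup>2"
          unfolding E_def by (intro tendsto_intros)
        then show ?case by simp
      qed
    qed (use Em in auto)
    show "(\<lambda>k. L2dist \<Omega> ?G (grad (q k))) \<longlonglongrightarrow> 0"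
    proof (rule Lim_null_comparison[OF always_eventually], rule allI)
      fix k
      have "L2dist \<Omega> ?G (grad (q k)) \<le> (LINT x|lebesgue_on \<Omega>. 2 * (norm (G x - grad (\<phi> k) x))\<^sup>2 + 2 * (E k x)\<^sup>2)"
        unfolding L2dist_def
      proof (rule integral_mono)
        show "integrable (lebesgue_on \<Omega>) (\<lambda>x. (norm (?G x - grad (q k) x))\<^sup>2)"
          by (intro L2_integrable L2_diff sqG test_function_L2[OF q \<Omega>(1)])
        show "integrable (lebesgue_on \<Omega>) (\<lambda>x. 2 * (norm (G x - grad (\<phi> k) x))\<^sup>2 + 2 * (E k x)\<^sup>2)"
          by (intro Bochner_Integration.integrable_add integrable_mult_right Ei L2_integrable L2_diff tsq H01_pairD[OF P])
        fix x
        have "norm (?G x - grad (q k) x) \<le> \<bar>spos' \<epsilon> (\<phi> k x - \<psi> x)\<bar> * norm (D x - (grad (\<phi> k) x - grad \<psi> x)) + E k x"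
          unfolding gq E_def D_def[symmetric] by (rule norm_diff_split)
        also have "D x - (grad (\<phi> k) x - grad \<psi> x) = G x - grad (\<phi> k) x" by (simp add: D_def)
        also have "\<bar>spos' \<epsilon> (\<phi> k x - \<psi> x)\<bar> * norm (G x - grad (\<phi> k) x) \<le> norm (G x - grad (\<phi> k) x)"
          using spos'_bounds[OF \<epsilon>] by (intro mult_left_le_one_le) auto
        finally have "norm (?G x - grad (q k) x) \<le> norm (G x - grad (\<phi> k) x) + E k x" by simp
        then have "(norm (?G x - grad (q k) x))\<^sup>2 \<le> (norm (G x - grad (\<phi> k) x) + E k x)\<^sup>2"
          by (intro power_mono) auto
        also have "\<dots> \<le> 2 * (norm (G x - grad (\<phi> k) x))\<^sup>2 + 2 * (E k x)\<^sup>2"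
          using sum_squares_bound[of "norm (G x - grad (\<phi> k) x)" "E k x"] by (simp add: power2_sum)
        finally show "(norm (?G x - grad (q k) x))\<^sup>2 \<le> 2 * (norm (G x - grad (\<phi> k) x))\<^sup>2 + 2 * (E k x)\<^sup>2" .
      qed
      also have "\<dots> = 2 * L2dist \<Omega> G (grad (\<phi> k)) + 2 * (LINT x|lebesgue_on \<Omega>. (E k x)\<^sup>2)"
        unfolding L2dist_def
        using Ei[of k] L2_integrable[OF L2_diff[OF H01_pairD(2)[OF P] tsq(2)[of k]]] by simp
      finally show "norm (L2dist \<Omega> ?G (grad (q k))) \<le> 2 * L2dist \<Omega> G (grad (\<phi> k)) + 2 * (LINT x|lebesgue_on \<Omega>. (E k x)\<^sup>2)"
        by (simp add: abs_of_nonneg[OF L2dist_nonneg])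
    next
      show "(\<lambda>k. 2 * L2dist \<Omega> G (grad (\<phi> k)) + 2 * (LINT x|lebesgue_on \<Omega>. (E k x)\<^sup>2)) \<longlonglongrightarrow> 0"
        using E0 \<phi>l(2) by (auto intro!: tendsto_eq_intros)
    qed
  qed
qed

text \<open>Let \<open>\<epsilon>\<close> tend to \<open>0\<close>. On the set where \<open>P = \<psi>\<close> all the approximating gradients vanish, so the
  pointwise limit is clear there as well.\<close>

lemma H01_pair_positive_part:
  assumes \<Omega>: "open \<Omega>" "bounded \<Omega>" and P: "H01_pair \<Omega> P G" and \<psi>: "smooth \<psi>"
    and K: "compact K" "K \<subseteq> \<Omega>" "\<And>x. x \<notin> K \<Longrightarrow> \<psi> x \<ge> 0"
  shows "H01_pair \<Omega> (\<lambda>x. max 0 (P x - \<psi> x)) (\<lambda>x. (if P x > \<psi> x then 1 else 0) *\<^sub>R (G x - grad \<psi> x))"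
    (is "H01_pair \<Omega> ?u ?G")
proof -
  define \<epsilon> where "\<epsilon> n = 1 / real (Suc n)" for n
  have \<epsilon>: "\<epsilon> n > 0" for n by (simp add: \<epsilon>_def)
  define U where "U n x = spos (\<epsilon> n) (P x - \<psi> x)" for n x
  define D where "D x = G x - grad \<psi> x" for x
  define H where "H n x = spos' (\<epsilon> n) (P x - \<psi> x) *\<^sub>R D x" for n x
  have UH: "H01_pair \<Omega> (U n) (H n)" for n
    unfolding U_def[abs_def] H_def[abs_def] D_def by (rule H01_pair_spos[OF assms \<epsilon>])
  have sq\<psi>: "square_integrable \<Omega> \<psi>" "square_integrable \<Omega> (grad \<psi>)"
    using L2_continuous[OF \<Omega>(2,1)] smooth_continuous[OF \<psi>] continuous_grad[OF \<psi>] by auto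
  have sqP: "square_integrable \<Omega> (\<lambda>x. P x - \<psi> x)" by (intro L2_diff H01_pairD(1)[OF P] sq\<psi>)
  have sqD: "square_integrable \<Omega> D" unfolding D_def[abs_def] by (intro L2_diff H01_pairD(2)[OF P] sq\<psi>)
  note mP = L2_measurable[OF sqP] and mD = L2_measurable[OF sqD]
  have squ: "square_integrable \<Omega> ?u"
    by (rule L2_dominated[OF sqP]) (use mP in auto)
  have "Measurable.pred (lebesgue_on \<Omega>) (\<lambda>x. P x - \<psi> x > 0)" using mP by measurable
  then have mi: "(\<lambda>x. if P x > \<psi> x then 1 else 0 :: real) \<in> borel_measurable (lebesgue_on \<Omega>)"
    by (intro measurable_If) (auto simp: pred_def)
  have sqG: "square_integrable \<Omega> ?G"
    by (rule L2_dominated[OF sqD]) (use borel_measurable_scaleR[OF mi mD] in \<open>auto simp: D_def\<close>)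
  have Ulim: "(\<lambda>n. L2dist \<Omega> ?u (U n)) \<longlonglongrightarrow> (LINT x|lebesgue_on \<Omega>. 0)"
    unfolding L2dist_def
  proof (rule integral_dominated_convergence[where w = "\<lambda>x. (norm (P x - \<psi> x))\<^sup>2"])
    show "integrable (lebesgue_on \<Omega>) (\<lambda>x. (norm (P x - \<psi> x))\<^sup>2)" by (rule L2_integrable[OF sqP])
    show "(\<lambda>x. (norm (?u x - U n x))\<^sup>2) \<in> borel_measurable (lebesgue_on \<Omega>)" for n
      using L2_measurable[OF squ] L2_measurable[OF H01_pairD(1)[OF UH[of n]]] by auto
    show "AE x in lebesgue_on \<Omega>. norm ((norm (?u x - U n x))\<^sup>2) \<le> (norm (P x - \<psi> x))\<^sup>2" for n
    proof (rule AE_I2)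
      fix x
      have "norm (?u x - U n x) \<le> norm (P x - \<psi> x)"
        using spos_bounds[OF \<epsilon>[of n], of "P x - \<psi> x"] by (auto simp: U_def max_def split: if_splits)
      from power_mono[OF this norm_ge_zero, of 2] show "norm ((norm (?u x - U n x))\<^sup>2) \<le> (norm (P x - \<psi> x))\<^sup>2" by simp
    qed
    show "AE x in lebesgue_on \<Omega>. (\<lambda>n. (norm (?u x - U n x))\<^sup>2) \<longlonglongrightarrow> 0"
    proof (rule AE_I2)
      fix x
      have "(\<lambda>n. (norm (?u x - U n x))\<^sup>2) \<longlonglongrightarrow> (norm (?u x - ?u x))\<^sup>2"
        unfolding U_def \<epsilon>_def by (intro tendsto_intros spos_tendsto)
      then show "(\<lambda>n. (norm (?u x - U n x))\<^sup>2) \<longlonglongrightarrow> 0" by simp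
    qed
  qed auto
  have Hlim: "(\<lambda>n. L2dist \<Omega> ?G (H n)) \<longlonglongrightarrow> (LINT x|lebesgue_on \<Omega>. 0)"
    unfolding L2dist_def
  proof (rule integral_dominated_convergence[where w = "\<lambda>x. (norm (D x))\<^sup>2"])
    show "integrable (lebesgue_on \<Omega>) (\<lambda>x. (norm (D x))\<^sup>2)" by (rule L2_integrable[OF sqD])
    show "(\<lambda>x. (norm (?G x - H n x))\<^sup>2) \<in> borel_measurable (lebesgue_on \<Omega>)" for n
      using L2_measurable[OF sqG] L2_measurable[OF H01_pairD(2)[OF UH[of n]]] by auto
    show "AE x in lebesgue_on \<Omega>. norm ((norm (?G x - H n x))\<^sup>2) \<le> (norm (D x))\<^sup>2" for n
    proof (rule AE_I2)
      fix x
      define b where "b = (if P x > \<psi> x then 1 else 0 :: real)"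
      have "norm (?G x - H n x) = \<bar>b - spos' (\<epsilon> n) (P x - \<psi> x)\<bar> * norm (D x)"
        unfolding H_def b_def D_def by (simp flip: scaleR_diff_left)
      also have "\<dots> \<le> norm (D x)"
        using spos'_bounds[OF \<epsilon>[of n], of "P x - \<psi> x"] by (intro mult_left_le_one_le) (auto simp: b_def)
      finally have "norm (?G x - H n x) \<le> norm (D x)" .
      from power_mono[OF this norm_ge_zero, of 2] show "norm ((norm (?G x - H n x))\<^sup>2) \<le> (norm (D x))\<^sup>2" by simp
    qed
    show "AE x in lebesgue_on \<Omega>. (\<lambda>n. (norm (?G x - H n x))\<^sup>2) \<longlonglongrightarrow> 0"
    proof (rule AE_I2)
      fix x
      have "(\<lambda>n. (norm (?G x - H n x))\<^sup>2) \<longlonglongrightarrow> (norm (?G x - (if P x - \<psi> x > 0 then 1 else 0) *\<^sub>R D x))\<^sup>2"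
        unfolding H_def \<epsilon>_def by (intro tendsto_intros spos'_tendsto)
      then show "(\<lambda>n. (norm (?G x - H n x))\<^sup>2) \<longlonglongrightarrow> 0" by (simp add: D_def split: if_splits)
    qed
  qed auto
  show ?thesis
    using Ulim Hlim by (intro H01_pair_closed[OF \<Omega>(1) squ sqG UH]) auto
qed

text \<open>Test \<open>-\<Delta>(P - \<psi>) \<le> 0\<close> with the positive part of \<open>P - \<psi>\<close>, whose gradient must then vanish. The
  condition off \<open>K\<close> expresses \<open>P \<le> \<psi>\<close> on the boundary.\<close>

lemma weak_comparison:
  assumes \<Omega>: "open \<Omega>" "bounded \<Omega>" and P: "dirichlet_solution \<Omega> f P" and \<psi>: "smooth \<psi>"
    and K: "compact K" "K \<subseteq> \<Omega>" "\<And>x. x \<notin> K \<Longrightarrow> \<psi> x \<ge> 0"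
    and le: "\<And>x. x \<in> \<Omega> \<Longrightarrow> f x \<le> - laplacian \<psi> x"
  shows "AE x in lebesgue_on \<Omega>. P x \<le> \<psi> x"
proof -
  obtain G where G: "H01_pair \<Omega> P G" using P H01_obtain_pair by (auto simp: dirichlet_solution_def)
  define z where "z x = max 0 (P x - \<psi> x)" for x
  define Z where "Z x = (if P x > \<psi> x then 1 else 0) *\<^sub>R (G x - grad \<psi> x)" for x
  have zZ: "H01_pair \<Omega> z Z"
    unfolding z_def[abs_def] Z_def[abs_def] by (rule H01_pair_positive_part[OF \<Omega> G \<psi> K])
  have sq\<psi>: "square_integrable \<Omega> (grad \<psi>)"
    using L2_continuous[OF \<Omega>(2,1)] continuous_grad[OF \<psi>] by auto
  note d = dirichlet_solution_pair[OF \<Omega>(1) P G zZ] and g = Green_identity[OF \<Omega> zZ \<psi>]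
  have "(LINT x|lebesgue_on \<Omega>. (norm (Z x))\<^sup>2) = (LINT x|lebesgue_on \<Omega>. G x \<bullet> Z x - Z x \<bullet> grad \<psi> x)"
    by (intro Bochner_Integration.integral_cong) (auto simp: Z_def power2_norm_eq_inner inner_diff_left inner_diff_right inner_commute)
  also have "\<dots> = (LINT x|lebesgue_on \<Omega>. f x * z x) - (- (LINT x|lebesgue_on \<Omega>. laplacian \<psi> x * z x))"
    using L2_inner[OF H01_pairD(2)[OF G] H01_pairD(2)[OF zZ]] L2_inner[OF H01_pairD(2)[OF zZ] sq\<psi>] d(2) g(1)
    by simp
  also have "\<dots> = (LINT x|lebesgue_on \<Omega>. f x * z x + laplacian \<psi> x * z x)"
    using d(1) g(2) by simp
  also have "\<dots> \<le> 0"
  proof -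
    have "0 \<le> (LINT x|lebesgue_on \<Omega>. - (f x * z x + laplacian \<psi> x * z x))"
    proof (rule Bochner_Integration.integral_nonneg)
      fix x assume "x \<in> space (lebesgue_on \<Omega>)"
      then have "(- laplacian \<psi> x - f x) * z x \<ge> 0"
        using le[of x] by (intro mult_nonneg_nonneg) (auto simp: z_def)
      then show "0 \<le> - (f x * z x + laplacian \<psi> x * z x)" by (simp add: algebra_simps)
    qed
    then show ?thesis by (simp only: Bochner_Integration.integral_minus neg_0_le_iff_le)
  qed
  finally have "AE x in lebesgue_on \<Omega>. z x = 0"
    by (rule H01_pair_zero_gradient[OF \<Omega> zZ])
  then show ?thesis by eventually_elim (auto simp: z_def max_def split: if_splits)
qed

lemma dirichlet_solution_uminus:
  assumes \<Omega>: "open \<Omega>" and P: "dirichlet_solution \<Omega> f P"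
  shows "dirichlet_solution \<Omega> (\<lambda>x. - f x) (\<lambda>x. - P x)"
proof -
  obtain G where G: "H01_pair \<Omega> P G" using P H01_obtain_pair by (auto simp: dirichlet_solution_def)
  have mG: "H01_pair \<Omega> (\<lambda>x. - P x) (\<lambda>x. - G x)"
    using H01_pair_lincomb[OF \<Omega> G G, of "-1" 0] by simp
  show ?thesis unfolding dirichlet_solution_def
  proof (intro conjI ballI)
    show "(\<lambda>x. - P x) \<in> H01 \<Omega>" by (rule H01_pair_imp_H01[OF \<Omega> mG])
    fix v assume v: "v \<in> H01 \<Omega>"
    then obtain H where H: "H01_pair \<Omega> v H" using H01_obtain_pair by blast
    note d = dirichlet_solution_pair[OF \<Omega> P G H]
    show "integrable (lebesgue_on \<Omega>) (\<lambda>x. - f x * v x)" using d(1) by simp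
    have ae: "AE x in lebesgue_on \<Omega>. (- G x) \<bullet> H x = weak_grad \<Omega> (\<lambda>x. - P x) x \<bullet> weak_grad \<Omega> v x"
      using H01_pair_weak_grad[OF \<Omega> mG] H01_pair_weak_grad[OF \<Omega> H] by eventually_elim simp
    have m: "(\<lambda>x. (- G x) \<bullet> H x) \<in> borel_measurable (lebesgue_on \<Omega>)"
      using L2_measurable[OF H01_pairD(2)[OF mG]] L2_measurable[OF H01_pairD(2)[OF H]] by auto
    have "(LINT x|lebesgue_on \<Omega>. weak_grad \<Omega> (\<lambda>x. - P x) x \<bullet> weak_grad \<Omega> v x) = (LINT x|lebesgue_on \<Omega>. (- G x) \<bullet> H x)"
      using \<Omega> m by (intro integral_cong_AE[symmetric] ae borel_measurable_lebesgue_on_cong_AE[OF _ m ae]) (auto intro: borel_open)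
    also have "\<dots> = (LINT x|lebesgue_on \<Omega>. - f x * v x)"
      using d by simp
    finally show "(LINT x|lebesgue_on \<Omega>. weak_grad \<Omega> (\<lambda>x. - P x) x \<bullet> weak_grad \<Omega> v x) = (LINT x|lebesgue_on \<Omega>. - f x * v x)" .
  qed
qed

section \<open>The Sobolev inequality\<close>

subsection \<open>Hoelder's inequality for several functions\<close>

text \<open>The value \<open>1\<close> for \<open>p = 0\<close>, also at the bases \<open>0\<close> and \<open>\<infinity>\<close>, lets factors with weight zero drop out of
  Hoelder's inequality and keeps the exponents additive.\<close>

definition epow :: "ennreal \<Rightarrow> real \<Rightarrow> ennreal" where
  "epow x p = (if p = 0 then 1 else if x = \<infinity> then \<infinity> else ennreal (enn2real x powr p))"

lemma epow_0 [simp]: "epow x 0 = 1"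
  by (simp add: epow_def)

lemma epow_measurable [measurable]: "f \<in> borel_measurable M \<Longrightarrow> (\<lambda>x. epow (f x) p) \<in> borel_measurable M"
proof -
  assume [measurable]: "f \<in> borel_measurable M"
  have "(\<lambda>x. if f x = \<infinity> then \<infinity> else ennreal (enn2real (f x) powr p)) \<in> borel_measurable M"
    by measurable
  then show ?thesis by (cases "p = 0") (simp_all add: epow_def)
qed

lemma epow_ennreal: "x \<ge> 0 \<Longrightarrow> p \<noteq> 0 \<Longrightarrow> epow (ennreal x) p = ennreal (x powr p)"
  by (simp add: epow_def)

lemma epow_zero: "p \<noteq> 0 \<Longrightarrow> epow 0 p = 0"
  by (simp add: epow_def)

lemma epow_add: "0 \<le> p \<Longrightarrow> 0 \<le> q \<Longrightarrow> epow x (p + q) = epow x p * epow x q"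
  by (cases "p = 0 \<or> q = 0")
     (auto simp: epow_def powr_add ennreal_mult' ennreal_mult)

lemma epow_mult:
  assumes "0 \<le> p" shows "epow (x * y) p = epow x p * epow y p"
proof -
  have nz: "epow z p \<noteq> 0" if "z \<noteq> 0" for z
    using that assms by (cases z) (auto simp: epow_def ennreal_eq_0_iff)
  consider "p = 0" | "p > 0" "x = 0 \<or> y = 0" | "p > 0" "x \<noteq> 0" "y \<noteq> 0" "x = \<infinity> \<or> y = \<infinity>" |
    "p > 0" "x \<noteq> \<infinity>" "y \<noteq> \<infinity>"
    using assms by linarith
  then show ?thesis
  proof cases
    case 3
    have top: "epow \<infinity> p = \<infinity>" using 3(1) by (simp add: epow_def)
    have "x * y = \<infinity>" using 3 by (auto simp: ennreal_mult_eq_top_iff)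
    moreover have "epow x p * epow y p = \<infinity>"
      using 3(4) top nz[OF 3(2)] nz[OF 3(3)] by (auto simp: ennreal_mult_eq_top_iff)
    ultimately show ?thesis using top by simp
  next
    case 4
    then obtain a b where ab: "x = ennreal a" "y = ennreal b" "a \<ge> 0" "b \<ge> 0"
      by (metis ennreal_cases infinity_ennreal_def)
    have "epow (x * y) p = epow (ennreal (a * b)) p" using ab by (simp add: ennreal_mult)
    also have "\<dots> = ennreal (a powr p * b powr p)"
      using ab 4(1) by (simp add: epow_ennreal powr_mult)
    also have "\<dots> = epow x p * epow y p" using ab 4(1) by (simp add: epow_ennreal ennreal_mult)
    finally show ?thesis .
  qed (auto simp: epow_zero)
qed

lemma epow_mono: "0 \<le> p \<Longrightarrow> x \<le> y \<Longrightarrow> epow x p \<le> epow y p"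
  by (cases x; cases y) (auto simp: epow_def powr_mono2 ennreal_leI top_unique)

text \<open>Jensen's inequality for the exponential function.\<close>

lemma weighted_AM_GM:
  fixes a x :: "'i \<Rightarrow> real"
  assumes J: "finite J" "\<And>j. j \<in> J \<Longrightarrow> a j \<ge> 0" "sum a J = 1" and x: "\<And>j. j \<in> J \<Longrightarrow> x j > 0"
  shows "(\<Prod>j\<in>J. x j powr a j) \<le> (\<Sum>j\<in>J. a j * x j)"
proof -
  have ne: "J \<noteq> {}" using J by auto
  have "(\<Prod>j\<in>J. x j powr a j) = exp (\<Sum>j\<in>J. a j *\<^sub>R ln (x j))"
    unfolding exp_sum[OF J(1)] using less_imp_neq[OF x] by (intro prod.cong refl) (auto simp: powr_def)
  also have "\<dots> \<le> (\<Sum>j\<in>J. a j * exp (ln (x j)))"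
    using J by (intro convex_on_sum[OF J(1) ne exp_convex]) auto
  also have "\<dots> = (\<Sum>j\<in>J. a j * x j)"
    using x by (intro sum.cong) auto
  finally show ?thesis .
qed

lemma prod_epow_le_sum:
  assumes J: "finite J" "\<And>j. j \<in> J \<Longrightarrow> a j \<ge> 0" "sum a J = 1"
  shows "(\<Prod>j\<in>J. epow (x j) (a j)) \<le> (\<Sum>j\<in>J. ennreal (a j) * x j)"
proof -
  define J' where "J' = {j\<in>J. a j \<noteq> 0}"
  have J': "finite J'" "J' \<subseteq> J" using J by (auto simp: J'_def)
  have pos: "a j > 0" if "j \<in> J'" for j using that J(2)[of j] by (auto simp: J'_def less_le)
  have s1: "sum a J' = 1" using J by (subst J(3)[symmetric], intro sum.mono_neutral_left) (auto simp: J'_def)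
  have p: "(\<Prod>j\<in>J. epow (x j) (a j)) = (\<Prod>j\<in>J'. epow (x j) (a j))"
    using J J' by (intro prod.mono_neutral_right) (auto simp: J'_def)
  have s: "(\<Sum>j\<in>J. ennreal (a j) * x j) = (\<Sum>j\<in>J'. ennreal (a j) * x j)"
    using J J' by (intro sum.mono_neutral_right) (auto simp: J'_def)
  consider j where "j \<in> J'" "x j = \<infinity>" | j where "j \<in> J'" "x j = 0" | "\<forall>j\<in>J'. x j \<noteq> \<infinity> \<and> x j \<noteq> 0" by blast
  then show ?thesis
  proof cases
    case 1
    then have "ennreal (a j) * x j = \<infinity>" using pos[OF 1(1)] by (auto simp: ennreal_mult_eq_top_iff ennreal_eq_0_iff)
    then have "(\<Sum>j\<in>J'. ennreal (a j) * x j) = \<infinity>"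
      using 1(1) J'(1) by (simp add: sum.remove)
    then show ?thesis unfolding s by simp
  next
    case 2
    then have "epow (x j) (a j) = 0" using pos[of j] by (auto simp: epow_def)
    then have z: "(\<Prod>j\<in>J'. epow (x j) (a j)) = 0" using 2(1) J'(1) by (intro prod_zero) auto
    show ?thesis unfolding p z by simp
  next
    case 3
    define y where "y j = enn2real (x j)" for j
    have y: "x j = ennreal (y j)" "y j > 0" if "j \<in> J'" for j
      using 3 that by (auto simp: y_def enn2real_positive_iff less_top zero_less_iff_neq_zero)
    have "(\<Prod>j\<in>J'. epow (x j) (a j)) = (\<Prod>j\<in>J'. ennreal (y j powr a j))"
      using y pos by (intro prod.cong refl) (auto simp: epow_ennreal less_imp_le less_imp_neq[symmetric])
    also have "\<dots> = ennreal (\<Prod>j\<in>J'. y j powr a j)"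
      by (intro prod_ennreal) auto
    also have "\<dots> \<le> ennreal (\<Sum>j\<in>J'. a j * y j)"
      using y pos s1 J' by (intro ennreal_leI weighted_AM_GM) (auto simp: less_imp_le)
    also have "\<dots> = (\<Sum>j\<in>J'. ennreal (a j * y j))"
      using y pos by (intro sum_ennreal[symmetric]) (auto simp: less_imp_le)
    also have "\<dots> = (\<Sum>j\<in>J'. ennreal (a j) * x j)"
      using y pos by (intro sum.cong refl) (auto simp: ennreal_mult less_imp_le)
    finally show ?thesis unfolding p s .
  qed
qed

text \<open>Divide each factor by its integral and integrate the weighted inequality of arithmetic and geometric
  means. Factors with integral \<open>0\<close> or \<open>\<infinity>\<close> are treated separately.\<close>

lemma nn_integral_Hoelder:
  assumes J: "finite J" "\<And>j. j \<in> J \<Longrightarrow> a j \<ge> 0" "sum a J = 1"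
    and f[measurable]: "\<And>j. j \<in> J \<Longrightarrow> f j \<in> borel_measurable M"
  shows "(\<integral>\<^sup>+x. (\<Prod>j\<in>J. epow (f j x) (a j)) \<partial>M) \<le> (\<Prod>j\<in>J. epow (\<integral>\<^sup>+x. f j x \<partial>M) (a j))"
proof -
  define J' where "J' = {j\<in>J. a j \<noteq> 0}"
  have J': "finite J'" "J' \<subseteq> J" using J by (auto simp: J'_def)
  have pos: "a j > 0" if "j \<in> J'" for j using that J(2)[of j] by (auto simp: J'_def less_le)
  have s1: "sum a J' = 1" using J by (subst J(3)[symmetric], intro sum.mono_neutral_left) (auto simp: J'_def)
  have p: "(\<Prod>j\<in>J. epow (y j) (a j)) = (\<Prod>j\<in>J'. epow (y j) (a j))" for y
    using J J' by (intro prod.mono_neutral_right) (auto simp: J'_def)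
  have [measurable]: "f j \<in> borel_measurable M" if "j \<in> J'" for j using that J' f by auto
  define I where "I j = (\<integral>\<^sup>+x. f j x \<partial>M)" for j
  consider j where "j \<in> J'" "I j = 0" | j where "\<forall>j\<in>J'. I j \<noteq> 0" "j \<in> J'" "I j = \<infinity>" | "\<forall>j\<in>J'. I j \<noteq> \<infinity> \<and> I j \<noteq> 0" by blast
  then show ?thesis
  proof cases
    case 1
    then have "AE x in M. f j x = 0"
      unfolding I_def by (subst (asm) nn_integral_0_iff_AE) auto
    then have "AE x in M. (\<Prod>j\<in>J'. epow (f j x) (a j)) = 0"
    proof eventually_elim
      case (elim x)
      then have "epow (f j x) (a j) = 0" using pos[OF 1(1)] by (simp add: epow_zero)
      then show ?case using 1(1) J'(1) by (auto simp: prod_zero_iff)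
    qed
    then have "(\<integral>\<^sup>+x. (\<Prod>j\<in>J'. epow (f j x) (a j)) \<partial>M) = 0"
      by (simp add: nn_integral_0_iff_AE)
    then show ?thesis unfolding p by simp
  next
    case 2
    have "epow (I k) (a k) \<noteq> 0" if "k \<in> J'" for k
      using 2(1) pos[OF that] that by (cases "I k") (auto simp: epow_def ennreal_eq_0_iff)
    then have "(\<Prod>k\<in>J'. epow (I k) (a k)) = \<infinity>"
      using 2 J'(1) pos[OF 2(2)] by (subst prod.remove[OF J'(1) 2(2)]) (auto simp: epow_def ennreal_top_mult prod_zero_iff)
    then show ?thesis unfolding p I_def by simp
  next
    case 3
    have "(\<integral>\<^sup>+x. (\<Prod>j\<in>J'. epow (f j x) (a j)) \<partial>M) =
        (\<integral>\<^sup>+x. (\<Prod>j\<in>J'. epow (I j) (a j)) * (\<Prod>j\<in>J'. epow (f j x / I j) (a j)) \<partial>M)"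
    proof (intro nn_integral_cong)
      fix x
      have "epow (f j x) (a j) = epow (I j) (a j) * epow (f j x / I j) (a j)" if "j \<in> J'" for j
      proof -
        have "I j * (f j x / I j) = f j x"
          using 3 that by (simp add: ennreal_times_divide ennreal_mult_divide_eq mult.commute[of "I j"] less_top)
        then show ?thesis using epow_mult[of "a j" "I j" "f j x / I j"] pos[OF that] by simp
      qed
      then show "(\<Prod>j\<in>J'. epow (f j x) (a j)) = (\<Prod>j\<in>J'. epow (I j) (a j)) * (\<Prod>j\<in>J'. epow (f j x / I j) (a j))"
        by (simp flip: prod.distrib)
    qed
    also have "\<dots> = (\<Prod>j\<in>J'. epow (I j) (a j)) * (\<integral>\<^sup>+x. (\<Prod>j\<in>J'. epow (f j x / I j) (a j)) \<partial>M)"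
      by (rule nn_integral_cmult) measurable
    also have "\<dots> \<le> (\<Prod>j\<in>J'. epow (I j) (a j)) * (\<integral>\<^sup>+x. (\<Sum>j\<in>J'. ennreal (a j) * (f j x / I j)) \<partial>M)"
      using J' pos s1 by (intro mult_left_mono nn_integral_mono prod_epow_le_sum) (auto intro: less_imp_le)
    also have "(\<integral>\<^sup>+x. (\<Sum>j\<in>J'. ennreal (a j) * (f j x / I j)) \<partial>M) = (\<Sum>j\<in>J'. ennreal (a j) * (I j / I j))"
      unfolding I_def by (subst nn_integral_sum) (auto simp: nn_integral_cmult nn_integral_divide intro!: sum.cong)
    also have "\<dots> = (\<Sum>j\<in>J'. ennreal (a j))"
      using 3 by (intro sum.cong refl) (auto simp: ennreal_divide_self less_top)
    also have "\<dots> = 1" using pos s1 by (subst sum_ennreal) (auto intro: less_imp_le)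
    finally show ?thesis unfolding p I_def by simp
  qed
qed

subsection \<open>The grid-lines inequality\<close>

definition line :: "(('i \<Rightarrow> real) \<Rightarrow> ennreal) \<Rightarrow> 'i \<Rightarrow> ('i \<Rightarrow> real) \<Rightarrow> ennreal" where
  "line F j x = (\<integral>\<^sup>+t. F (x(j := t)) \<partial>lborel)"

interpretation lborel_prod: product_sigma_finite "\<lambda>_::'i. lborel :: real measure"
  by standard

lemma line_measurable [measurable]:
  assumes [measurable]: "F \<in> borel_measurable (Pi\<^sub>M I (\<lambda>_. lborel :: real measure))" and "j \<in> I"
  shows "line F j \<in> borel_measurable (Pi\<^sub>M I (\<lambda>_. lborel))"
proof -
  have "(\<lambda>(x, t). x(j := t)) \<in> measurable (Pi\<^sub>M I (\<lambda>_. lborel :: real measure) \<Otimes>\<^sub>M lborel) (Pi\<^sub>M I (\<lambda>_. lborel))"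
    using measurable_add_dim[of j I "\<lambda>_. lborel :: real measure"] assms(2) by (simp add: insert_absorb)
  then have [measurable]: "(\<lambda>z. F (case z of (x, t) \<Rightarrow> x(j := t))) \<in> borel_measurable (Pi\<^sub>M I (\<lambda>_. lborel :: real measure) \<Otimes>\<^sub>M lborel)"
    by (rule measurable_compose) fact
  have "(\<lambda>(x, t). F (x(j := t))) \<in> borel_measurable (Pi\<^sub>M I (\<lambda>_. lborel :: real measure) \<Otimes>\<^sub>M lborel)"
    using \<open>(\<lambda>z. F (case z of (x, t) \<Rightarrow> x(j := t))) \<in> _\<close> by (simp add: case_prod_beta)
  from sigma_finite_measure.borel_measurable_nn_integral[OF sigma_finite_lborel this]
  show ?thesis unfolding line_def[abs_def] .
qed

text \<open>Induction on the set of coordinates. Integrating first over the coordinate \<open>i\<close>, the factor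
  \<open>line F i\<close> is constant, and Hoelder's inequality with weight \<open>1 - |I| p\<close> for \<open>F\<close> and weight \<open>p\<close> for each
  of the other \<open>|I|\<close> line integrals leaves the same expression for the marginal \<open>G\<close> of \<open>F\<close> on the
  remaining coordinates. The exponent of \<open>F\<close> is chosen to make this work. For \<open>n\<close> coordinates it is
  \<open>0\<close> when \<open>p = 1 / (n - 1)\<close>, and this case gives the Gagliardo--Nirenberg inequality.\<close>

lemma grid_lines_inequality:
  fixes I :: "'i set"
  assumes "finite I" "p > 0" "(real (card I) - 1) * p \<le> 1"
    and F: "F \<in> borel_measurable (Pi\<^sub>M I (\<lambda>_. lborel :: real measure))"
  shows "(\<integral>\<^sup>+x. epow (F x) (1 - (real (card I) - 1) * p) * (\<Prod>j\<in>I. epow (line F j x) p) \<partial>Pi\<^sub>M I (\<lambda>_. lborel))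
     \<le> epow (\<integral>\<^sup>+x. F x \<partial>Pi\<^sub>M I (\<lambda>_. lborel)) (1 + p)"
  using assms
proof (induction I arbitrary: F rule: finite_induct)
  case empty
  then show ?case by (simp add: lborel_prod.nn_integral_empty)
next
  case (insert i I)
  let ?L = "lborel :: real measure"
  note F[measurable] = insert.prems(3)
  have p: "p > 0" by fact
  have c: "real (card (insert i I)) = real (card I) + 1" using insert.hyps by simp
  have cp: "real (card I) * p \<le> 1" using insert.prems(2) unfolding c by simp
  define G where "G = line F i"
  have add[measurable]: "(\<lambda>(x, t). x(i := t)) \<in> measurable (Pi\<^sub>M I (\<lambda>_. ?L) \<Otimes>\<^sub>M ?L) (Pi\<^sub>M (insert i I) (\<lambda>_. ?L))"
    by (rule measurable_add_dim)
  have upd: "(\<lambda>t. x(i := t)) \<in> measurable ?L (Pi\<^sub>M (insert i I) (\<lambda>_. ?L))" if "x \<in> space (Pi\<^sub>M I (\<lambda>_. ?L))" for x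
    using measurable_compose[OF measurable_Pair1'[OF that] add] by simp
  have Gm[measurable]: "G \<in> borel_measurable (Pi\<^sub>M I (\<lambda>_. ?L))"
  proof -
    have "(\<lambda>(x, t). F (x(i := t))) \<in> borel_measurable (Pi\<^sub>M I (\<lambda>_. ?L) \<Otimes>\<^sub>M ?L)"
      using measurable_compose[OF add F] by (simp add: case_prod_beta)
    from sigma_finite_measure.borel_measurable_nn_integral[OF sigma_finite_lborel this]
    show ?thesis unfolding G_def line_def[abs_def] .
  qed
  define e where "e = 1 - real (card I) * p"
  have e: "e \<ge> 0" using cp by (simp add: e_def)
  define \<Phi> where "\<Phi> x = epow (F x) e * (\<Prod>j\<in>insert i I. epow (line F j x) p)" for x
  have \<Phi>m[measurable]: "\<Phi> \<in> borel_measurable (Pi\<^sub>M (insert i I) (\<lambda>_. ?L))"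
    unfolding \<Phi>_def[abs_def] using insert.hyps
    by (intro borel_measurable_times_ennreal borel_measurable_prod_ennreal epow_measurable line_measurable F)
  have Gline: "line F i (x(i := t)) = G x" for x t
    by (simp add: line_def G_def)
  have swap: "(\<integral>\<^sup>+t. line F j (x(i := t)) \<partial>?L) = line G j x" if "j \<in> I" "x \<in> space (Pi\<^sub>M I (\<lambda>_. ?L))" for j x
  proof -
    have ij: "i \<noteq> j" using that insert.hyps by auto
    have "(\<lambda>(t, r). (x(j := r))(i := t)) \<in> measurable (?L \<Otimes>\<^sub>M ?L) (Pi\<^sub>M (insert i I) (\<lambda>_. ?L))"
    proof -
      have "(\<lambda>r. x(j := r)) \<in> measurable ?L (Pi\<^sub>M I (\<lambda>_. ?L))"
        using measurable_compose[OF measurable_Pair1'[OF that(2)] measurable_add_dim[of j I "\<lambda>_. ?L"]] that(1) by (simp add: insert_absorb)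
      then have "(\<lambda>z. (x(j := snd z), fst z)) \<in> measurable (?L \<Otimes>\<^sub>M ?L) (Pi\<^sub>M I (\<lambda>_. ?L) \<Otimes>\<^sub>M ?L)"
        by (intro measurable_Pair measurable_fst measurable_compose[OF measurable_snd])
      from measurable_compose[OF this add] show ?thesis by (simp add: case_prod_beta)
    qed
    from measurable_compose[OF this F]
    have m: "(\<lambda>(t, r). F (x(j := r, i := t))) \<in> borel_measurable (?L \<Otimes>\<^sub>M ?L)"
      by (simp add: case_prod_beta fun_upd_def)
    have ps: "pair_sigma_finite ?L ?L" by (simp add: pair_sigma_finite_def sigma_finite_lborel)
    have "(\<integral>\<^sup>+t. line F j (x(i := t)) \<partial>?L) = (\<integral>\<^sup>+t. \<integral>\<^sup>+r. F (x(j := r, i := t)) \<partial>?L \<partial>?L)"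
      unfolding line_def using ij by (simp add: fun_upd_twist)
    also have "\<dots> = (\<integral>\<^sup>+r. \<integral>\<^sup>+t. F (x(j := r, i := t)) \<partial>?L \<partial>?L)"
      by (rule pair_sigma_finite.Fubini'[OF ps m, symmetric])
    also have "\<dots> = line G j x" by (simp add: line_def G_def)
    finally show ?thesis .
  qed
  have inner: "(\<integral>\<^sup>+t. \<Phi> (x(i := t)) \<partial>?L) \<le> epow (G x) (1 - (real (card I) - 1) * p) * (\<Prod>j\<in>I. epow (line G j x) p)"
    if x: "x \<in> space (Pi\<^sub>M I (\<lambda>_. ?L))" for x
  proof -
    define J where "J = insert None (Some ` I)"
    define a where "a = case_option e (\<lambda>j::'i. p)"
    define f where "f = case_option (\<lambda>t. F (x(i := t))) (\<lambda>j t. line F j (x(i := t)))"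
    have prodJ: "(\<Prod>k\<in>J. h k) = h None * (\<Prod>j\<in>I. h (Some j))" for h :: "'i option \<Rightarrow> ennreal"
      unfolding J_def using insert.hyps by (subst prod.insert) (auto simp: prod.reindex)
    have sumJ: "(\<Sum>k\<in>J. a k) = 1"
      unfolding J_def using insert.hyps by (subst sum.insert) (auto simp: sum.reindex a_def e_def)
    have Fx: "(\<lambda>t. F (x(i := t))) \<in> borel_measurable ?L" by (rule measurable_compose[OF upd[OF x] F])
    have lx: "(\<lambda>t. line F j (x(i := t))) \<in> borel_measurable ?L" if "j \<in> I" for j
      using that by (intro measurable_compose[OF upd[OF x] line_measurable[OF F]]) auto
    have "(\<integral>\<^sup>+t. \<Phi> (x(i := t)) \<partial>?L) = (\<integral>\<^sup>+t. epow (G x) p * (\<Prod>k\<in>J. epow (f k t) (a k)) \<partial>?L)"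
      unfolding prodJ \<Phi>_def using insert.hyps by (simp add: Gline f_def a_def mult_ac)
    also have "\<dots> = epow (G x) p * (\<integral>\<^sup>+t. (\<Prod>k\<in>J. epow (f k t) (a k)) \<partial>?L)"
      unfolding prodJ f_def using Fx lx
      by (intro nn_integral_cmult borel_measurable_times_ennreal borel_measurable_prod_ennreal epow_measurable) auto
    also have "\<dots> \<le> epow (G x) p * (\<Prod>k\<in>J. epow (\<integral>\<^sup>+t. f k t \<partial>?L) (a k))"
    proof (intro mult_left_mono nn_integral_Hoelder)
      show "finite J" using insert.hyps by (simp add: J_def)
      show "sum a J = 1" by (rule sumJ)
      show "0 \<le> a k" for k using e p by (auto simp: a_def split: option.split)
      show "f k \<in> borel_measurable ?L" if "k \<in> J" for k
        using that Fx lx by (auto simp: f_def J_def)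
    qed simp
    also have "\<dots> = (epow (G x) p * epow (G x) e) * (\<Prod>j\<in>I. epow (line G j x) p)"
    proof -
      have "(\<integral>\<^sup>+t. F (x(i := t)) \<partial>?L) = G x" by (simp add: G_def line_def)
      moreover have "(\<Prod>j\<in>I. epow (\<integral>\<^sup>+t. line F j (x(i := t)) \<partial>?L) p) = (\<Prod>j\<in>I. epow (line G j x) p)"
        using swap[OF _ x] by (intro prod.cong) auto
      ultimately show ?thesis unfolding prodJ by (simp add: f_def a_def mult.assoc)
    qed
    also have "epow (G x) p * epow (G x) e = epow (G x) (p + e)"
      using p e by (intro epow_add[symmetric]) auto
    also have "p + e = 1 - (real (card I) - 1) * p" by (simp add: e_def algebra_simps)
    finally show ?thesis .
  qed
  have "(\<integral>\<^sup>+x. epow (F x) (1 - (real (card (insert i I)) - 1) * p) * (\<Prod>j\<in>insert i I. epow (line F j x) p) \<partial>Pi\<^sub>M (insert i I) (\<lambda>_. ?L))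
     = (\<integral>\<^sup>+x. \<Phi> x \<partial>Pi\<^sub>M (insert i I) (\<lambda>_. ?L))"
    unfolding \<Phi>_def e_def c by simp
  also have "\<dots> = (\<integral>\<^sup>+x. (\<integral>\<^sup>+t. \<Phi> (x(i := t)) \<partial>?L) \<partial>Pi\<^sub>M I (\<lambda>_. ?L))"
    by (rule lborel_prod.product_nn_integral_insert[OF insert.hyps(1,2) \<Phi>m])
  also have "\<dots> \<le> (\<integral>\<^sup>+x. epow (G x) (1 - (real (card I) - 1) * p) * (\<Prod>j\<in>I. epow (line G j x) p) \<partial>Pi\<^sub>M I (\<lambda>_. ?L))"
    by (intro nn_integral_mono inner)
  also have "\<dots> \<le> epow (\<integral>\<^sup>+x. G x \<partial>Pi\<^sub>M I (\<lambda>_. ?L)) (1 + p)"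
    using cp p by (intro insert.IH Gm) (auto simp: algebra_simps)
  also have "(\<integral>\<^sup>+x. G x \<partial>Pi\<^sub>M I (\<lambda>_. ?L)) = (\<integral>\<^sup>+x. F x \<partial>Pi\<^sub>M (insert i I) (\<lambda>_. ?L))"
    unfolding G_def line_def by (rule lborel_prod.product_nn_integral_insert[OF insert.hyps(1,2) F, symmetric])
  finally show ?case .
qed

text \<open>If \<open>q\<close> is bounded by every line integral of \<open>F\<close> parallel to the axes, then \<open>q\<close> to the power
  \<open>n/(n-1)\<close> is bounded by the product of the \<open>n\<close> line integrals, each to the power \<open>1/(n-1)\<close>, and the
  grid-lines inequality applies.\<close>

lemma Gagliardo_Nirenberg:
  fixes F :: "'a::euclidean_space \<Rightarrow> ennreal" and q :: "'a \<Rightarrow> ennreal"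
  assumes F[measurable]: "F \<in> borel_measurable borel" and d: "DIM('a) \<ge> 2"
    and q: "\<And>y b c. b \<in> Basis \<Longrightarrow> q (y + c *\<^sub>R b) \<le> (\<integral>\<^sup>+t. F (y + t *\<^sub>R b) \<partial>lborel)"
    and qm[measurable]: "q \<in> borel_measurable borel"
  shows "(\<integral>\<^sup>+x. epow (q x) (real DIM('a) / (real DIM('a) - 1)) \<partial>lborel)
    \<le> epow (\<integral>\<^sup>+x. F x \<partial>lborel) (real DIM('a) / (real DIM('a) - 1))"
proof -
  let ?n = "real DIM('a)"
  let ?M = "Pi\<^sub>M (Basis::'a set) (\<lambda>_. lborel :: real measure)"
  define E where "E x = (\<Sum>b\<in>Basis. x b *\<^sub>R b)" for x :: "'a \<Rightarrow> real"
  define p where "p = 1 / (?n - 1)"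
  have n: "?n \<ge> 2" using d by linarith
  have p: "p > 0" "1 + p = ?n / (?n - 1)" "1 - (?n - 1) * p = 0" using n by (auto simp: p_def field_simps)
  have Em[measurable]: "E \<in> measurable ?M borel" unfolding E_def[abs_def] by measurable
  have lb: "lborel = distr ?M borel E"
    unfolding lborel_eq_real E_def[abs_def] by (rule lborel_def)
  have tr: "(\<integral>\<^sup>+x. h x \<partial>lborel) = (\<integral>\<^sup>+x. h (E x) \<partial>?M)" if "h \<in> borel_measurable borel" for h :: "'a \<Rightarrow> ennreal"
    by (subst lb, subst nn_integral_distr) (use that in auto)
  have Eupd: "E (x(b := t)) = (E x - x b *\<^sub>R b) + t *\<^sub>R b" if "b \<in> Basis" for x b t
    unfolding E_def by (subst (1 2) sum.remove[OF finite_Basis that]) (auto intro!: sum.cong)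
  define F' where "F' x = F (E x)" for x
  have F'm: "F' \<in> borel_measurable ?M" unfolding F'_def[abs_def] by measurable
  have ql: "q (E x) \<le> line F' b x" if "b \<in> Basis" for b x
    using q[OF that, of "E x - x b *\<^sub>R b" "x b"] Eupd[OF that] by (simp add: line_def F'_def)
  have pw: "epow y (1 + p) = (\<Prod>b\<in>(Basis::'a set). epow y p)" for y
  proof -
    have *: "epow y (real k * p) = epow y p ^ k" for k
      by (induction k) (use p(1) epow_add[of p "real _ * p" y] in \<open>auto simp: algebra_simps\<close>)
    have "1 + p = ?n * p" using p(3) by (simp add: algebra_simps)
    then show ?thesis by (simp only: * prod_constant)
  qed
  have "(\<integral>\<^sup>+x. epow (q x) (1 + p) \<partial>lborel) = (\<integral>\<^sup>+x. epow (q (E x)) (1 + p) \<partial>?M)"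
    by (rule tr) measurable
  also have "\<dots> \<le> (\<integral>\<^sup>+x. epow (F' x) (1 - (?n - 1) * p) * (\<Prod>b\<in>Basis. epow (line F' b x) p) \<partial>?M)"
  proof (intro nn_integral_mono)
    fix x
    have "epow (q (E x)) (1 + p) \<le> (\<Prod>b\<in>Basis. epow (line F' b x) p)"
      unfolding pw using p(1) by (intro prod_mono_ennreal epow_mono ql) auto
    then show "epow (q (E x)) (1 + p) \<le> epow (F' x) (1 - (?n - 1) * p) * (\<Prod>b\<in>Basis. epow (line F' b x) p)"
      unfolding p(3) by simp
  qed
  also have "\<dots> \<le> epow (\<integral>\<^sup>+x. F' x \<partial>?M) (1 + p)"
    using p by (intro grid_lines_inequality F'm) auto
  also have "(\<integral>\<^sup>+x. F' x \<partial>?M) = (\<integral>\<^sup>+x. F x \<partial>lborel)"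
    unfolding F'_def by (rule tr[symmetric]) measurable
  finally show ?thesis by (simp only: p(2))
qed

subsection \<open>Sobolev's inequality for the critical exponent\<close>

lemma has_real_derivative_abs_powr:
  fixes s :: real
  assumes "g > 1"
  shows "((\<lambda>s. \<bar>s\<bar> powr g) has_real_derivative g * \<bar>s\<bar> powr (g - 1) * sgn s) (at s)"
proof (cases "s = 0")
  case True
  have "((\<lambda>h. \<bar>h\<bar> powr (g - 1)) \<longlongrightarrow> \<bar>0\<bar> powr (g - 1)) (at (0::real))"
    using assms by (intro tendsto_powr' tendsto_intros) auto
  then have "((\<lambda>h. \<bar>h\<bar> powr (g - 1)) \<longlongrightarrow> 0) (at (0::real))" using assms by simp
  then have "((\<lambda>h. \<bar>h\<bar> powr g / h) \<longlongrightarrow> 0) (at (0::real))"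
  proof (rule Lim_null_comparison[rotated])
    show "\<forall>\<^sub>F h in at 0. norm (\<bar>h\<bar> powr g / h) \<le> \<bar>h\<bar> powr (g - 1)"
      unfolding eventually_at_filter by (auto simp: powr_diff intro!: always_eventually)
  qed
  then show ?thesis unfolding True DERIV_def using assms by simp
next
  case False
  have d: "((\<lambda>s. (c * s) powr g) has_real_derivative c * (g * (c * s) powr (g - 1))) (at s)" if "c * s > 0" for c
    using that by (auto intro!: derivative_eq_intros simp: powr_diff)
  have "\<forall>\<^sub>F x in nhds s. \<bar>x\<bar> powr g = (sgn s * x) powr g"
  proof (cases "s > 0")
    case True
    then have "\<forall>\<^sub>F x in nhds s. x \<in> {0<..}" by (intro eventually_nhds_in_open) auto
    then show ?thesis by eventually_elim (use True in auto)
  next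
    case 2: False
    then have "\<forall>\<^sub>F x in nhds s. x \<in> {..<0}" using False by (intro eventually_nhds_in_open) auto
    then show ?thesis by eventually_elim (use 2 False in auto)
  qed
  moreover have "((\<lambda>x. (sgn s * x) powr g) has_real_derivative g * \<bar>s\<bar> powr (g - 1) * sgn s) (at s)"
    using d[of "sgn s"] False by (simp add: sgn_mult_self_eq abs_sgn[symmetric] mult_ac)
  ultimately show ?thesis by (subst DERIV_cong_ev[OF refl _ refl])
qed

lemma continuous_abs_powr:
  assumes "continuous_on S f" "g > 0" shows "continuous_on S (\<lambda>x. \<bar>f x :: real\<bar> powr g)"
  using assms by (intro continuous_on_powr' continuous_intros) auto

text \<open>Integrate the derivative of \<open>|f|\<^sup>g\<close> along the line, starting outside the support of \<open>f\<close>.\<close>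

lemma abs_powr_le_line_integral:
  fixes f :: "real^'n \<Rightarrow> real"
  assumes f: "smooth f" "compact (closure {x. f x \<noteq> 0})" and g: "g > 1"
  shows "ennreal (\<bar>f (y + c *\<^sub>R axis i 1)\<bar> powr g)
     \<le> (\<integral>\<^sup>+t. ennreal (g * \<bar>f (y + t *\<^sub>R axis i 1)\<bar> powr (g - 1) * norm (grad f (y + t *\<^sub>R axis i 1))) \<partial>lborel)"
proof -
  let ?b = "axis i (1::real)"
  obtain R where R: "\<And>x. x \<in> closure {x. f x \<noteq> 0} \<Longrightarrow> norm x \<le> R"
    using compact_imp_bounded[OF f(2)] by (auto simp: bounded_iff)
  define L where "L = \<bar>R\<bar> + norm (y + c *\<^sub>R ?b) + 1"
  have L: "L > 0" by (simp add: L_def add_nonneg_pos)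
  have "L - norm (y + c *\<^sub>R ?b) \<le> norm (y + (c - L) *\<^sub>R ?b)"
    using norm_triangle_ineq4[of "y + c *\<^sub>R ?b" "y + (c - L) *\<^sub>R ?b"] L by (simp add: norm_axis_1 scaleR_left_diff_distrib)
  then have "norm (y + (c - L) *\<^sub>R ?b) > R" by (simp add: L_def)
  then have "y + (c - L) *\<^sub>R ?b \<notin> closure {x. f x \<noteq> 0}" using R by force
  then have f0: "f (y + (c - L) *\<^sub>R ?b) = 0" using closure_subset[of "{x. f x \<noteq> 0}"] by blast
  define h where "h t = \<bar>f (y + t *\<^sub>R ?b)\<bar> powr g" for t
  define h' where "h' t = g * \<bar>f (y + t *\<^sub>R ?b)\<bar> powr (g - 1) * sgn (f (y + t *\<^sub>R ?b)) * partial_deriv i f (y + t *\<^sub>R ?b)" for t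
  define H where "H t = g * \<bar>f (y + t *\<^sub>R ?b)\<bar> powr (g - 1) * norm (grad f (y + t *\<^sub>R ?b))" for t
  have D: "(h has_real_derivative h' t) (at t)" for t
    unfolding h_def h'_def by (rule DERIV_chain2[OF has_real_derivative_abs_powr[OF g] DERIV_along_axis[OF f(1)]])
  have "(h' has_integral h c - h (c - L)) {c - L..c}"
    using L D by (intro fundamental_theorem_of_calculus)
      (auto intro: has_field_derivative_at_within simp flip: has_real_derivative_iff_has_vector_derivative)
  then have hI: "(h' has_integral h c) {c - L..c}" using f0 g by (simp add: h_def)
  have lc: "continuous_on S (\<lambda>t. y + t *\<^sub>R ?b)" for S :: "real set" by (intro continuous_intros)
  have Hc: "continuous_on S H" for S
    unfolding H_def using g
    by (intro continuous_intros continuous_abs_powr continuous_on_compose2[OF smooth_continuous[OF f(1), of UNIV] lc]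
        continuous_on_compose2[OF continuous_grad[OF f(1), of UNIV] lc]) auto
  have H0: "H t \<ge> 0" for t using g by (simp add: H_def)
  have bd: "norm (h' t) \<le> H t" for t
    unfolding h'_def H_def using g component_le_norm_cart[of "grad f (y + t *\<^sub>R ?b)" i]
    by (auto simp: abs_mult sgn_if intro!: mult_left_mono mult_nonneg_nonneg)
  have "norm (integral {c - L..c} h') \<le> integral {c - L..c} H"
  proof (rule integral_norm_bound_integral)
    show "h' integrable_on {c - L..c}" using hI by auto
    show "H integrable_on {c - L..c}" by (intro integrable_continuous_interval Hc)
  qed (rule bd)
  then have "h c \<le> integral {c - L..c} H"
    using hI by (simp add: integral_unique)
  then have "ennreal (h c) \<le> ennreal (integral {c - L..c} H)" by (rule ennreal_leI)
  also have "\<dots> = (\<integral>\<^sup>+t. ennreal (H t) * indicator {c - L..c} t \<partial>lborel)"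
    using H0 by (intro nn_integral_has_integral_lebesgue'[symmetric] integrable_integral integrable_continuous_interval Hc)
  also have "\<dots> \<le> (\<integral>\<^sup>+t. ennreal (H t) \<partial>lborel)"
    by (intro nn_integral_mono) (auto simp: indicator_def)
  finally show ?thesis by (simp add: h_def H_def)
qed

lemma integrable_powr_test_function:
  assumes \<phi>: "\<phi> \<in> test_functions \<Omega>" and \<Omega>: "open \<Omega>" and s: "s > 0"
  shows "integrable lborel (\<lambda>x. \<bar>\<phi> x\<bar> powr s)" "integrable (lebesgue_on \<Omega>) (\<lambda>x. \<bar>\<phi> x\<bar> powr s)"
    "(LINT x|lebesgue_on \<Omega>. \<bar>\<phi> x\<bar> powr s) = (LINT x|lborel. \<bar>\<phi> x\<bar> powr s)"
proof -
  note t = test_functionsD[OF \<phi>]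
  have S: "\<Omega> \<in> sets lebesgue" using \<Omega> by (auto intro: borel_open)
  have c: "continuous_on UNIV (\<lambda>x. \<bar>\<phi> x\<bar> powr s)"
    by (intro continuous_abs_powr smooth_continuous t s)
  have 0: "\<bar>\<phi> x\<bar> powr s = 0" if "x \<notin> closure {x. \<phi> x \<noteq> 0}" for x
    using that closure_subset[of "{x. \<phi> x \<noteq> 0}"] by auto
  show "integrable lborel (\<lambda>x. \<bar>\<phi> x\<bar> powr s)" by (rule compact_support_integrable(1)[OF c t(2) 0])
  show "integrable (lebesgue_on \<Omega>) (\<lambda>x. \<bar>\<phi> x\<bar> powr s)" by (rule compact_support_integrable(2)[OF c t(2) 0 S])
  show "(LINT x|lebesgue_on \<Omega>. \<bar>\<phi> x\<bar> powr s) = (LINT x|lborel. \<bar>\<phi> x\<bar> powr s)"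
    using S by (intro integral_lebesgue_on_support borel_measurable_continuous_onI c) (auto simp: test_functions_outside[OF \<phi>])
qed

definition Sobolev_const :: "real \<Rightarrow> real" where
  "Sobolev_const N = (2 * (N - 1) / (N - 2))\<^sup>2"

text \<open>Absorbs the occurrence of \<open>X\<close> on the right-hand side of a sublinear bound.\<close>

lemma powr_absorb:
  fixes X D b :: real
  assumes "X \<ge> 0" "D \<ge> 0" "0 < b" "b < 1" "X \<le> (X * D) powr b"
  shows "X \<le> D powr (b / (1 - b))"
proof (cases "X = 0")
  case False
  then have X: "X > 0" using assms by simp
  have "X powr (1 - b) * X powr b \<le> D powr b * X powr b"
    using assms X by (simp add: powr_mult mult.commute flip: powr_add)
  then have "X powr (1 - b) \<le> D powr b" using X by simp
  then have "(X powr (1 - b)) powr (1 / (1 - b)) \<le> (D powr b) powr (1 / (1 - b))"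
    using assms by (intro powr_mono2) auto
  then show ?thesis using X assms by (simp add: powr_powr)
qed simp

text \<open>Apply the Gagliardo--Nirenberg inequality to \<open>|\<phi>|\<^sup>g\<close> and the Cauchy--Schwarz inequality to its gradient.
  The exponent \<open>g = 2 (N - 1) / (N - 2)\<close> is the one for which both sides contain the integral of
  \<open>|\<phi>|\<close> to the same, critical, power.\<close>

lemma Sobolev_test:
  fixes \<Omega> :: "(real^'n) set" and N :: real
  assumes \<phi>: "\<phi> \<in> test_functions \<Omega>" and \<Omega>: "open \<Omega>" and N: "N = real CARD('n)" "N > 2"
  shows "(LINT x|lebesgue_on \<Omega>. \<bar>\<phi> x\<bar> powr (2 * N / (N - 2)))
     \<le> (Sobolev_const N * (LINT x|lebesgue_on \<Omega>. (norm (grad \<phi> x))\<^sup>2)) powr (N / (N - 2))"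
proof -
  define s where "s = 2 * N / (N - 2)"
  define g where "g = 2 * (N - 1) / (N - 2)"
  have g: "g > 1" "g * (N / (N - 1)) = s" "2 * (g - 1) = s" "s > 0"
  proof -
    show "g > 1" "2 * (g - 1) = s" "s > 0" using N(2) by (auto simp: g_def s_def field_simps)
    have "2 * (N - 1) / (N - 2) * (N / (N - 1)) = (2 * N / (N - 2)) * ((N - 1) / (N - 1))"
      by (simp only: times_divide_times_eq mult_ac)
    moreover have "(N - 1) / (N - 1) = 1" using N(2) by simp
    ultimately show "g * (N / (N - 1)) = s" unfolding g_def s_def by (simp only: mult_1_right)
  qed
  note t = test_functionsD[OF \<phi>]
  note ip = integrable_powr_test_function[OF \<phi> \<Omega> g(4)]
  define X where "X = (LINT x|lebesgue_on \<Omega>. \<bar>\<phi> x\<bar> powr s)"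
  define E where "E = (LINT x|lebesgue_on \<Omega>. (norm (grad \<phi> x))\<^sup>2)"
  define F where "F x = g * \<bar>\<phi> x\<bar> powr (g - 1) * norm (grad \<phi> x)" for x
  have cg: "continuous_on UNIV (grad \<phi>)" by (rule continuous_grad[OF t(1)])
  have c\<phi>: "continuous_on UNIV \<phi>" by (rule smooth_continuous[OF t(1)])
  have Fc: "continuous_on UNIV F"
    unfolding F_def using g by (intro continuous_intros continuous_abs_powr cg c\<phi>) auto
  have Fsupp: "F x = 0" if "x \<notin> closure {x. \<phi> x \<noteq> 0}" for x
    using grad_outside_support[OF that] by (simp add: F_def)
  have F0: "F x \<ge> 0" for x using g by (simp add: F_def)
  have Fi: "integrable lborel F" by (rule compact_support_integrable(1)[OF Fc t(2) Fsupp])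
  have FY: "(LINT x|lborel. F x) = (LINT x|lebesgue_on \<Omega>. F x)"
    using \<Omega> t(3) Fsupp by (intro integral_lebesgue_on_support[symmetric] borel_measurable_continuous_onI Fc) (auto intro: borel_open)
  define Y where "Y = (LINT x|lborel. F x)"
  have dim: "real DIM(real^'n) = N" using N(1) by simp
  have "(\<integral>\<^sup>+x. epow (ennreal (\<bar>\<phi> x\<bar> powr g)) (real DIM(real^'n) / (real DIM(real^'n) - 1)) \<partial>lborel)
      \<le> epow (\<integral>\<^sup>+x. ennreal (F x) \<partial>lborel) (real DIM(real^'n) / (real DIM(real^'n) - 1))"
  proof (rule Gagliardo_Nirenberg)
    show "(\<lambda>x. ennreal (F x)) \<in> borel_measurable borel"
      using borel_measurable_continuous_onI[OF Fc] by measurable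
    show "(\<lambda>x. ennreal (\<bar>\<phi> x\<bar> powr g)) \<in> borel_measurable borel"
      using borel_measurable_continuous_onI[OF c\<phi>] by measurable
    show "DIM(real^'n) \<ge> 2" using N by simp
    fix y c and b :: "real^'n" assume "b \<in> Basis"
    then obtain i where "b = axis i 1" by (auto simp: Basis_vec_def)
    then show "ennreal (\<bar>\<phi> (y + c *\<^sub>R b)\<bar> powr g) \<le> (\<integral>\<^sup>+t. ennreal (F (y + t *\<^sub>R b)) \<partial>lborel)"
      unfolding F_def using abs_powr_le_line_integral[OF t(1,2) g(1)] by simp
  qed
  also have "(\<integral>\<^sup>+x. epow (ennreal (\<bar>\<phi> x\<bar> powr g)) (real DIM(real^'n) / (real DIM(real^'n) - 1)) \<partial>lborel) =
      (\<integral>\<^sup>+x. ennreal (\<bar>\<phi> x\<bar> powr s) \<partial>lborel)"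
  proof -
    have "epow (ennreal (y powr g)) (N / (N - 1)) = ennreal (y powr s)" for y
      using N(2) g(2) by (subst epow_ennreal) (simp_all only: powr_powr, auto)
    then show ?thesis unfolding dim by simp
  qed
  also have "\<dots> = ennreal X"
    unfolding X_def ip(3) by (intro nn_integral_eq_integral ip) auto
  also have "(\<integral>\<^sup>+x. ennreal (F x) \<partial>lborel) = ennreal Y"
    unfolding Y_def using F0 by (intro nn_integral_eq_integral Fi) auto
  also have "epow (ennreal Y) (real DIM(real^'n) / (real DIM(real^'n) - 1)) = ennreal (Y powr (N / (N - 1)))"
    unfolding dim using N(2) F0 by (intro epow_ennreal) (auto simp: Y_def)
  finally have XY: "X \<le> Y powr (N / (N - 1))" by simp
  have X0: "X \<ge> 0" and E0: "E \<ge> 0" and Y0: "Y \<ge> 0" using F0 by (auto simp: X_def E_def Y_def)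
  have sqr: "(norm (y powr (g - 1)))\<^sup>2 = y powr s" for y :: real
    using g(3) by (simp add: power2_eq_square flip: powr_add)
  have sq: "square_integrable \<Omega> (\<lambda>x. \<bar>\<phi> x\<bar> powr (g - 1))"
    unfolding square_integrable_def
  proof
    have "continuous_on UNIV (\<lambda>x. \<bar>\<phi> x\<bar> powr (g - 1))" using g by (intro continuous_abs_powr c\<phi>) auto
    then show "(\<lambda>x. \<bar>\<phi> x\<bar> powr (g - 1)) \<in> borel_measurable (lebesgue_on \<Omega>)"
      by (intro measurable_restrict_space1 measurable_completion) (simp add: borel_measurable_continuous_onI)
    show "integrable (lebesgue_on \<Omega>) (\<lambda>x. (norm (\<bar>\<phi> x\<bar> powr (g - 1)))\<^sup>2)"
      unfolding sqr by (rule ip(2))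
  qed
  have "(LINT x|lebesgue_on \<Omega>. norm (\<bar>\<phi> x\<bar> powr (g - 1)) * norm (grad \<phi> x))\<^sup>2
      \<le> (LINT x|lebesgue_on \<Omega>. (norm (\<bar>\<phi> x\<bar> powr (g - 1)))\<^sup>2) * E"
    unfolding E_def by (rule Cauchy_Schwarz_integral[OF sq test_function_L2(2)[OF \<phi> \<Omega>]])
  also have "(LINT x|lebesgue_on \<Omega>. (norm (\<bar>\<phi> x\<bar> powr (g - 1)))\<^sup>2) = X"
    unfolding X_def sqr ..
  finally have "g\<^sup>2 * (LINT x|lebesgue_on \<Omega>. \<bar>\<phi> x\<bar> powr (g - 1) * norm (grad \<phi> x))\<^sup>2 \<le> g\<^sup>2 * (X * E)"
    by (intro mult_left_mono) auto
  moreover have "Y = g * (LINT x|lebesgue_on \<Omega>. \<bar>\<phi> x\<bar> powr (g - 1) * norm (grad \<phi> x))"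
    unfolding Y_def FY F_def by (simp add: mult.assoc)
  ultimately have Y2: "Y\<^sup>2 \<le> X * (g\<^sup>2 * E)" by (simp add: power_mult_distrib mult_ac)
  define b where "b = N / (2 * (N - 1))"
  have b: "0 < b" "b < 1" "b / (1 - b) = N / (N - 2)" "2 * b = N / (N - 1)"
  proof -
    show "0 < b" "b < 1" "2 * b = N / (N - 1)" using N(2) by (auto simp: b_def field_simps)
    obtain c where c: "c = 2 * (N - 1)" "c > 0" using N(2) by auto
    have "b = N / c" "1 - b = (N - 2) / c" using c(2) by (simp_all add: b_def c(1) field_simps)
    then show "b / (1 - b) = N / (N - 2)" using c(2) by simp
  qed
  have "X \<le> (Y\<^sup>2) powr b"
    using XY Y0 unfolding b(4)[symmetric] by (cases "Y = 0") (auto simp: powr_powr simp flip: powr_numeral)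
  also have "\<dots> \<le> (X * (g\<^sup>2 * E)) powr b"
    using Y2 b by (intro powr_mono2) auto
  finally have "X \<le> (g\<^sup>2 * E) powr (b / (1 - b))"
    using X0 E0 b by (intro powr_absorb) auto
  then show ?thesis unfolding b(3) X_def E_def s_def by (simp add: Sobolev_const_def g_def)
qed

text \<open>The inequality passes to the closure by Fatou's lemma along an almost everywhere convergent
  subsequence.\<close>

lemma Sobolev:
  fixes \<Omega> :: "(real^'n) set" and N :: real
  assumes \<Omega>: "open \<Omega>" and u: "H01_pair \<Omega> u G" and N: "N = real CARD('n)" "N > 2"
  shows "integrable (lebesgue_on \<Omega>) (\<lambda>x. \<bar>u x\<bar> powr (2 * N / (N - 2)))"
    and "(LINT x|lebesgue_on \<Omega>. \<bar>u x\<bar> powr (2 * N / (N - 2)))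
     \<le> (Sobolev_const N * (LINT x|lebesgue_on \<Omega>. (norm (G x))\<^sup>2)) powr (N / (N - 2))"
proof -
  let ?M = "lebesgue_on \<Omega>"
  define s where "s = 2 * N / (N - 2)"
  have s: "s > 0" using N(2) by (simp add: s_def)
  define B where "B = (Sobolev_const N * (LINT x|?M. (norm (G x))\<^sup>2)) powr (N / (N - 2))"
  obtain \<phi>0 where \<phi>0: "\<And>k::nat. \<phi>0 k \<in> test_functions \<Omega>" "(\<lambda>k. L2dist \<Omega> u (\<phi>0 k)) \<longlonglongrightarrow> 0"
    "(\<lambda>k. L2dist \<Omega> G (grad (\<phi>0 k))) \<longlonglongrightarrow> 0" by (rule H01_pair_seq[OF u]) blast
  obtain r where r: "strict_mono (r::nat\<Rightarrow>nat)" "AE x in lebesgue_on \<Omega>. (\<lambda>k. \<phi>0 (r k) x) \<longlonglongrightarrow> u x"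
    using L2_AE_subseq[OF H01_pairD(1)[OF u] test_function_L2(1)[OF \<phi>0(1) \<Omega>] \<phi>0(2)] by blast
  define \<phi> where "\<phi> k = \<phi>0 (r k)" for k
  have \<phi>: "\<phi> k \<in> test_functions \<Omega>" for k by (simp add: \<phi>_def \<phi>0)
  have "(\<lambda>k. LINT x|?M. (norm (grad (\<phi>0 k) x))\<^sup>2) \<longlonglongrightarrow> (LINT x|?M. (norm (G x))\<^sup>2)"
    by (rule L2_tendsto_norm[OF H01_pairD(2)[OF u] test_function_L2(2)[OF \<phi>0(1) \<Omega>] \<phi>0(3)])
  from LIMSEQ_subseq_LIMSEQ[OF this r(1)]
  have gl: "(\<lambda>k. LINT x|?M. (norm (grad (\<phi> k) x))\<^sup>2) \<longlonglongrightarrow> (LINT x|?M. (norm (G x))\<^sup>2)" by (simp add: o_def \<phi>_def)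
  define B' where "B' k = (Sobolev_const N * (LINT x|?M. (norm (grad (\<phi> k) x))\<^sup>2)) powr (N / (N - 2))" for k
  have B'l: "B' \<longlonglongrightarrow> B"
    unfolding B'_def B_def using N(2)
    by (intro tendsto_powr' tendsto_intros gl) (auto simp: Sobolev_const_def intro!: always_eventually)
  have mu: "u \<in> borel_measurable ?M" by (rule L2_measurable[OF H01_pairD(1)[OF u]])
  have m\<phi>: "\<phi> k \<in> borel_measurable ?M" for k by (rule L2_measurable[OF test_function_L2(1)[OF \<phi> \<Omega>]])
  have "(\<integral>\<^sup>+x. ennreal (\<bar>u x\<bar> powr s) \<partial>?M) \<le> (\<integral>\<^sup>+x. liminf (\<lambda>k. ennreal (\<bar>\<phi> k x\<bar> powr s)) \<partial>?M)"
  proof (rule nn_integral_mono_AE)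
    show "AE x in ?M. ennreal (\<bar>u x\<bar> powr s) \<le> liminf (\<lambda>k. ennreal (\<bar>\<phi> k x\<bar> powr s))"
      using r(2)
    proof eventually_elim
      case (elim x)
      then have "(\<lambda>k. \<bar>\<phi> k x\<bar> powr s) \<longlonglongrightarrow> \<bar>u x\<bar> powr s"
        unfolding \<phi>_def using s by (intro tendsto_powr' tendsto_intros) auto
      then have "(\<lambda>k. ennreal (\<bar>\<phi> k x\<bar> powr s)) \<longlonglongrightarrow> ennreal (\<bar>u x\<bar> powr s)"
        by (rule tendsto_ennrealI)
      from lim_imp_Liminf[OF sequentially_bot this] show ?case by simp
    qed
  qed
  also have "\<dots> \<le> liminf (\<lambda>k. \<integral>\<^sup>+x. ennreal (\<bar>\<phi> k x\<bar> powr s) \<partial>?M)"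
    using m\<phi> by (intro nn_integral_liminf) auto
  also have "\<dots> \<le> liminf (\<lambda>k. ennreal (B' k))"
  proof (intro Liminf_mono always_eventually allI)
    fix k
    have "(\<integral>\<^sup>+x. ennreal (\<bar>\<phi> k x\<bar> powr s) \<partial>?M) = ennreal (LINT x|?M. \<bar>\<phi> k x\<bar> powr s)"
      by (intro nn_integral_eq_integral integrable_powr_test_function[OF \<phi> \<Omega> s]) auto
    also have "\<dots> \<le> ennreal (B' k)"
      unfolding B'_def s_def by (intro ennreal_leI Sobolev_test[OF \<phi> \<Omega> N])
    finally show "(\<integral>\<^sup>+x. ennreal (\<bar>\<phi> k x\<bar> powr s) \<partial>?M) \<le> ennreal (B' k)" .
  qed
  also have "\<dots> = ennreal B"
    by (rule lim_imp_Liminf[OF sequentially_bot tendsto_ennrealI[OF B'l]])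
  finally have le: "(\<integral>\<^sup>+x. ennreal (\<bar>u x\<bar> powr s) \<partial>?M) \<le> ennreal B" .
  have m: "(\<lambda>x. \<bar>u x\<bar> powr s) \<in> borel_measurable ?M" using mu by measurable
  have "(\<integral>\<^sup>+x. ennreal (\<bar>u x\<bar> powr s) \<partial>?M) < \<infinity>" using le by (auto intro: le_less_trans)
  then have i: "integrable ?M (\<lambda>x. \<bar>u x\<bar> powr s)"
    using m by (intro integrableI_nonneg) auto
  then show "integrable ?M (\<lambda>x. \<bar>u x\<bar> powr (2 * N / (N - 2)))" by (simp add: s_def)
  have "ennreal (LINT x|?M. \<bar>u x\<bar> powr s) \<le> ennreal B"
    using le nn_integral_eq_integral[OF i] by simp
  then show "(LINT x|?M. \<bar>u x\<bar> powr (2 * N / (N - 2))) \<le> (Sobolev_const N * (LINT x|?M. (norm (G x))\<^sup>2)) powr (N / (N - 2))"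
    by (simp add: B_def s_def ennreal_le_iff)
qed

section \<open>Bubbles and their projections\<close>

lemma bubble_eq:
  fixes \<xi> x :: "real^'n"
  assumes "\<delta> > 0" "N = real CARD('n)" "m = (N - 2) / 2"
  shows "bubble \<delta> \<xi> x = bubble_const N * \<delta> powr m * (\<delta>\<^sup>2 + (norm (x - \<xi>))\<^sup>2) powr (- m)"
  unfolding bubble_def Let_def assms(2,3) by (simp add: powr_minus_divide)

lemma bubble_const_pos: "N > 2 \<Longrightarrow> bubble_const N > 0"
  by (simp add: bubble_const_def)

lemma bubble_pos:
  fixes \<xi> x :: "real^'n"
  assumes "\<delta> > 0" "real CARD('n) > 2" shows "bubble \<delta> \<xi> x > 0"
proof -
  have "\<delta>\<^sup>2 + (norm (x - \<xi>))\<^sup>2 > 0" using assms by (simp add: add_pos_nonneg)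
  then show ?thesis using bubble_const_pos[OF assms(2)] assms(1)
    by (simp add: bubble_eq[OF assms(1) refl refl])
qed

lemma smooth_bubble:
  fixes \<xi> :: "real^'n" assumes "\<delta> > 0" shows "smooth (bubble \<delta> \<xi>)"
proof -
  have "smooth (\<lambda>x. bubble_const (real CARD('n)) * \<delta> powr ((real CARD('n) - 2) / 2) * (\<delta>\<^sup>2 + (norm (x - \<xi>))\<^sup>2) powr (- ((real CARD('n) - 2) / 2)))"
    using assms by (intro smooth_intros) (simp add: add_pos_nonneg)
  then show ?thesis by (simp add: bubble_eq[OF assms refl refl, abs_def])
qed

text \<open>The normalisation \<open>bubble_const\<close> turns the potential of the linearised equation into this rational
  function, in which the exponents depending on \<open>N\<close> have disappeared.\<close>

lemma bubble_powr_potential: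
  fixes \<xi> x :: "real^'n"
  assumes "\<delta> > 0" "N = real CARD('n)" "N > 2"
  shows "bubble \<delta> \<xi> x powr (4 / (N - 2)) = N * (N - 2) * \<delta>\<^sup>2 / (\<delta>\<^sup>2 + (norm (x - \<xi>))\<^sup>2)\<^sup>2"
proof -
  define D where "D = \<delta>\<^sup>2 + (norm (x - \<xi>))\<^sup>2"
  have D: "D > 0" using assms by (simp add: D_def add_pos_nonneg)
  have "bubble \<delta> \<xi> x powr (4 / (N - 2)) =
      (bubble_const N) powr (4 / (N - 2)) * (\<delta> powr ((N - 2) / 2)) powr (4 / (N - 2)) * (D powr (- ((N - 2) / 2))) powr (4 / (N - 2))"
    unfolding bubble_eq[OF assms(1,2) refl] D_def[symmetric] using bubble_const_pos[OF assms(3)]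
    by (simp add: powr_mult)
  also have "(bubble_const N) powr (4 / (N - 2)) = N * (N - 2)"
  proof -
    have "(N - 2) / 4 * (4 / (N - 2)) = 1" using assms(3) by simp
    then show ?thesis using assms(3) by (simp only: bubble_const_def powr_powr) simp
  qed
  also have "(\<delta> powr ((N - 2) / 2)) powr (4 / (N - 2)) = \<delta>\<^sup>2"
  proof -
    have "c / 2 * (4 / c) = 2" if "c > 0" for c :: real using that by simp
    from this[of "N - 2"] have "(N - 2) / 2 * (4 / (N - 2)) = 2" using assms(3) by simp
    then show ?thesis using assms(1) by (simp add: powr_powr)
  qed
  also have "(D powr (- ((N - 2) / 2))) powr (4 / (N - 2)) = 1 / D\<^sup>2"
  proof -
    have "- (c / 2) * (4 / c) = - 2" if "c > 0" for c :: real using that by simp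
    from this[of "N - 2"] have "- ((N - 2) / 2) * (4 / (N - 2)) = - 2" using assms(3) by simp
    then have "(D powr (- ((N - 2) / 2))) powr (4 / (N - 2)) = D powr (- 2)" by (simp only: powr_powr)
    also have "\<dots> = 1 / D\<^sup>2" using D by (simp add: powr_minus_divide)
    finally show ?thesis .
  qed
  finally show ?thesis by (simp add: D_def)
qed

lemma bubble_equation:
  fixes \<xi> x :: "real^'n"
  assumes \<delta>: "\<delta> > 0" and N: "N = real CARD('n)" "N > 2"
  shows "bubble \<delta> \<xi> x powr ((N + 2) / (N - 2)) = - laplacian (bubble \<delta> \<xi>) x"
proof -
  define m where "m = (N - 2) / 2"
  define C where "C = bubble_const N * \<delta> powr m"
  define t where "t = (norm (x - \<xi>))\<^sup>2"
  define D where "D = \<delta>\<^sup>2 + t"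
  have t0: "t \<ge> 0" by (simp add: t_def)
  have D: "D > 0" using \<delta> t0 by (simp add: D_def add_pos_nonneg)
  have Nm: "N = 2 * m + 2" "m > 0" using N by (auto simp: m_def field_simps)
  have pos: "\<delta>\<^sup>2 + s > 0" if "s \<ge> 0" for s using \<delta> that by (simp add: add_pos_nonneg)
  have bub: "bubble \<delta> \<xi> = (\<lambda>x. C * (\<delta>\<^sup>2 + (norm (x - \<xi>))\<^sup>2) powr (- m))"
    unfolding C_def using bubble_eq[OF \<delta> N(1) m_def] by (auto simp: fun_eq_iff)
  have "laplacian (bubble \<delta> \<xi>) x = 4 * t * (C * (- m) * (- m - 1) * D powr (- m - 1 - 1)) + 2 * CARD('n) * (C * (- m) * D powr (- m - 1))"
    unfolding bub t_def D_def
  proof (rule laplacian_radial)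
    fix s :: real assume "s \<ge> 0"
    then have "\<delta>\<^sup>2 + s > 0" by (rule pos)
    then have dp: "((\<lambda>s. (\<delta>\<^sup>2 + s) powr k) has_real_derivative k * (\<delta>\<^sup>2 + s) powr (k - 1)) (at s)" for k
      by (rule DERIV_chain2[OF has_real_derivative_powr, THEN DERIV_cong]) (auto intro!: derivative_eq_intros)
    show "((\<lambda>s. C * (\<delta>\<^sup>2 + s) powr - m) has_real_derivative C * (- m) * (\<delta>\<^sup>2 + s) powr (- m - 1)) (at s)"
      using DERIV_cmult[OF dp[of "- m"], of C] by (simp add: mult.assoc)
    show "((\<lambda>s. C * (- m) * (\<delta>\<^sup>2 + s) powr (- m - 1)) has_real_derivative C * (- m) * (- m - 1) * (\<delta>\<^sup>2 + s) powr (- m - 1 - 1)) (at s)"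
      using DERIV_cmult[OF dp[of "- m - 1"], of "C * (- m)"] by (simp only: mult.assoc)
  qed
  also have "D powr (- m - 1 - 1) = D powr (- m) / D\<^sup>2"
    using D by (simp only: powr_diff) (simp add: power2_eq_square)
  also have "D powr (- m - 1) = D powr (- m) / D\<^sup>2 * D"
    using D by (simp only: powr_diff) (simp add: power2_eq_square)
  finally have "- laplacian (bubble \<delta> \<xi>) x = (C * D powr (- m)) * (N * (N - 2) * \<delta>\<^sup>2 / D\<^sup>2)"
    using Nm(1) unfolding N(1) by (simp add: D_def algebra_simps add_divide_distrib)
  also have "C * D powr (- m) = bubble \<delta> \<xi> x" by (simp add: bub D_def t_def)
  also have "N * (N - 2) * \<delta>\<^sup>2 / D\<^sup>2 = bubble \<delta> \<xi> x powr (4 / (N - 2))"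
    unfolding bubble_powr_potential[OF \<delta> N] D_def t_def ..
  also have "bubble \<delta> \<xi> x * bubble \<delta> \<xi> x powr (4 / (N - 2)) = bubble \<delta> \<xi> x powr (1 + 4 / (N - 2))"
    using bubble_pos[OF \<delta>, of \<xi> x] N by (simp add: powr_add)
  also have "1 + 4 / (N - 2) = (N + 2) / (N - 2)" using N by (simp add: field_simps)
  finally show ?thesis by simp
qed

lemma bubble_antimono:
  fixes \<xi> x :: "real^'n"
  assumes "\<delta> > 0" "N = real CARD('n)" "N > 2" "m = (N - 2) / 2" "(norm (x - \<xi>))\<^sup>2 \<ge> t" "t \<ge> 0"
  shows "bubble \<delta> \<xi> x \<le> bubble_const N * \<delta> powr m * (\<delta>\<^sup>2 + t) powr (- m)"
  unfolding bubble_eq[OF assms(1,2,4)] using assms bubble_const_pos[OF assms(3)]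
  by (intro mult_left_mono powr_mono2') (auto simp: add_pos_nonneg)

lemma bubble_ge:
  fixes \<xi> x :: "real^'n"
  assumes "\<delta> > 0" "N = real CARD('n)" "N > 2" "m = (N - 2) / 2" "(norm (x - \<xi>))\<^sup>2 \<le> t"
  shows "bubble_const N * \<delta> powr m * (\<delta>\<^sup>2 + t) powr (- m) \<le> bubble \<delta> \<xi> x"
  unfolding bubble_eq[OF assms(1,2,4)] using assms bubble_const_pos[OF assms(3)]
  by (intro mult_left_mono powr_mono2') (auto simp: add_pos_nonneg)

text \<open>In units of its height \<open>\<delta>\<^sup>-\<^sup>m\<close> the profile depends only on the ratio \<open>r/\<delta>\<close>.\<close>

lemma bubble_profile:
  fixes \<delta> m r :: real
  assumes "\<delta> > 0" shows "\<delta> powr m * (\<delta>\<^sup>2 + r\<^sup>2) powr (- m) = \<delta> powr (- m) * (1 + (r / \<delta>)\<^sup>2) powr (- m)"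
proof -
  have "\<delta>\<^sup>2 + r\<^sup>2 = \<delta>\<^sup>2 * (1 + (r / \<delta>)\<^sup>2)" using assms by (simp add: field_simps)
  then have "(\<delta>\<^sup>2 + r\<^sup>2) powr (- m) = (\<delta>\<^sup>2) powr (- m) * (1 + (r / \<delta>)\<^sup>2) powr (- m)"
    by (simp add: powr_mult)
  also have "(\<delta>\<^sup>2) powr (- m) = \<delta> powr (- m) * \<delta> powr (- m)"
    using assms by (simp add: power2_eq_square powr_mult)
  finally show ?thesis using assms by (simp add: powr_minus field_simps)
qed

lemma bubble_le_height:
  fixes \<xi> x :: "real^'n"
  assumes "\<delta> > 0" "N = real CARD('n)" "N > 2" "m = (N - 2) / 2"
  shows "bubble \<delta> \<xi> x \<le> bubble_const N * \<delta> powr (- m)"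
  using bubble_antimono[OF assms, of 0 x \<xi>] bubble_profile[OF assms(1), of m 0] by (simp add: mult.assoc)

lemma laplacian_const_diff: "smooth f \<Longrightarrow> laplacian (\<lambda>x. c - f x) x = - laplacian f x"
proof -
  assume f: "smooth f"
  have p: "partial_deriv i (\<lambda>x. c - g x) = (\<lambda>x. - partial_deriv i g x)" if "smooth g" for g c and i :: 'a
    unfolding partial_deriv_def[of i g]
    by (rule ext, rule partial_derivI) (use smooth_has_derivative[OF that] in \<open>auto intro!: derivative_eq_intros\<close>)
  have "partial_deriv i (\<lambda>x. - partial_deriv i f x) = (\<lambda>x. - partial_deriv i (partial_deriv i f) x)" for i
    using p[OF smooth_partial_deriv[OF f], of i 0 i] by simp
  then show ?thesis by (simp add: laplacian_def p[OF f] sum_negf)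
qed

text \<open>All three bounds are comparisons with smooth functions: \<open>0\<close>, the bubble \<open>U\<close> itself, and \<open>U\<close> minus its
  value at distance \<open>d\<close> from the centre, which is nonpositive near the boundary.\<close>

lemma projected_bubble_bounds:
  fixes \<Omega> :: "(real^'n) set"
  assumes \<Omega>: "open \<Omega>" "bounded \<Omega>" and \<delta>: "\<delta> > 0" and N: "N = real CARD('n)" "N > 2"
    and P: "is_projected_bubble \<Omega> \<delta> \<xi> P"
  shows "AE x in lebesgue_on \<Omega>. P x \<ge> 0"
    and "AE x in lebesgue_on \<Omega>. P x \<le> bubble \<delta> \<xi> x"
    and "cball \<xi> d \<subseteq> \<Omega> \<Longrightarrow> d > 0 \<Longrightarrow> AE x in lebesgue_on \<Omega>.
       bubble \<delta> \<xi> x - bubble_const N * \<delta> powr ((N - 2) / 2) * (\<delta>\<^sup>2 + d\<^sup>2) powr (- ((N - 2) / 2)) \<le> P x"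
proof -
  define f where "f x = bubble \<delta> \<xi> x powr ((N + 2) / (N - 2))" for x
  have P': "dirichlet_solution \<Omega> f P"
    using P unfolding is_projected_bubble_def f_def[abs_def] N(1) .
  have f: "f x = - laplacian (bubble \<delta> \<xi>) x" for x unfolding f_def by (rule bubble_equation[OF \<delta> N])
  note mP = dirichlet_solution_uminus[OF \<Omega>(1) P']
  have pos: "bubble \<delta> \<xi> x \<ge> 0" for x using bubble_pos[OF \<delta>, of \<xi> x] N by simp
  have l0: "laplacian (\<lambda>x. 0) x = 0" for x :: "real^'n"
    using laplacian_const_diff[OF smooth_const[of 0], of 0 x] by simp
  have "AE x in lebesgue_on \<Omega>. - P x \<le> 0"
    by (rule weak_comparison[OF \<Omega> mP smooth_const[of 0], where K = "{}"]) (auto simp: l0 f_def)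
  then show "AE x in lebesgue_on \<Omega>. P x \<ge> 0" by eventually_elim simp
  show "AE x in lebesgue_on \<Omega>. P x \<le> bubble \<delta> \<xi> x"
    by (rule weak_comparison[OF \<Omega> P' smooth_bubble[OF \<delta>], where K = "{}"]) (auto simp: pos f)
  assume d: "cball \<xi> d \<subseteq> \<Omega>" "d > 0"
  define M where "M = bubble_const N * \<delta> powr ((N - 2) / 2) * (\<delta>\<^sup>2 + d\<^sup>2) powr (- ((N - 2) / 2))"
  have "AE x in lebesgue_on \<Omega>. - P x \<le> M - bubble \<delta> \<xi> x"
  proof (rule weak_comparison[OF \<Omega> mP _ compact_cball d(1)])
    show "smooth (\<lambda>x. M - bubble \<delta> \<xi> x)" by (intro smooth_intros smooth_bubble \<delta>)
    show "- f x \<le> - laplacian (\<lambda>x. M - bubble \<delta> \<xi> x) x" for x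
      by (simp add: laplacian_const_diff[OF smooth_bubble[OF \<delta>]] f)
    fix x assume "x \<notin> cball \<xi> d"
    then have "d\<^sup>2 \<le> (norm (x - \<xi>))\<^sup>2" using d(2) by (intro power_mono) (auto simp: dist_norm norm_minus_commute)
    from bubble_antimono[OF \<delta> N refl this] show "0 \<le> M - bubble \<delta> \<xi> x" by (simp add: M_def)
  qed
  then show "AE x in lebesgue_on \<Omega>.
       bubble \<delta> \<xi> x - bubble_const N * \<delta> powr ((N - 2) / 2) * (\<delta>\<^sup>2 + d\<^sup>2) powr (- ((N - 2) / 2)) \<le> P x"
    unfolding M_def by eventually_elim simp
qed

section \<open>The local estimate\<close>

text \<open>For \<open>u = v - U\<close> with \<open>v\<close> small compared to \<open>U\<close>, the left-hand side is \<open>(e + 1) U\<^sup>e v\<close> up to a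
  quadratic error, and by monotonicity larger \<open>u\<close> only help. The factor \<open>9/10\<close> pays for the error:
  \<open>(1 - 1/20)\<^sup>2 \<ge> 9/10\<close>.\<close>

lemma critical_nonlinearity_lower_bound:
  fixes U v u e :: real
  assumes e: "1 \<le> e" "e \<le> 2" and U: "U > 0" and v: "0 \<le> v" "v \<le> U / 20" and u: "u \<ge> v - U"
  shows "\<bar>u\<bar> powr e * u + U powr (e + 1) \<ge> 9/10 * (e + 1) * U powr e * v"
proof -
  have Up: "U powr (e + 1) = U powr e * U" using U by (simp add: powr_add)
  show ?thesis
  proof (cases "u \<ge> 0")
    case True
    have "9/10 * (e + 1) * v \<le> 9/10 * 3 * (U / 20)"
      using e v U by (intro mult_mono) auto
    also have "\<dots> \<le> U" using U by simp
    finally have "U powr e * (9/10 * (e + 1) * v) \<le> U powr e * U"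
      by (intro mult_left_mono) auto
    moreover have "0 \<le> \<bar>u\<bar> powr e * u" using True by simp
    ultimately show ?thesis unfolding Up by (simp add: mult_ac)
  next
    case False
    then have "\<bar>u\<bar> \<le> U - v" using u by simp
    then have "\<bar>u\<bar> powr (e + 1) \<le> (U - v) powr (e + 1)" using e by (intro powr_mono2) auto
    then have fu: "\<bar>u\<bar> powr e * u \<ge> - ((U - v) powr (e + 1))"
      using False by (simp add: powr_add)
    have mvt: "U powr (e + 1) - (U - v) powr (e + 1) \<ge> (e + 1) * (U - v) powr e * v"
    proof (cases "v = 0")
      case False
      then have vp: "U - v < U" "U - v > 0" using v U by auto
      have "\<exists>z. U - v < z \<and> z < U \<and> U powr (e + 1) - (U - v) powr (e + 1) = (U - (U - v)) * ((e + 1) * z powr e)"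
      proof (rule MVT2[OF vp(1)])
        fix z assume "U - v \<le> z" "z \<le> U"
        then show "((\<lambda>z. z powr (e + 1)) has_real_derivative (e + 1) * z powr e) (at z)"
          using vp has_real_derivative_powr[of z "e + 1"] by simp
      qed
      then obtain z where z: "z > U - v" "U powr (e + 1) - (U - v) powr (e + 1) = v * ((e + 1) * z powr e)" by auto
      have "(U - v) powr e \<le> z powr e" using z vp e by (intro powr_mono2) auto
      then have "v * ((e + 1) * (U - v) powr e) \<le> v * ((e + 1) * z powr e)"
        using v e by (intro mult_left_mono) auto
      then show ?thesis using z(2) by (simp add: mult_ac)
    qed simp
    have "9/10 * U powr e \<le> (19/20)\<^sup>2 * U powr e" by (intro mult_right_mono) (auto simp: power2_eq_square)
    also have "(19/20::real)\<^sup>2 = (19/20) powr 2" by simp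
    also have "\<dots> \<le> (19/20) powr e" using e by (intro powr_mono') auto
    also have "(19/20) powr e * U powr e = (19/20 * U) powr e" by (rule powr_mult[symmetric])
    also have "\<dots> \<le> (U - v) powr e" using v U e by (intro powr_mono2) auto
    finally have "9/10 * U powr e \<le> (U - v) powr e" by (simp add: mult_right_mono)
    then have "(e + 1) * v * (9/10 * U powr e) \<le> (e + 1) * v * (U - v) powr e"
      using e v by (intro mult_left_mono) auto
    with mvt fu show ?thesis by (simp add: mult_ac)
  qed
qed

text \<open>This says that the Gaussian \<open>exp (-|y|\<^sup>2)\<close>, whose Laplacian is \<open>4 t - 2 N\<close> times itself at
  \<open>t = |y|\<^sup>2\<close>, is a strict subsolution of the linearised equation at the bubble with \<open>\<delta> = 1\<close>, even with
  nine tenths of the potential.\<close>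

lemma radial_polynomial_bound:
  fixes N t :: real
  assumes "N \<in> {4, 5, 6}" "t \<ge> 0"
  shows "4 * t - 2 * N + 9/10 * N * (N + 2) / (1 + t)\<^sup>2 \<ge> 1/2"
proof -
  define s where "s = 1 + t"
  have s: "s \<ge> 1" using assms by (simp add: s_def)
  \<comment> \<open>the cubic is minimal at \<open>c = (4.5 + 2 N) / 6\<close>; up to a constant it is a product with a double root there\<close>
  have "4 * s^3 - (4.5 + 2 * N) * s\<^sup>2 + 9/10 * N * (N + 2) \<ge> 0"
  proof -
    have q: "0 \<le> 4 * s^3 - 6 * c * s\<^sup>2 + 2 * (c * c * c)" if "c > 0" for c
    proof -
      have "0 \<le> (s - c)\<^sup>2 * (4 * s + 2 * c)" using s that by (intro mult_nonneg_nonneg) auto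
      also have "\<dots> = 4 * s^3 - 6 * c * s\<^sup>2 + 2 * (c * c * c)"
        by (simp add: power2_eq_square power3_eq_cube algebra_simps)
      finally show ?thesis .
    qed
    consider "N = 4" | "N = 5" | "N = 6" using assms by auto
    then show ?thesis
    proof cases
      case 1
      show ?thesis unfolding 1 using q[of "25/12"] by simp
    next
      case 2
      show ?thesis unfolding 2 using q[of "29/12"] by simp
    next
      case 3
      show ?thesis unfolding 3 using q[of "33/12"] by simp
    qed
  qed
  then have "0 \<le> (4 * s^3 - (4.5 + 2 * N) * s\<^sup>2 + 9/10 * N * (N + 2)) / s\<^sup>2" by simp
  also have "\<dots> = 4 * s - (4.5 + 2 * N) + 9/10 * N * (N + 2) / s\<^sup>2"
    using s by (simp add: field_simps power2_eq_square power3_eq_cube)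
  finally show ?thesis by (simp add: s_def)
qed

text \<open>The same for the compactly supported function \<open>exp (- a\<^sup>2 / (a - t))\<close> with \<open>a = 1000\<close>, which for large
  \<open>a\<close> is close to a multiple of the Gaussian. Its logarithmic derivative is \<open>- \<rho>\<close>, where the Gaussian has
  \<open>- 1\<close>.\<close>

lemma radial_inequality:
  fixes N t \<rho> :: real
  assumes N: "N \<in> {4, 5, 6}" and t: "0 \<le> t" "t < 1000" and \<rho>: "\<rho> = (1000 / (1000 - t))\<^sup>2"
  shows "4 * t * \<rho>\<^sup>2 - 8 * t * \<rho> / (1000 - t) - 2 * N * \<rho> + 9/10 * N * (N + 2) / (1 + t)\<^sup>2 \<ge> 1/4"
proof -
  define V where "V = 9/10 * N * (N + 2) / (1 + t)\<^sup>2"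
  have V0: "V \<ge> 0" using N by (auto simp: V_def)
  have pb: "4 * t - 2 * N + V \<ge> 1/2" using radial_polynomial_bound[OF N t(1)] by (simp add: V_def)
  have \<rho>1: "\<rho> \<ge> 1" unfolding \<rho> using t by (intro one_le_power) (simp add: field_simps)
  have "1 / (1000 - t) \<le> \<rho> / 1000"
  proof -
    have "1 / (1000 - t) * 1 \<le> 1 / (1000 - t) * (1000 / (1000 - t))"
      using t by (intro mult_left_mono) (auto simp: field_simps)
    then show ?thesis by (simp add: \<rho> power2_eq_square)
  qed
  then have "8 * t * \<rho> * (1 / (1000 - t)) \<le> 8 * t * \<rho> * (\<rho> / 1000)"
    using t \<rho>1 by (intro mult_left_mono) auto
  then have "4 * t * \<rho>\<^sup>2 - 8 * t * \<rho> / (1000 - t) \<ge> 499/125 * t * \<rho>\<^sup>2"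
    by (simp add: power2_eq_square)
  moreover have "499/125 * t * \<rho>\<^sup>2 - 2 * N * \<rho> + V \<ge> 1/4"
  proof (cases "t \<le> 2")
    case True
    have "1000 / (1000 - t) \<le> 1000 / 998" using True by (intro divide_left_mono) auto
    then have "\<rho> \<le> (1000/998)\<^sup>2" unfolding \<rho> using t by (intro power_mono) auto
    then have "\<rho> \<le> 201/200" by (simp add: power2_eq_square)
    then have "2 * N * \<rho> \<le> 2 * N * (201/200)" using N by (intro mult_left_mono) auto
    moreover have "\<rho>\<^sup>2 \<ge> 1" using \<rho>1 by (simp add: one_le_power)
    then have "499/125 * t * \<rho>\<^sup>2 \<ge> 499/125 * t" using mult_left_mono[of 1 "\<rho>\<^sup>2" "499/125 * t"] t by simp
    moreover have "N \<le> 6" using N by auto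
    ultimately show ?thesis using pb True by linarith
  next
    case False
    have N6: "N \<le> 6" "N \<ge> 4" using N by auto
    have "0 \<le> (\<rho> - 1) * (499/125 * t * (\<rho> + 1) - 2 * N)"
    proof (intro mult_nonneg_nonneg)
      have "499/125 * 2 * 2 \<le> 499/125 * t * (\<rho> + 1)" using False \<rho>1 by (intro mult_mono) auto
      then show "0 \<le> 499/125 * t * (\<rho> + 1) - 2 * N" using N6 by linarith
    qed (use \<rho>1 in auto)
    also have "\<dots> = 499/125 * t * \<rho>\<^sup>2 - 499/125 * t - 2 * N * \<rho> + 2 * N"
    proof -
      have "(r - 1) * (k * (r + 1) - n) = k * r\<^sup>2 - k - n * r + n" for r k n :: real
        by (simp add: power2_eq_square algebra_simps)
      from this[of \<rho> "499/125 * t" "2 * N"] show ?thesis .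
    qed
    finally have "499/125 * t * \<rho>\<^sup>2 - 2 * N * \<rho> \<ge> 499/125 * t - 2 * N" by linarith
    moreover have "499/125 * t - 2 * N + V \<ge> 1/4"
    proof (cases "t \<le> 20")
      case True then show ?thesis using pb by linarith
    next
      case False then show ?thesis using V0 N6 by linarith
    qed
    ultimately show ?thesis by linarith
  qed
  ultimately show ?thesis unfolding V_def by linarith
qed

text \<open>The function \<open>exp (- a\<^sup>2 / (a - t))\<close> of \<open>t = |x - \<xi>|\<^sup>2 / \<delta>\<^sup>2\<close> with \<open>a = 1000\<close>; its support lies in the ball
  of radius \<open>32 \<delta>\<close>, since \<open>32\<^sup>2 > 1000\<close>.\<close>

definition core_test :: "real \<Rightarrow> real^'n \<Rightarrow> real^'n \<Rightarrow> real" where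
  "core_test \<delta> \<xi> x = flat 0 (1000\<^sup>2 * \<delta>\<^sup>2) (1000 * \<delta>\<^sup>2 - (norm (x - \<xi>))\<^sup>2)"

lemma core_test_nonneg: "core_test \<delta> \<xi> x \<ge> 0"
  by (simp add: core_test_def flat_def)

lemma core_test_outside: "x \<notin> cball \<xi> (32 * \<delta>) \<Longrightarrow> \<delta> > 0 \<Longrightarrow> core_test \<delta> \<xi> x = 0"
proof -
  assume x: "x \<notin> cball \<xi> (32 * \<delta>)" "\<delta> > 0"
  then have "(32 * \<delta>)\<^sup>2 \<le> (norm (x - \<xi>))\<^sup>2" by (intro power_mono) (auto simp: dist_norm norm_minus_commute)
  moreover have "(32 * \<delta>)\<^sup>2 = 1000 * \<delta>\<^sup>2 + 24 * \<delta>\<^sup>2" by (simp add: power_mult_distrib)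
  ultimately have "1000 * \<delta>\<^sup>2 - (norm (x - \<xi>))\<^sup>2 \<le> 0" using zero_le_power2[of \<delta>] by linarith
  then show ?thesis by (simp add: core_test_def flat_def)
qed

lemma core_test_test:
  assumes "\<delta> > 0" "cball \<xi> (32 * \<delta>) \<subseteq> \<Omega>" shows "core_test \<delta> \<xi> \<in> test_functions \<Omega>"
proof (rule test_functionsI[OF _ compact_cball assms(2)])
  show "smooth (core_test \<delta> \<xi>)" unfolding core_test_def[abs_def] using assms by (intro smooth_intros) auto
qed (use core_test_outside assms in auto)

text \<open>The linearised operator at a bubble has a negative eigenvalue. This test function exhibits it, in the
  pointwise form needed when only bounds on the function to be tested are known.\<close>

lemma core_test_subsolution:
  fixes \<xi> x :: "real^'n"
  assumes \<delta>: "\<delta> > 0" and N: "N = real CARD('n)" "N \<in> {4, 5, 6}"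
  shows "laplacian (core_test \<delta> \<xi>) x + 9/10 * ((N + 2) / (N - 2)) * bubble \<delta> \<xi> x powr (4 / (N - 2)) * core_test \<delta> \<xi> x
     \<ge> 1 / (4 * \<delta>\<^sup>2) * core_test \<delta> \<xi> x"
proof -
  define c where "c = 1000\<^sup>2 * \<delta>\<^sup>2"
  define A where "A = 1000 * \<delta>\<^sup>2"
  have c: "c > 0" using \<delta> by (simp add: c_def)
  define T where "T = (norm (x - \<xi>))\<^sup>2"
  have T0: "T \<ge> 0" by (simp add: T_def)
  have N2: "N > 2" using N by auto
  have lap: "laplacian (core_test \<delta> \<xi>) x =
      4 * T * (c * (c * flat 4 c (A - T) - 2 * flat 3 c (A - T))) + 2 * CARD('n) * (- (c * flat 2 c (A - T)))"
    unfolding T_def core_test_def[abs_def] c_def[symmetric] A_def[symmetric]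
  proof (rule laplacian_radial)
    fix s :: real
    show "((\<lambda>s. flat 0 c (A - s)) has_real_derivative - (c * flat 2 c (A - s))) (at s)"
      by (rule DERIV_chain2[OF flat_has_derivative[OF c], THEN DERIV_cong])
         (auto intro!: derivative_eq_intros simp: numeral_2_eq_2)
    have "((\<lambda>s. flat 2 c (A - s)) has_real_derivative (c * flat (2+2) c (A - s) - real 2 * flat (2+1) c (A - s)) * (- 1)) (at s)"
      by (rule DERIV_chain2[OF flat_has_derivative[OF c]]) (auto intro!: derivative_eq_intros)
    from DERIV_minus[OF DERIV_cmult[OF this, of c]]
    show "((\<lambda>s. - (c * flat 2 c (A - s))) has_real_derivative c * (c * flat 4 c (A - s) - 2 * flat 3 c (A - s))) (at s)"
      by (rule DERIV_cong) (simp add: algebra_simps eval_nat_numeral)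
  qed
  have pot: "9/10 * ((N + 2) / (N - 2)) * bubble \<delta> \<xi> x powr (4 / (N - 2)) = 9/10 * N * (N + 2) * \<delta>\<^sup>2 / (\<delta>\<^sup>2 + T)\<^sup>2"
  proof -
    have "9/10 * ((n + 2) / k) * (n * k * d / D) = 9/10 * n * (n + 2) * d / D" if "k > 0" for k n d D :: real
      using that by simp
    from this[of "N - 2" N] show ?thesis
      unfolding bubble_powr_potential[OF \<delta> N(1) N2] T_def using N2 by simp
  qed
  show ?thesis
  proof (cases "T < A")
    case False
    then show ?thesis unfolding lap by (simp add: core_test_def flat_def A_def[symmetric] T_def[symmetric])
  next
    case True
    define t where "t = T / \<delta>\<^sup>2"
    have Tt: "T = t * \<delta>\<^sup>2" using \<delta> by (simp add: t_def)
    have t: "0 \<le> t" "t < 1000" using True \<delta> T0 by (auto simp: t_def A_def field_simps)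
    define \<rho> where "\<rho> = (1000 / (1000 - t))\<^sup>2"
    define E where "E = core_test \<delta> \<xi> x"
    define s where "s = A - T"
    have s: "s = (1000 - t) * \<delta>\<^sup>2" "s > 0" using True by (auto simp: s_def A_def Tt algebra_simps)
    have flatk: "flat k c s = E / s ^ k" for k
      using s(2)[unfolded s_def A_def T_def] by (simp add: E_def core_test_def flat_def c_def A_def T_def s_def)
    have cs: "c / s\<^sup>2 = \<rho> / \<delta>\<^sup>2"
    proof -
      have "K\<^sup>2 * d / (w * d)\<^sup>2 = (K / w)\<^sup>2 / d" if "d > 0" for K w d :: real
        using that by (simp add: power_divide power_mult_distrib power2_eq_square)
      from this[of "\<delta>\<^sup>2" 1000 "1000 - t"] show ?thesis
        using \<delta> unfolding c_def s(1) \<rho>_def by simp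
    qed
    have E0: "E \<ge> 0" by (simp add: E_def core_test_nonneg)
    have "laplacian (core_test \<delta> \<xi>) x = E * (4 * T * ((c / s\<^sup>2)\<^sup>2 - 2 * (c / s\<^sup>2) / s) - 2 * N * (c / s\<^sup>2))"
      unfolding lap s_def[symmetric] flatk using s(2) N(1)
      by (simp add: field_simps power2_eq_square power3_eq_cube power4_eq_xxxx)
    also have "\<dots> = (1 / \<delta>\<^sup>2) * E * (4 * t * \<rho>\<^sup>2 - 8 * t * \<rho> / (1000 - t) - 2 * N * \<rho>)"
      unfolding cs unfolding s(1) Tt using \<delta> t by (simp add: field_simps power2_eq_square)
    finally have l: "laplacian (core_test \<delta> \<xi>) x = (1 / \<delta>\<^sup>2) * E * (4 * t * \<rho>\<^sup>2 - 8 * t * \<rho> / (1000 - t) - 2 * N * \<rho>)" .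
    have p: "9/10 * N * (N + 2) * \<delta>\<^sup>2 / (\<delta>\<^sup>2 + T)\<^sup>2 = (1 / \<delta>\<^sup>2) * (9/10 * N * (N + 2) / (1 + t)\<^sup>2)"
    proof -
      have sq: "(\<delta>\<^sup>2 + T)\<^sup>2 = \<delta>\<^sup>2 * \<delta>\<^sup>2 * (1 + t)\<^sup>2" by (simp add: Tt power2_eq_square algebra_simps)
      have gen: "K * d / (d * d * w) = (1 / d) * (K / w)" if "d > 0" for K w d :: real
        using that by simp
      show ?thesis unfolding sq by (rule gen) (use \<delta> in simp)
    qed
    have "(1 / \<delta>\<^sup>2) * E * (1/4) \<le> (1 / \<delta>\<^sup>2) * E * (4 * t * \<rho>\<^sup>2 - 8 * t * \<rho> / (1000 - t) - 2 * N * \<rho> + 9/10 * N * (N + 2) / (1 + t)\<^sup>2)"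
      using radial_inequality[OF N(2) t \<rho>_def] E0 by (intro mult_left_mono) auto
    then show ?thesis unfolding l pot p E_def[symmetric] by (simp add: algebra_simps)
  qed
qed

lemma core_test_integral_pos:
  assumes "\<delta> > 0" "cball \<xi> (32 * \<delta>) \<subseteq> \<Omega>" "open \<Omega>"
  shows "(LINT x|lebesgue_on \<Omega>. core_test \<delta> \<xi> x) > 0"
proof (rule ccontr)
  assume "\<not> ?thesis"
  moreover have "(LINT x|lebesgue_on \<Omega>. core_test \<delta> \<xi> x) \<ge> 0" by (simp add: core_test_nonneg)
  ultimately have 0: "(LINT x|lebesgue_on \<Omega>. core_test \<delta> \<xi> x) = 0" by simp
  have S: "\<Omega> \<in> sets lebesgue" using assms(3) by (auto intro: borel_open)
  have "AE x in lebesgue_on \<Omega>. core_test \<delta> \<xi> x = 0"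
    using 0 integral_nonneg_eq_0_iff_AE[OF integrable_test_function(2)[OF core_test_test[OF assms(1,2)] S]] core_test_nonneg by auto
  then have ae: "AE x in lebesgue. x \<in> \<Omega> \<longrightarrow> core_test \<delta> \<xi> x = 0" using S by (simp add: AE_restrict_space_iff)
  have pos: "core_test \<delta> \<xi> x > 0 \<and> x \<in> \<Omega>" if "x \<in> ball \<xi> \<delta>" for x
  proof -
    have "x \<in> cball \<xi> (32 * \<delta>)" using that assms(1) by auto
    moreover have "(norm (x - \<xi>))\<^sup>2 \<le> \<delta>\<^sup>2" using that by (intro power_mono) (auto simp: dist_norm norm_minus_commute)
    then have "1000 * \<delta>\<^sup>2 - (norm (x - \<xi>))\<^sup>2 > 0" using assms(1) zero_less_power[of \<delta> 2] by linarith
    ultimately show ?thesis using assms by (auto simp: core_test_def flat_def)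
  qed
  have "AE x in lebesgue. x \<notin> ball \<xi> \<delta>" using ae by eventually_elim (use pos in force)
  then have "negligible (ball \<xi> \<delta>)"
    by (simp add: negligible_iff_null_sets completion.null_sets_iff_AE)
  then show False using open_not_negligible[of "ball \<xi> \<delta>"] assms(1) by auto
qed

text \<open>On the core of the sharper bubble \<open>v = u + P\<close> is positive and small compared to \<open>U\<close>, and it is almost a
  supersolution of the linearised equation at \<open>-U\<close>, with an error of size \<open>l U\<close>. A positive supersolution
  is incompatible with the negative eigenvalue, so the error must dominate: testing with \<open>core_test\<close>
  bounds \<open>A / \<delta>\<^sup>2\<close> by a multiple of \<open>l\<close> times the height of \<open>U\<close>.\<close>

lemma local_estimate:
  fixes \<Omega> :: "(real^'n) set" and \<xi> :: "real^'n"
  assumes \<Omega>: "open \<Omega>" "bounded \<Omega>" and N: "N = real CARD('n)" "N \<in> {4, 5, 6}" and \<delta>: "\<delta> > 0" and l: "l > 0"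
    and ball: "cball \<xi> (32 * \<delta>) \<subseteq> \<Omega>"
    and u: "brezis_nirenberg_solution \<Omega> l u" and P: "is_projected_bubble \<Omega> \<delta> \<xi> P"
    and A: "A > 0" and lower: "AE x in lebesgue_on \<Omega>. x \<in> cball \<xi> (32 * \<delta>) \<longrightarrow> A \<le> u x + P x"
    and upper: "AE x in lebesgue_on \<Omega>. x \<in> cball \<xi> (32 * \<delta>) \<longrightarrow> u x + P x \<le> bubble \<delta> \<xi> x / 20"
  shows "A \<le> 4 * \<delta>\<^sup>2 * (l * bubble_const N * \<delta> powr (- ((N - 2) / 2)))"
proof (rule ccontr)
  let ?M = "lebesgue_on \<Omega>"
  assume neg: "\<not> ?thesis"
  define h where "h = bubble_const N * \<delta> powr (- ((N - 2) / 2))"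
  define k where "k = A / (4 * \<delta>\<^sup>2) - l * h"
  have k: "k > 0" using neg \<delta> by (simp add: k_def h_def field_simps)
  define e where "e = 4 / (N - 2)"
  have N2: "N > 2" using N by auto
  have e: "1 \<le> e" "e \<le> 2" "e + 1 = (N + 2) / (N - 2)" "critical_exponent N - 2 = e"
    using N(2) by (auto simp: e_def critical_exponent_def)
  define U where "U = bubble \<delta> \<xi>"
  have U: "U x > 0" for x using bubble_pos[OF \<delta>, of \<xi> x] N N2 by (simp add: U_def)
  define \<phi> where "\<phi> = core_test \<delta> \<xi>"
  have \<phi>: "\<phi> \<in> test_functions \<Omega>" unfolding \<phi>_def by (rule core_test_test[OF \<delta> ball])
  note s\<phi> = test_functionsD(1)[OF \<phi>]
  note p\<phi> = H01_pair_test[OF \<Omega>(1) \<phi>]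
  have u': "dirichlet_solution \<Omega> (\<lambda>x. l * u x + \<bar>u x\<bar> powr e * u x) u"
    using u unfolding brezis_nirenberg_solution_def N(1)[symmetric] e(4) .
  have P': "dirichlet_solution \<Omega> (\<lambda>x. U x powr (e + 1)) P"
    using P unfolding is_projected_bubble_def N(1)[symmetric] e(3) U_def .
  obtain G where G: "H01_pair \<Omega> u G" using u' H01_obtain_pair by (auto simp: dirichlet_solution_def)
  obtain H where H: "H01_pair \<Omega> P H" using P' H01_obtain_pair by (auto simp: dirichlet_solution_def)
  note du = dirichlet_solution_pair[OF \<Omega>(1) u' G p\<phi>] and dP = dirichlet_solution_pair[OF \<Omega>(1) P' H p\<phi>]
  note gu = Green_identity[OF \<Omega> G s\<phi>] and gP = Green_identity[OF \<Omega> H s\<phi>]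
  have S: "\<Omega> \<in> sets lebesgue" using \<Omega>(1) by (auto intro: borel_open)
  have i\<phi>: "integrable ?M \<phi>" by (rule integrable_test_function(2)[OF \<phi> S])
  \<comment> \<open>the sum of both equations, tested with \<open>\<phi>\<close>; its integral vanishes, but pointwise it is at least \<open>k \<phi>\<close>\<close>
  define I where "I x = (l * u x + \<bar>u x\<bar> powr e * u x) * \<phi> x + U x powr (e + 1) * \<phi> x + laplacian \<phi> x * u x + laplacian \<phi> x * P x" for x
  have iI: "integrable ?M I" unfolding I_def by (intro Bochner_Integration.integrable_add du dP gu gP)
  have I0: "(LINT x|?M. I x) = 0"
    unfolding I_def using du dP gu gP by simp
  have "(LINT x|?M. k * \<phi> x) \<le> (LINT x|?M. I x)"
  proof (rule integral_mono_AE)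
    show "integrable ?M (\<lambda>x. k * \<phi> x)" using i\<phi> by simp
    show "integrable ?M I" by (rule iI)
    have PU: "AE x in ?M. P x \<le> U x" unfolding U_def by (rule projected_bubble_bounds(2)[OF \<Omega> \<delta> N(1) N2 P])
    show "AE x in ?M. k * \<phi> x \<le> I x"
      using lower upper PU
    proof eventually_elim
      case (elim x)
      define v where "v = u x + P x"
      have eq: "I x = (l * u x) * \<phi> x + (\<bar>u x\<bar> powr e * u x + U x powr (e + 1)) * \<phi> x + laplacian \<phi> x * v"
        by (simp add: I_def v_def algebra_simps)
      show ?case
      proof (cases "x \<in> cball \<xi> (32 * \<delta>)")
        case False
        then have "x \<notin> closure {x. \<phi> x \<noteq> 0}"
        proof -
          have "{x. \<phi> x \<noteq> 0} \<subseteq> cball \<xi> (32 * \<delta>)"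
            using core_test_outside[OF _ \<delta>, of _ \<xi>] unfolding \<phi>_def by blast
          from closure_minimal[OF this closed_cball] have "closure {x. \<phi> x \<noteq> 0} \<subseteq> cball \<xi> (32 * \<delta>)" .
          then show ?thesis using False by blast
        qed
        moreover have "\<phi> x = 0" using core_test_outside[OF False \<delta>] by (simp add: \<phi>_def)
        moreover have "laplacian \<phi> x = 0"
          unfolding laplacian_def
        proof (intro sum.neutral ballI partial_deriv_outside_support)
          fix i
          show "x \<notin> closure {x. partial_deriv i \<phi> x \<noteq> 0}"
            using partial_deriv_support[of i \<phi>] \<open>x \<notin> closure {x. \<phi> x \<noteq> 0}\<close> by blast
        qed
        ultimately show ?thesis by (simp add: eq)
      next
        case True
        then have v: "A \<le> v" "v \<le> U x / 20" using elim by (auto simp: v_def U_def)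
        have v0: "v \<ge> 0" using v A by simp
        have \<phi>0: "\<phi> x \<ge> 0" by (simp add: \<phi>_def core_test_nonneg)
        have uv: "u x \<ge> v - U x" using elim(3) by (simp add: v_def)
        define q where "q = 9/10 * (e + 1) * U x powr e"
        define W where "W = \<bar>u x\<bar> powr e * u x + U x powr (e + 1)"
        define B where "B = 1 / (4 * \<delta>\<^sup>2)"
        have f1: "q * v * \<phi> x \<le> W * \<phi> x"
          using critical_nonlinearity_lower_bound[OF e(1,2) U v0 v(2) uv] \<phi>0 unfolding q_def W_def by (intro mult_right_mono)
        have f2: "(B * \<phi> x) * v \<le> (laplacian \<phi> x + q * \<phi> x) * v"
          using core_test_subsolution[OF \<delta> N, of \<xi> x, folded e_def e(3) \<phi>_def U_def B_def] v0 unfolding q_def by (intro mult_right_mono)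
        have f3: "(B * \<phi> x) * A \<le> (B * \<phi> x) * v"
          using v(1) \<phi>0 by (intro mult_left_mono) (auto simp: B_def)
        have f4: "- (l * h) * \<phi> x \<le> (l * u x) * \<phi> x"
        proof (intro mult_right_mono \<phi>0)
          have "- h \<le> u x"
            using uv v0 bubble_le_height[OF \<delta> N(1) N2 refl, of \<xi> x] by (simp add: U_def h_def)
          then have "l * (- h) \<le> l * u x" using l by (intro mult_left_mono) auto
          then show "- (l * h) \<le> l * u x" by simp
        qed
        have "(laplacian \<phi> x + q * \<phi> x) * v = laplacian \<phi> x * v + q * v * \<phi> x"
          "k * \<phi> x = (B * \<phi> x) * A + - (l * h) * \<phi> x"
          by (simp_all add: algebra_simps k_def B_def)
        then show ?thesis unfolding eq W_def[symmetric] using f1 f2 f3 f4 by linarith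
      qed
    qed
  qed
  then have "k * (LINT x|?M. \<phi> x) \<le> 0" using I0 by simp
  moreover have "(LINT x|?M. \<phi> x) > 0" unfolding \<phi>_def by (rule core_test_integral_pos[OF \<delta> ball \<Omega>(1)])
  ultimately show False using k by (simp add: mult_le_0_iff)
qed

section \<open>The energy of the positive part\<close>

lemma H01_norm_pair:
  assumes "open \<Omega>" "H01_pair \<Omega> u G"
  shows "(H01_norm \<Omega> u)\<^sup>2 = (LINT x|lebesgue_on \<Omega>. (norm (G x))\<^sup>2)"
proof -
  have S: "\<Omega> \<in> sets lebesgue" using assms(1) by (auto intro: borel_open)
  have ae: "AE x in lebesgue_on \<Omega>. (norm (G x))\<^sup>2 = (norm (weak_grad \<Omega> u x))\<^sup>2"
    using H01_pair_weak_grad[OF assms] by eventually_elim simp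
  have m: "(\<lambda>x. (norm (G x))\<^sup>2) \<in> borel_measurable (lebesgue_on \<Omega>)"
    using L2_measurable[OF H01_pairD(2)[OF assms(2)]] by measurable
  have "(LINT x|lebesgue_on \<Omega>. (norm (G x))\<^sup>2) = (LINT x|lebesgue_on \<Omega>. (norm (weak_grad \<Omega> u x))\<^sup>2)"
    by (intro integral_cong_AE m ae borel_measurable_lebesgue_on_cong_AE[OF S m ae])
  then show ?thesis by (simp add: H01_norm_def)
qed

lemma powr_sum_le:
  fixes a b s :: real
  assumes "a \<ge> 0" "b \<ge> 0" "s > 0"
  shows "(a + b) powr s \<le> 2 powr s * (a powr s + b powr s)"
proof -
  have "(a + b) powr s \<le> (2 * max a b) powr s" using assms by (intro powr_mono2) auto
  also have "\<dots> = 2 powr s * max a b powr s" using assms by (simp add: powr_mult)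
  also have "\<dots> \<le> 2 powr s * (a powr s + b powr s)"
    by (intro mult_left_mono) (auto simp: max_def)
  finally show ?thesis .
qed

text \<open>Testing the equation with \<open>u\<^sup>+\<close> shows that its energy \<open>E\<close> is the sum of its critical mass and of a
  term which the Poincare inequality bounds by \<open>E / 2\<close>. By Sobolev's inequality the critical mass is at
  most of order \<open>E\<close> to the power \<open>N / (N - 2) > 1\<close>, so \<open>E\<close> cannot be small unless it vanishes.\<close>

lemma positive_part_mass_lower_bound:
  fixes \<Omega> :: "(real^'n) set" and N :: real
  assumes \<Omega>: "open \<Omega>" "\<And>x. x \<in> \<Omega> \<Longrightarrow> norm x \<le> R" and N: "N = real CARD('n)" "N > 2"
    and l: "l > 0" "l * (4 * R\<^sup>2) \<le> 1/2"
    and u: "brezis_nirenberg_solution \<Omega> l u" and pos: "\<not> (AE x in lebesgue_on \<Omega>. u x \<le> 0)"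
  shows "(1 / (2 * Sobolev_const N powr (N / (N - 2)))) powr ((N - 2) / 2) / 2
      \<le> (LINT x|lebesgue_on \<Omega>. \<bar>max 0 (u x)\<bar> powr (2 * N / (N - 2)))"
    and "integrable (lebesgue_on \<Omega>) (\<lambda>x. \<bar>max 0 (u x)\<bar> powr (2 * N / (N - 2)))"
proof -
  let ?M = "lebesgue_on \<Omega>"
  define e where "e = critical_exponent N - 2"
  define s where "s = 2 * N / (N - 2)"
  define q where "q = N / (N - 2)"
  have es: "e + 2 = s" by (simp add: e_def s_def critical_exponent_def)
  have q1: "q - 1 = 2 / (N - 2)" "q > 1" using N(2) by (auto simp: q_def field_simps)
  have bdd: "bounded \<Omega>" using \<Omega>(2) by (auto simp: bounded_iff)
  have u': "dirichlet_solution \<Omega> (\<lambda>x. l * u x + \<bar>u x\<bar> powr e * u x) u"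
    using u unfolding brezis_nirenberg_solution_def N(1)[symmetric] e_def .
  obtain G where G: "H01_pair \<Omega> u G" using u' H01_obtain_pair by (auto simp: dirichlet_solution_def)
  define z where "z x = max 0 (u x)" for x
  define Z where "Z x = (if u x > 0 then 1 else 0) *\<^sub>R G x" for x
  have g0: "grad (\<lambda>x. 0) x = 0" for x :: "real^'n"
    using grad_outside_support[of x "\<lambda>x. 0"] by simp
  have zZ: "H01_pair \<Omega> z Z"
    using H01_pair_positive_part[OF \<Omega>(1) bdd G smooth_const[of 0], of "{}"] by (simp add: g0 z_def[abs_def] Z_def[abs_def])
  define E where "E = (LINT x|?M. (norm (Z x))\<^sup>2)"
  define X where "X = (LINT x|?M. \<bar>z x\<bar> powr s)"
  note Sob = Sobolev[OF \<Omega>(1) zZ N, folded s_def q_def]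
  show "integrable ?M (\<lambda>x. \<bar>max 0 (u x)\<bar> powr (2 * N / (N - 2)))"
    using Sob(1) by (simp add: z_def s_def)
  have "E = (LINT x|?M. G x \<bullet> Z x)"
    unfolding E_def by (intro Bochner_Integration.integral_cong) (auto simp: Z_def power2_norm_eq_inner)
  also have "\<dots> = (LINT x|?M. (l * u x + \<bar>u x\<bar> powr e * u x) * z x)"
    by (rule dirichlet_solution_pair(2)[OF \<Omega>(1) u' G zZ])
  also have "\<dots> = (LINT x|?M. l * (norm (z x))\<^sup>2 + \<bar>z x\<bar> powr s)"
  proof (intro Bochner_Integration.integral_cong refl)
    fix x
    have "\<bar>u x\<bar> powr e * u x * u x = \<bar>u x\<bar> powr s" if "u x > 0"
      using that by (simp add: powr_add power2_eq_square mult.assoc flip: es)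
    then show "(l * u x + \<bar>u x\<bar> powr e * u x) * z x = l * (norm (z x))\<^sup>2 + \<bar>z x\<bar> powr s"
      by (cases "u x > 0") (auto simp: z_def max_def algebra_simps power2_eq_square)
  qed
  also have "\<dots> = l * (LINT x|?M. (norm (z x))\<^sup>2) + X"
    unfolding X_def using L2_integrable[OF H01_pairD(1)[OF zZ]] Sob(1) by simp
  also have "l * (LINT x|?M. (norm (z x))\<^sup>2) \<le> l * (4 * R\<^sup>2 * E)"
    unfolding E_def using l by (intro mult_left_mono Poincare[OF \<Omega> zZ]) auto
  also have "l * (4 * R\<^sup>2 * E) = (l * (4 * R\<^sup>2)) * E" by simp
  also have "\<dots> \<le> 1/2 * E" using l by (intro mult_right_mono) (auto simp: E_def)
  finally have EX: "E / 2 \<le> X" by simp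
  have E0: "E > 0"
  proof (rule ccontr)
    assume "\<not> ?thesis"
    then have "AE x in ?M. z x = 0" unfolding E_def by (intro H01_pair_zero_gradient[OF \<Omega>(1) bdd zZ]) auto
    then have "AE x in ?M. u x \<le> 0" by eventually_elim (auto simp: z_def max_def split: if_splits)
    with pos show False by simp
  qed
  define S where "S = Sobolev_const N"
  have S: "S > 0" using N(2) by (simp add: S_def Sobolev_const_def)
  have "E / 2 \<le> (S * E) powr q" using EX Sob(2) by (simp add: X_def E_def S_def)
  also have "\<dots> = S powr q * (E powr (q - 1) * E)"
    using E0 S by (simp add: powr_mult powr_diff)
  finally have "E * 1 \<le> E * (2 * S powr q * E powr (q - 1))" by (simp add: mult_ac)
  then have "1 \<le> 2 * S powr q * E powr (q - 1)" using E0 by (simp only: mult_le_cancel_left_pos)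
  then have "1 / (2 * S powr q) \<le> E powr (q - 1)" using S by (simp add: field_simps)
  then have "(1 / (2 * S powr q)) powr ((N - 2) / 2) \<le> (E powr (q - 1)) powr ((N - 2) / 2)"
    using N(2) by (intro powr_mono2) auto
  also have "\<dots> = E"
  proof -
    have "2 / k * (k / 2) = 1" if "k > 0" for k :: real using that by simp
    from this[of "N - 2"] have "(q - 1) * ((N - 2) / 2) = 1" unfolding q1(1) using N(2) by simp
    then show ?thesis using E0 by (simp only: powr_powr) simp
  qed
  finally show "(1 / (2 * Sobolev_const N powr (N / (N - 2)))) powr ((N - 2) / 2) / 2
      \<le> (LINT x|lebesgue_on \<Omega>. \<bar>max 0 (u x)\<bar> powr (2 * N / (N - 2)))"
    using EX by (simp add: X_def z_def s_def S_def q_def)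
qed

text \<open>Since \<open>P2 \<ge> 0\<close> and \<open>P1\<close> is at most the height of its bubble, \<open>u \<le> b + |w|\<close>. Hence a low outer bubble and
  a small remainder would leave too little room for a positive part of \<open>u\<close>.\<close>

lemma energy_estimate:
  fixes \<Omega> :: "(real^'n) set" and N :: real
  assumes \<Omega>: "open \<Omega>" "\<And>x. x \<in> \<Omega> \<Longrightarrow> norm x \<le> R" and N: "N = real CARD('n)" "N > 2"
    and l: "l > 0" "l * (4 * R\<^sup>2) \<le> 1/2" and \<delta>: "\<delta>1 > 0" "\<delta>2 > 0"
    and u: "brezis_nirenberg_solution \<Omega> l u" and sc: "sign_changing \<Omega> u"
    and P1: "is_projected_bubble \<Omega> \<delta>1 \<xi> P1" and P2: "is_projected_bubble \<Omega> \<delta>2 \<xi> P2"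
    and w: "w = (\<lambda>x. u x - P1 x + P2 x)" and b: "bubble_const N * \<delta>1 powr (- ((N - 2) / 2)) \<le> b"
  shows "(1 / (2 * Sobolev_const N powr (N / (N - 2)))) powr ((N - 2) / 2) / 2
      \<le> 2 powr (2 * N / (N - 2)) * (b powr (2 * N / (N - 2)) * measure lebesgue \<Omega> +
          (Sobolev_const N * (H01_norm \<Omega> w)\<^sup>2) powr (N / (N - 2)))"
proof -
  let ?M = "lebesgue_on \<Omega>"
  define s where "s = 2 * N / (N - 2)"
  have s: "s > 0" using N(2) by (simp add: s_def)
  have bdd: "bounded \<Omega>" using \<Omega>(2) by (auto simp: bounded_iff)
  have S: "\<Omega> \<in> sets lebesgue" using \<Omega>(1) by (auto intro: borel_open)
  have lm: "\<Omega> \<in> lmeasurable" using bdd \<Omega>(1) by (simp add: lmeasurable_open)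
  have b0: "b \<ge> 0" using b bubble_const_pos[OF N(2)] by (meson less_imp_le mult_nonneg_nonneg order_trans powr_ge_zero)
  obtain G where G: "H01_pair \<Omega> u G" using u H01_obtain_pair by (auto simp: brezis_nirenberg_solution_def dirichlet_solution_def)
  obtain G1 where G1: "H01_pair \<Omega> P1 G1" using P1 H01_obtain_pair by (auto simp: is_projected_bubble_def dirichlet_solution_def)
  obtain G2 where G2: "H01_pair \<Omega> P2 G2" using P2 H01_obtain_pair by (auto simp: is_projected_bubble_def dirichlet_solution_def)
  define W where "W x = G x - G1 x + G2 x" for x
  have W: "H01_pair \<Omega> w W"
    using H01_pair_lincomb[OF \<Omega>(1) H01_pair_lincomb[OF \<Omega>(1) G G1, of 1 "-1"] G2, of 1 1]
    by (simp add: w W_def[abs_def])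
  note Sob = Sobolev[OF \<Omega>(1) W N, folded s_def H01_norm_pair[OF \<Omega>(1) W]]
  have np: "\<not> (AE x in ?M. u x \<le> 0)" using sc by (simp add: sign_changing_def)
  note lower = positive_part_mass_lower_bound[OF \<Omega> N l u np, folded s_def]
  have fin: "finite_measure ?M" using lm by (simp add: finite_measure_lebesgue_on)
  have ib: "integrable ?M (\<lambda>x. b powr s)" by (rule finite_measure.integrable_const[OF fin])
  have "(LINT x|?M. \<bar>max 0 (u x)\<bar> powr s) \<le> (LINT x|?M. 2 powr s * (b powr s + \<bar>w x\<bar> powr s))"
  proof (rule integral_mono_AE)
    show "integrable ?M (\<lambda>x. \<bar>max 0 (u x)\<bar> powr s)" by (rule lower(2))
    show "integrable ?M (\<lambda>x. 2 powr s * (b powr s + \<bar>w x\<bar> powr s))"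
      by (intro integrable_mult_right Bochner_Integration.integrable_add ib Sob(1))
    show "AE x in ?M. \<bar>max 0 (u x)\<bar> powr s \<le> 2 powr s * (b powr s + \<bar>w x\<bar> powr s)"
      using projected_bubble_bounds(2)[OF \<Omega>(1) bdd \<delta>(1) N P1] projected_bubble_bounds(1)[OF \<Omega>(1) bdd \<delta>(2) N P2]
    proof eventually_elim
      case (elim x)
      have "u x \<le> b + \<bar>w x\<bar>"
        using elim b bubble_le_height[OF \<delta>(1) N refl, of \<xi> x] by (simp add: w)
      then have "\<bar>max 0 (u x)\<bar> powr s \<le> (b + \<bar>w x\<bar>) powr s"
        using b0 s by (intro powr_mono2) auto
      also have "\<dots> \<le> 2 powr s * (b powr s + \<bar>w x\<bar> powr s)"
        using b0 s by (intro powr_sum_le) auto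
      finally show ?case .
    qed
  qed
  also have "\<dots> = 2 powr s * (b powr s * measure lebesgue \<Omega> + (LINT x|?M. \<bar>w x\<bar> powr s))"
    using ib Sob(1) S by (simp add: measure_restrict_space mult.commute)
  also have "\<dots> \<le> 2 powr s * (b powr s * measure lebesgue \<Omega> + (Sobolev_const N * (H01_norm \<Omega> w)\<^sup>2) powr (N / (N - 2)))"
    using Sob(2) by (intro mult_left_mono add_left_mono) auto
  finally show ?thesis using lower(1) by (simp add: s_def)
qed

section \<open>The contradiction at the inner scale\<close>

text \<open>For \<open>\<delta>1 \<le> D\<close> the projection \<open>P1\<close> near \<open>\<xi>\<close> lies between \<open>c\<close> times the height of its bubble and the
  height itself. As \<open>w\<close> is at most half of the lower bound, \<open>u + P2 = P1 + w\<close> satisfies the hypotheses of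
  \<open>local_estimate\<close> on the core of the second bubble. In the conclusion all powers cancel up to
  \<open>\<delta>2\<close> to the power \<open>2 - m\<close>, and \<open>m \<le> 2\<close> because \<open>N \<le> 6\<close>.\<close>

lemma inner_scale_estimate:
  fixes \<Omega> :: "(real^'n) set" and \<xi> :: "real^'n"
  assumes \<Omega>: "open \<Omega>" "bounded \<Omega>" and N: "N = real CARD('n)" "N \<in> {4, 5, 6}" and l: "l > 0"
    and \<delta>: "\<delta>1 > 0" "\<delta>2 > 0" "\<delta>1 \<le> D" and d: "d > 0" "cball \<xi> d \<subseteq> \<Omega>"
    and m: "m = (N - 2) / 2"
    and c: "c = (1 + (d / (2 * D))\<^sup>2) powr (- m) - (1 + (d / D)\<^sup>2) powr (- m)"
    and ratio: "\<delta>2 / \<delta>1 \<le> d / (64 * D)" "\<delta>2 / \<delta>1 \<le> 1" "40 * 1025 powr m * (\<delta>2 / \<delta>1) powr m \<le> 1"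
    and u: "brezis_nirenberg_solution \<Omega> l u"
    and P1: "is_projected_bubble \<Omega> \<delta>1 \<xi> P1" and P2: "is_projected_bubble \<Omega> \<delta>2 \<xi> P2"
    and w: "w = (\<lambda>x. u x - P1 x + P2 x)"
    and wb: "AE x in lebesgue_on (cball \<xi> d). \<bar>\<delta>1 powr m * w x\<bar> \<le> bubble_const N * c / 2"
  shows "c \<le> 8 * l * D\<^sup>2"
proof -
  let ?M = "lebesgue_on \<Omega>"
  define \<alpha> where "\<alpha> = bubble_const N"
  have N2: "N > 2" using N by auto
  have m1: "m \<ge> 1" "m \<le> 2" using N(2) by (auto simp: m)
  have \<alpha>: "\<alpha> > 0" unfolding \<alpha>_def by (rule bubble_const_pos[OF N2])
  have D: "D > 0" using \<delta> by simp
  have S: "\<Omega> \<in> sets lebesgue" using \<Omega>(1) by (auto intro: borel_open)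
  have "d / (2 * D) < d / D" using d D by (simp add: field_simps)
  then have "(d / (2 * D))\<^sup>2 < (d / D)\<^sup>2" using d D by (intro power_strict_mono) auto
  then have c0: "c > 0" unfolding c using m1 by (simp add: powr_less_mono2_neg add_pos_nonneg)
  have "(1 + (d / (2 * D))\<^sup>2) powr (- m) \<le> 1"
    using m1 powr_mono2'[of "- m" 1 "1 + (d / (2 * D))\<^sup>2"] by simp
  then have c1: "c \<le> 1" unfolding c using powr_ge_zero[of "1 + (d / D)\<^sup>2" "- m"] by linarith
  have r32: "32 * \<delta>2 / \<delta>1 \<le> d / (2 * D)" using ratio(1) by simp
  then have "32 * \<delta>2 \<le> d / (2 * D) * \<delta>1" using \<delta> by (simp add: field_simps)
  also have "\<dots> \<le> d / (2 * D) * D" using d D \<delta> by (intro mult_left_mono) auto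
  also have "\<dots> \<le> d" using d D by simp
  finally have "cball \<xi> (32 * \<delta>2) \<subseteq> cball \<xi> d" by (simp add: subset_cball)
  note sub = this
  have ballO: "cball \<xi> (32 * \<delta>2) \<subseteq> \<Omega>" using sub d(2) by blast
  define h where "h = \<delta>1 powr (- m)"
  have h: "h > 0" using \<delta> by (simp add: h_def)
  define A where "A = \<alpha> * c / 2 * h"
  have A: "A > 0" using \<alpha> c0 h by (simp add: A_def)
  have wb': "AE x in ?M. x \<in> cball \<xi> d \<longrightarrow> \<bar>w x\<bar> \<le> A"
  proof -
    have "AE x in lebesgue. x \<in> cball \<xi> d \<longrightarrow> \<bar>\<delta>1 powr m * w x\<bar> \<le> bubble_const N * c / 2"
      using wb by (subst (asm) AE_restrict_space_iff) auto
    then have "AE x in lebesgue. x \<in> \<Omega> \<longrightarrow> x \<in> cball \<xi> d \<longrightarrow> \<bar>w x\<bar> \<le> A"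
    proof eventually_elim
      case (elim x)
      have "\<bar>w x\<bar> = h * \<bar>\<delta>1 powr m * w x\<bar>"
        using \<delta> by (simp add: h_def abs_mult powr_minus field_simps)
      then show ?case using elim h by (simp add: A_def \<alpha>_def mult.commute[of h] mult_right_mono)
    qed
    then show ?thesis using S by (simp add: AE_restrict_space_iff)
  qed
  have low: "AE x in ?M. bubble \<delta>1 \<xi> x - \<alpha> * h * (1 + (d / \<delta>1)\<^sup>2) powr (- m) \<le> P1 x"
    using projected_bubble_bounds(3)[OF \<Omega> \<delta>(1) N(1) N2 P1 d(2,1), folded m] bubble_profile[OF \<delta>(1), of m d]
    by (simp add: \<alpha>_def h_def mult.assoc)
  have up: "AE x in ?M. P1 x \<le> \<alpha> * h"
    using projected_bubble_bounds(2)[OF \<Omega> \<delta>(1) N(1) N2 P1]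
  proof eventually_elim
    case (elim x)
    then show ?case using bubble_le_height[OF \<delta>(1) N(1) N2 m, of \<xi> x] by (simp add: \<alpha>_def h_def)
  qed
  have "A \<le> 4 * \<delta>2\<^sup>2 * (l * bubble_const N * \<delta>2 powr (- ((N - 2) / 2)))"
  proof (rule local_estimate[OF \<Omega> N \<delta>(2) l ballO u P2 A])
    show "AE x in ?M. x \<in> cball \<xi> (32 * \<delta>2) \<longrightarrow> A \<le> u x + P2 x"
      using wb' low
    proof eventually_elim
      case (elim x)
      show ?case
      proof
        assume x: "x \<in> cball \<xi> (32 * \<delta>2)"
        then have "(norm (x - \<xi>))\<^sup>2 \<le> (32 * \<delta>2)\<^sup>2" by (intro power_mono) (auto simp: dist_norm norm_minus_commute)
        from bubble_ge[OF \<delta>(1) N(1) N2 m this] have "\<alpha> * h * (1 + (32 * \<delta>2 / \<delta>1)\<^sup>2) powr (- m) \<le> bubble \<delta>1 \<xi> x"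
          using bubble_profile[OF \<delta>(1), of m "32 * \<delta>2"] by (simp add: \<alpha>_def h_def mult.assoc)
        moreover have "(1 + (d / (2 * D))\<^sup>2) powr (- m) \<le> (1 + (32 * \<delta>2 / \<delta>1)\<^sup>2) powr (- m)"
          using r32 \<delta> m1 by (intro powr_mono2' add_left_mono power_mono) (auto simp: add_pos_nonneg)
        then have "\<alpha> * h * (1 + (d / (2 * D))\<^sup>2) powr (- m) \<le> \<alpha> * h * (1 + (32 * \<delta>2 / \<delta>1)\<^sup>2) powr (- m)"
          using \<alpha> h by (intro mult_left_mono) auto
        moreover have "d / D \<le> d / \<delta>1" using \<delta> d D by (intro divide_left_mono) auto
        then have "(1 + (d / \<delta>1)\<^sup>2) powr (- m) \<le> (1 + (d / D)\<^sup>2) powr (- m)"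
          using d D m1 by (intro powr_mono2' add_left_mono power_mono) (auto simp: add_pos_nonneg)
        then have "\<alpha> * h * (1 + (d / \<delta>1)\<^sup>2) powr (- m) \<le> \<alpha> * h * (1 + (d / D)\<^sup>2) powr (- m)"
          using \<alpha> h by (intro mult_left_mono) auto
        ultimately have "\<alpha> * h * (1 + (d / (2 * D))\<^sup>2) powr (- m) - \<alpha> * h * (1 + (d / D)\<^sup>2) powr (- m) \<le> P1 x"
          using elim(2) by linarith
        then have "\<alpha> * h * c \<le> P1 x" unfolding c by (simp only: right_diff_distrib)
        moreover have "\<alpha> * h * c = A + A" by (simp add: A_def)
        moreover have "- A \<le> w x" using elim(1) x sub by auto
        ultimately show "A \<le> u x + P2 x" by (simp add: w)
      qed
    qed
    show "AE x in ?M. x \<in> cball \<xi> (32 * \<delta>2) \<longrightarrow> u x + P2 x \<le> bubble \<delta>2 \<xi> x / 20"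
      using wb' up
    proof eventually_elim
      case (elim x)
      show ?case
      proof
        assume x: "x \<in> cball \<xi> (32 * \<delta>2)"
        then have "(norm (x - \<xi>))\<^sup>2 \<le> (32 * \<delta>2)\<^sup>2" by (intro power_mono) (auto simp: dist_norm norm_minus_commute)
        from bubble_ge[OF \<delta>(2) N(1) N2 m this] have U2: "\<alpha> * \<delta>2 powr (- m) * 1025 powr (- m) \<le> bubble \<delta>2 \<xi> x"
          using bubble_profile[OF \<delta>(2), of m "32 * \<delta>2"] \<delta>(2) by (simp add: \<alpha>_def mult.assoc)
        have "40 * h \<le> \<delta>2 powr (- m) * 1025 powr (- m)"
          using ratio(3) \<delta> by (simp add: h_def powr_minus powr_divide field_simps)
        then have "\<alpha> * (40 * h) \<le> \<alpha> * (\<delta>2 powr (- m) * 1025 powr (- m))" using \<alpha> by (intro mult_left_mono) auto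
        then have "40 * (\<alpha> * h) \<le> bubble \<delta>2 \<xi> x" using U2 by (simp add: mult_ac)
        moreover have "\<alpha> * h * c \<le> \<alpha> * h * 1" using \<alpha> h c1 by (intro mult_left_mono) auto
        moreover have "\<alpha> * h * c = A + A" by (simp add: A_def)
        ultimately have "A \<le> \<alpha> * h" "40 * (\<alpha> * h) \<le> bubble \<delta>2 \<xi> x" using A by linarith+
        moreover have "w x \<le> A" using elim(1) x sub by auto
        ultimately show "u x + P2 x \<le> bubble \<delta>2 \<xi> x / 20" using elim(2) by (simp add: w)
      qed
    qed
  qed
  also have "\<dots> = \<alpha> * (4 * l * (\<delta>2 powr 2 * \<delta>2 powr (- m)))"
    using \<delta>(2) by (simp add: \<alpha>_def m)
  also have "\<delta>2 powr 2 * \<delta>2 powr (- m) = \<delta>2 powr (2 - m)" by (simp flip: powr_add)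
  also have "\<alpha> * (4 * l * \<delta>2 powr (2 - m)) \<le> \<alpha> * (4 * l * \<delta>1 powr (2 - m))"
    using \<alpha> l \<delta> ratio(2) m1 by (intro mult_left_mono powr_mono2) auto
  also have "\<delta>1 powr (2 - m) = \<delta>1\<^sup>2 * h"
    using \<delta>(1) by (simp add: h_def powr_diff powr_minus_divide)
  also have "\<alpha> * (4 * l * (\<delta>1\<^sup>2 * h)) \<le> \<alpha> * (4 * l * (D\<^sup>2 * h))"
    using \<alpha> l h \<delta> by (intro mult_left_mono mult_right_mono power_mono) auto
  finally have "(\<alpha> * h) * c \<le> (\<alpha> * h) * (8 * l * D\<^sup>2)" by (simp add: A_def mult_ac)
  then show ?thesis using \<alpha> h by simp
qed

theorem theorem1:
  fixes \<Omega> :: "(real^'n) set" and \<xi> :: "real^'n" and N :: real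
  assumes "CARD('n) \<in> {4, 5, 6}"
    and "N = real CARD('n)"
    and "smooth_bounded_domain \<Omega>"
    and "\<xi> \<in> \<Omega>"
  shows "\<not> (\<exists>(\<Lambda>::real set) (\<delta>1::real \<Rightarrow> real) (\<delta>2::real \<Rightarrow> real)
              (u::real \<Rightarrow> real^'n \<Rightarrow> real) (PU1::real \<Rightarrow> real^'n \<Rightarrow> real)
              (PU2::real \<Rightarrow> real^'n \<Rightarrow> real) (w::real \<Rightarrow> real^'n \<Rightarrow> real).
            \<Lambda> \<subseteq> {0<..} \<and> 0 islimpt \<Lambda> \<and>
            (\<forall>l\<in>\<Lambda>. \<delta>1 l > 0 \<and> \<delta>2 l > 0 \<and>
               brezis_nirenberg_solution \<Omega> l (u l) \<and> sign_changing \<Omega> (u l) \<and>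
               is_projected_bubble \<Omega> (\<delta>1 l) \<xi> (PU1 l) \<and>
               is_projected_bubble \<Omega> (\<delta>2 l) \<xi> (PU2 l) \<and>
               w l = (\<lambda>x. u l x - PU1 l x + PU2 l x)) \<and>
            ((\<lambda>l. \<delta>2 l / \<delta>1 l) \<longlongrightarrow> 0) (at 0 within \<Lambda>) \<and>
            ((\<lambda>l. H01_norm \<Omega> (w l)) \<longlongrightarrow> 0) (at 0 within \<Lambda>) \<and>
            (\<forall>K. compact K \<and> K \<subseteq> \<Omega> \<longrightarrow>
               ess_uniformly_null (at 0 within \<Lambda>) K
                 (\<lambda>l x. \<delta>1 l powr ((N - 2) / 2) * w l x) \<and>
               ess_uniformly_null (at 0 within \<Lambda>) K
                 (\<lambda>l x. \<delta>1 l powr (N / 2) *\<^sub>R weak_grad \<Omega> (w l) x)))"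
proof (rule notI, elim exE conjE)
  fix \<Lambda> :: "real set" and \<delta>1 \<delta>2 :: "real \<Rightarrow> real" and u P1 P2 w :: "real \<Rightarrow> real^'n \<Rightarrow> real"
  assume \<Lambda>: "\<Lambda> \<subseteq> {0<..}" "0 islimpt \<Lambda>"
    and fam: "\<forall>l\<in>\<Lambda>. \<delta>1 l > 0 \<and> \<delta>2 l > 0 \<and>
               brezis_nirenberg_solution \<Omega> l (u l) \<and> sign_changing \<Omega> (u l) \<and>
               is_projected_bubble \<Omega> (\<delta>1 l) \<xi> (P1 l) \<and>
               is_projected_bubble \<Omega> (\<delta>2 l) \<xi> (P2 l) \<and>
               w l = (\<lambda>x. u l x - P1 l x + P2 l x)"
    and ratio: "((\<lambda>l. \<delta>2 l / \<delta>1 l) \<longlongrightarrow> 0) (at 0 within \<Lambda>)"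
    and wnorm: "((\<lambda>l. H01_norm \<Omega> (w l)) \<longlongrightarrow> 0) (at 0 within \<Lambda>)"
    and wK: "\<forall>K. compact K \<and> K \<subseteq> \<Omega> \<longrightarrow>
               ess_uniformly_null (at 0 within \<Lambda>) K
                 (\<lambda>l x. \<delta>1 l powr ((N - 2) / 2) * w l x) \<and>
               ess_uniformly_null (at 0 within \<Lambda>) K
                 (\<lambda>l x. \<delta>1 l powr (N / 2) *\<^sub>R weak_grad \<Omega> (w l) x)"
  let ?F = "at 0 within \<Lambda>"
  have N: "N = real CARD('n)" "N \<in> {4, 5, 6}" "N > 2" using assms(1,2) by auto
  have \<Omega>: "open \<Omega>" "bounded \<Omega>" using assms(3) by (auto simp: smooth_bounded_domain_def)
  obtain R where R: "\<And>x. x \<in> \<Omega> \<Longrightarrow> norm x \<le> R" using \<Omega>(2) by (auto simp: bounded_iff)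
  define m where "m = (N - 2) / 2"
  have m: "m > 0" using N by (simp add: m_def)
  define s where "s = 2 * N / (N - 2)"
  define q where "q = N / (N - 2)"
  have sq: "s > 0" "q > 0" using N by (auto simp: s_def q_def)
  define \<alpha> where "\<alpha> = bubble_const N"
  have \<alpha>: "\<alpha> > 0" unfolding \<alpha>_def by (rule bubble_const_pos[OF N(3)])
  have inL: "\<forall>\<^sub>F l in ?F. l \<in> \<Lambda>" by (simp add: eventually_at_filter)
  have lim0: "((\<lambda>l. l) \<longlongrightarrow> 0) ?F" by (rule tendsto_ident_at)
  define \<epsilon>0 where "\<epsilon>0 = (1 / (2 * Sobolev_const N powr q)) powr ((N - 2) / 2) / 2"
  have S0: "Sobolev_const N > 0" using N(3) by (simp add: Sobolev_const_def)
  have \<epsilon>0: "\<epsilon>0 > 0" using S0 by (simp add: \<epsilon>0_def)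

  \<comment> \<open>a height \<open>b\<close> too small for \<open>energy_estimate\<close>, and a width \<open>D\<close> beyond which bubbles are lower than \<open>b\<close>\<close>
  define b where "b = (\<epsilon>0 / (4 * 2 powr s * (measure lebesgue \<Omega> + 1))) powr (1 / s)"
  have mO: "measure lebesgue \<Omega> \<ge> 0" by simp
  then have mp: "measure lebesgue \<Omega> + 1 > 0" by linarith
  have b0: "b > 0" using \<epsilon>0 less_imp_neq[OF mp] by (simp add: b_def)
  have bs: "2 powr s * (b powr s * measure lebesgue \<Omega>) \<le> \<epsilon>0 / 4"
  proof -
    have "b powr s = \<epsilon>0 / (4 * 2 powr s * (measure lebesgue \<Omega> + 1))"
      using \<epsilon>0 sq mp by (simp add: b_def powr_powr less_imp_le)
    then have "2 powr s * (b powr s * measure lebesgue \<Omega>) = \<epsilon>0 / 4 * (measure lebesgue \<Omega> / (measure lebesgue \<Omega> + 1))"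
      by simp
    also have "\<dots> \<le> \<epsilon>0 / 4 * 1" using \<epsilon>0 mp by (intro mult_left_mono) (auto simp: divide_le_eq)
    finally show ?thesis by simp
  qed
  define D where "D = (\<alpha> / b) powr (1 / m)"
  have D: "D > 0" using \<alpha> b0 by (simp add: D_def)
  have Db: "\<alpha> * \<delta> powr (- m) \<le> b" if "\<delta> \<ge> D" for \<delta>
  proof -
    have "\<delta> powr (- m) \<le> D powr (- m)" using that D m by (intro powr_mono2') auto
    also have "D powr (- m) = (\<alpha> / b) powr (- 1)" using m by (simp add: D_def powr_powr)
    also have "\<dots> = b / \<alpha>" using \<alpha> b0 by (simp add: powr_minus_divide)
    finally show ?thesis using \<alpha> by (simp add: field_simps)
  qed

  have "((\<lambda>l. 2 powr s * (Sobolev_const N * (H01_norm \<Omega> (w l))\<^sup>2) powr q) \<longlongrightarrow> 2 powr s * (Sobolev_const N * 0\<^sup>2) powr q) ?F"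
    using S0 sq by (intro tendsto_intros tendsto_powr' wnorm) (auto intro!: always_eventually)
  then have "((\<lambda>l. 2 powr s * (Sobolev_const N * (H01_norm \<Omega> (w l))\<^sup>2) powr q) \<longlongrightarrow> 0) ?F"
    using sq by simp
  then have ev1: "\<forall>\<^sub>F l in ?F. 2 powr s * (Sobolev_const N * (H01_norm \<Omega> (w l))\<^sup>2) powr q < \<epsilon>0 / 4"
    using \<epsilon>0 by (intro order_tendstoD(2)) auto
  have "((\<lambda>l. l * (4 * R\<^sup>2)) \<longlongrightarrow> 0 * (4 * R\<^sup>2)) ?F" by (intro tendsto_intros lim0)
  then have ev2: "\<forall>\<^sub>F l in ?F. l * (4 * R\<^sup>2) < 1/2" by (intro order_tendstoD(2)) auto
  have small: "\<forall>\<^sub>F l in ?F. \<delta>1 l \<le> D"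
    using inL ev1 ev2
  proof eventually_elim
    case (elim l)
    show ?case
    proof (rule ccontr)
      assume "\<not> \<delta>1 l \<le> D"
      then have bb: "bubble_const N * \<delta>1 l powr (- ((N - 2) / 2)) \<le> b" using Db[of "\<delta>1 l"] by (simp add: \<alpha>_def m_def)
      have l: "l > 0" using elim(1) \<Lambda> by auto
      have f: "\<delta>1 l > 0" "\<delta>2 l > 0" "brezis_nirenberg_solution \<Omega> l (u l)" "sign_changing \<Omega> (u l)"
        "is_projected_bubble \<Omega> (\<delta>1 l) \<xi> (P1 l)" "is_projected_bubble \<Omega> (\<delta>2 l) \<xi> (P2 l)" "w l = (\<lambda>x. u l x - P1 l x + P2 l x)"
        using fam elim(1) by auto
      have "\<epsilon>0 \<le> 2 powr s * (b powr s * measure lebesgue \<Omega> + (Sobolev_const N * (H01_norm \<Omega> (w l))\<^sup>2) powr q)"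
        using energy_estimate[OF \<Omega>(1) R N(1,3) l less_imp_le[OF elim(3)] f(1-7) bb] unfolding \<epsilon>0_def s_def q_def .
      also have "\<dots> = 2 powr s * (b powr s * measure lebesgue \<Omega>) + 2 powr s * (Sobolev_const N * (H01_norm \<Omega> (w l))\<^sup>2) powr q"
        by (simp add: algebra_simps)
      finally show False using bs elim(2) \<epsilon>0 by linarith
    qed
  qed

  \<comment> \<open>now \<open>\<delta>1 \<le> D\<close> near \<open>0\<close>, and the hypotheses of \<open>inner_scale_estimate\<close> hold there, but not its conclusion\<close>
  obtain d where d: "d > 0" "cball \<xi> d \<subseteq> \<Omega>" using \<Omega>(1) assms(4) by (auto simp: open_contains_cball)
  define c where "c = (1 + (d / (2 * D))\<^sup>2) powr (- m) - (1 + (d / D)\<^sup>2) powr (- m)"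
  have "d / (2 * D) < d / D" using d D by (simp add: field_simps)
  then have "(d / (2 * D))\<^sup>2 < (d / D)\<^sup>2" using d D by (intro power_strict_mono) auto
  then have c0: "c > 0" unfolding c_def using m by (simp add: powr_less_mono2_neg add_pos_nonneg)
  have ev3: "\<forall>\<^sub>F l in ?F. \<delta>2 l / \<delta>1 l < d / (64 * D)" "\<forall>\<^sub>F l in ?F. \<delta>2 l / \<delta>1 l < 1"
    using order_tendstoD(2)[OF ratio] d D by auto
  have "((\<lambda>l. 40 * 1025 powr m * (\<delta>2 l / \<delta>1 l) powr m) \<longlongrightarrow> 40 * 1025 powr m * 0 powr m) ?F"
  proof (intro tendsto_intros tendsto_powr' ratio)
    show "0 \<noteq> (0::real) \<or> 0 < m \<and> (\<forall>\<^sub>F l in ?F. 0 \<le> \<delta>2 l / \<delta>1 l)"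
      using m inL by (auto elim!: eventually_mono simp: fam less_imp_le)
  qed
  then have ev4: "\<forall>\<^sub>F l in ?F. 40 * 1025 powr m * (\<delta>2 l / \<delta>1 l) powr m < 1"
    by (intro order_tendstoD(2)) auto
  have ev5: "\<forall>\<^sub>F l in ?F. AE x in lebesgue_on (cball \<xi> d). norm (\<delta>1 l powr ((N - 2) / 2) * w l x) \<le> \<alpha> * c / 2"
    using wK d(2) \<alpha> c0 unfolding ess_uniformly_null_def by (meson compact_cball half_gt_zero mult_pos_pos)
  have "((\<lambda>l. 8 * l * D\<^sup>2) \<longlongrightarrow> 8 * 0 * D\<^sup>2) ?F" by (intro tendsto_intros lim0)
  then have ev6: "\<forall>\<^sub>F l in ?F. 8 * l * D\<^sup>2 < c" using c0 by (intro order_tendstoD(2)) auto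
  have "\<forall>\<^sub>F l in ?F. False"
    using inL small ev3 ev4 ev5 ev6
  proof eventually_elim
    case (elim l)
    have l: "l > 0" using elim(1) \<Lambda> by auto
    have f: "\<delta>1 l > 0" "\<delta>2 l > 0" "brezis_nirenberg_solution \<Omega> l (u l)"
      "is_projected_bubble \<Omega> (\<delta>1 l) \<xi> (P1 l)" "is_projected_bubble \<Omega> (\<delta>2 l) \<xi> (P2 l)" "w l = (\<lambda>x. u l x - P1 l x + P2 l x)"
      using fam elim(1) by auto
    have "c \<le> 8 * l * D\<^sup>2"
      using elim(6) by (intro inner_scale_estimate[OF \<Omega> N(1,2) l f(1,2) elim(2) d m_def c_def
          less_imp_le[OF elim(3)] less_imp_le[OF elim(4)] less_imp_le[OF elim(5)] f(3-6)]) (simp add: m_def \<alpha>_def)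
    with elim(7) show False by simp
  qed
  then have "?F = bot" by (simp only: eventually_False)
  then show False using \<Lambda>(2) trivial_limit_within[of 0 \<Lambda>] by blast
qed

end
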